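(* Let $\mathbb{F}$ be a field of characteristic $0$ and let $\widetilde{\mathcal{SV}}$ be the extended Schrödinger-Virasoro Lie conformal algebra, i.e. the free $\mathbb{F}[\partial]$-module on $L,M,Y,N$ with non-zero $\lambda$-brackets on generators $[L_\lambda L]=(\partial+2\lambda)L$, $[L_\lambda M]=(\partial+\lambda)M$, $[L_\lambda Y]=(\partial+\tfrac32\lambda)Y$, $[M_\lambda L]=\lambda M$, $[Y_\lambda L]=(\tfrac12\partial+\tfrac32\lambda)Y$, $[Y_\lambda Y]=(\partial+2\lambda)M$, $[L_\lambda N]=(\partial+\lambda)N$, $[N_\lambda L]=\lambda N$, $[N_\lambda M]=2M$, $[M_\lambda N]=-2M$, $[N_\lambda Y]=Y$, $[Y_\lambda N]=-Y$. Then the basic and reduced cohomology of $\widetilde{\mathcal{SV}}$ with coefficients in its adjoint module vanish in all degrees: $$\widetilde{\mathrm{H}}^\bullet(\widetilde{\mathcal{SV}},\widetilde{\mathcal{SV}})=\mathrm{H}^\bullet(\widetilde{\mathcal{SV}},\widetilde{\mathcal{SV}})=0.$$ As a result, every Casimir element of $\widetilde{\mathcal{SV}}$ is trivial (zero) and every derivation of $\widetilde{\mathcal{SV}}$ is inner.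
   Context: Lie conformal algebra (LCA): an $\mathbb{F}[\partial]$-module $\mathcal{A}$ with an $\mathbb{F}$-bilinear $\lambda$-bracket $\mathcal{A}\otimes\mathcal{A}\to\mathcal{A}[\lambda]$, $a\otimes b\mapsto[a_\lambda b]$, such that $[\partial a_\lambda b]=-\lambda[a_\lambda b]$, $[a_\lambda\partial b]=(\partial+\lambda)[a_\lambda b]$, $[a_\lambda b]=-[b_{-\lambda-\partial}a]$, and $[a_\lambda[b_\mu c]]=[[a_\lambda b]_{\lambda+\mu}c]+[b_\mu[a_\lambda c]]$. The $\lambda$-bracket on $\mathbb{F}[\partial]$-generators determines it everywhere. An $\mathcal{A}$-module is an $\mathbb{F}[\partial]$-module $V$ with an $\mathbb{F}$-bilinear $\lambda$-action $a\otimes v\mapsto a_\lambda v\in V[\lambda]$ such that $(\partial a)_\lambda v=-\lambda a_\lambda v$, $a_\lambda(\partial v)=(\partial+\lambda)a_\lambda v$, $a_\lambda(b_\mu v)-b_\mu(a_\lambda v)=[a_\lambda b]_{\lambda+\mu}v$. The adjoint module is $V=\mathcal{A}$ with $a_\lambda v=[a_\lambda v]$. Write $\partial^V$ for the action of $\partial$ on $V$. Basic complex: for $q\ge 1$, $\widetilde{C}^q(\mathcal{A},V)$ is the space of $\mathbb{F}$-linear maps $f:\mathcal{A}^{\otimes q}\to V[\lambda_1,\dots,\lambda_q]$, $a_1\otimes\cdots\otimes a_q\mapsto f_{\lambda_1,\dots,\lambda_q}(a_1,\dots,a_q)$, with $f_{\lambda_1,\dots,\lambda_q}(a_1,\dots,\partial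 a_i,\dots,a_q)=-\lambda_i f_{\lambda_1,\dots,\lambda_q}(a_1,\dots,a_q)$ for all $i$, and skew-symmetric under simultaneous permutations of the $a_i$ and the $\lambda_i$. Also $\widetilde{C}^0(\mathcal{A},V)=V$. The differential is $$(\mathbf{d}f)_{\lambda_1,\dots,\lambda_{q+1}}(a_1,\dots,a_{q+1})=\sum_{k}(-1)^{k+1}a_{k\,\lambda_k}f_{\lambda_1,\dots,\hat\lambda_k,\dots,\lambda_{q+1}}(a_1,\dots,\hat a_k,\dots,a_{q+1})+\sum_{k<l}(-1)^{k+l}f_{\lambda_k+\lambda_l,\lambda_1,\dots,\hat\lambda_k,\dots,\hat\lambda_l,\dots,\lambda_{q+1}}([a_{k\,\lambda_k}a_l],a_1,\dots,\hat a_k,\dots,\hat a_l,\dots,a_{q+1}),$$ with $(\mathbf{d}v)_\lambda(a)=a_\lambda v$ for $v\in V$; hats denote omission, and polynomial coefficients in the $\lambda$'s are extended linearly. One has $\mathbf{d}^2=0$. Define $(\partial f)_{\lambda_1,\dots,\lambda_q}(a_1,\dots,a_q)=(\partial^V+\sum_{k=1}^q\lambda_k)f_{\lambda_1,\dots,\lambda_q}(a_1,\dots,a_q)$; then $\mathbf{d}\partial=\partial\mathbf{d}$. The reduced complex is $C^\bullet(\mathcal{A},V)=\widetilde{C}^\bullet(\mathcal{A},V)/\partial\widetilde{C}^\bullet(\mathcal{A},V)$. The basic cohomology $\widetilde{\mathrm{H}}^\bullet(\mathcal{A},V)$ is the cohomology of $\widetilde{C}^\bullet(\mathcal{A},V)$;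 the reduced cohomology $\mathrm{H}^\bullet(\mathcal{A},V)$ is the cohomology of $C^\bullet(\mathcal{A},V)$. A Casimir element of $\mathcal{A}$ is a class $\int a\in\mathcal{A}/\partial\mathcal{A}$ (with $\int:\mathcal{A}\to\mathcal{A}/\partial\mathcal{A}$ the quotient map) such that $[a_\lambda b]|_{\lambda=0}=0$ for all $b\in\mathcal{A}$. A derivation of $\mathcal{A}$ is an $\mathbb{F}[\partial]$-module endomorphism $D$ with $D([a_\lambda b])=[a_\lambda D(b)]+[D(a)_\lambda b]$; it is inner if it has the form $b\mapsto[a_\lambda b]|_{\lambda=0}$ for some $a\in\mathcal{A}$. *)

theory Defs
  imports
    "HOL-Library.Poly_Mapping"
    "HOL-Computational_Algebra.Polynomial"
    "HOL-Combinatorics.Permutations"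
    "HOL-Analysis.Finite_Cartesian_Product"
    "HOL-Algebra.Elementary_Groups"
begin

section \<open>Polynomials in the variables \<open>\<lambda>\<^sub>0, \<lambda>\<^sub>1, \<dots>\<close> with coefficients in a module\<close>

text \<open>
  An element of \<open>V[\<lambda>\<^sub>0, \<lambda>\<^sub>1, \<dots>]\<close> is a finitely supported map from exponents to \<open>V\<close>.
  An \<open>F[\<partial>]\<close>-module is a module in the sense of \<^locale>\<open>module\<close> over the ring \<^typ>\<open>'f poly\<close>,
  the polynomial variable being \<open>\<partial>\<close>; thus \<open>\<partial> v\<close> is \<open>sc [:0, 1:] v\<close> and the multiple of \<open>v\<close>
  by the scalar \<open>c\<close> is \<open>sc [:c:] v\<close>.  If \<open>V\<close> is an \<open>F[\<partial>]\<close>-module then \<open>V[\<lambda>\<^sub>0, \<lambda>\<^sub>1, \<dots>]\<close> is a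
  module over \<open>F[\<partial>][\<lambda>\<^sub>0, \<lambda>\<^sub>1, \<dots>]\<close>, by \<open>vmult\<close> below.  All indices are counted from \<open>0\<close>.
\<close>

type_synonym 'v mvpoly = "(nat \<Rightarrow>\<^sub>0 nat) \<Rightarrow>\<^sub>0 'v"

definition mvpolys :: "nat \<Rightarrow> 'v::zero mvpoly set" where
  "mvpolys q = {w. \<forall>m\<in>Poly_Mapping.keys w. Poly_Mapping.keys m \<subseteq> {..<q}}"

definition lam :: "nat \<Rightarrow> 'f::field poly mvpoly" where
  "lam i = Poly_Mapping.single (Poly_Mapping.single i 1) 1"

definition dd :: "'f::field poly mvpoly" where
  "dd = Poly_Mapping.single 0 [:0, 1:]"

definition scalar :: "'f::field \<Rightarrow> 'f poly mvpoly" where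
  "scalar c = Poly_Mapping.single 0 [:c:]"

definition vmult ::
    "('f::field poly \<Rightarrow> 'v::ab_group_add \<Rightarrow> 'v) \<Rightarrow> 'f poly mvpoly \<Rightarrow> 'v mvpoly \<Rightarrow> 'v mvpoly" where
  "vmult sc P w =
     (\<Sum>m\<in>Poly_Mapping.keys P. \<Sum>n\<in>Poly_Mapping.keys w. Poly_Mapping.single (m + n) (sc (Poly_Mapping.lookup P m) (Poly_Mapping.lookup w n)))"

text \<open>
  Substitution of \<open>xs ! i\<close> for \<open>\<lambda>\<^sub>i\<close>.  The substituted polynomials may contain \<open>\<partial>\<close>, which then
  acts on the coefficients of \<open>w\<close>, as in \<open>[b\<^bsub>-\<lambda>-\<partial>\<^esub> a]\<close>.
\<close>
definition vsubst ::
    "('f::field poly \<Rightarrow> 'v::ab_group_add \<Rightarrow> 'v) \<Rightarrow> 'f poly mvpoly list \<Rightarrow> 'v mvpoly \<Rightarrow> 'v mvpoly" where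
  "vsubst sc xs w =
     (\<Sum>m\<in>Poly_Mapping.keys w. vmult sc (\<Prod>i\<in>Poly_Mapping.keys m. (xs ! i) ^ Poly_Mapping.lookup m i) (Poly_Mapping.single 0 (Poly_Mapping.lookup w m)))"

text \<open>Extension of a map \<open>F\<close> on coefficients that is linear in the variables \<open>\<lambda>\<^sub>i\<close>.\<close>
definition lin_ext ::
    "('f::field poly \<Rightarrow> 'v::ab_group_add \<Rightarrow> 'v) \<Rightarrow> ('a::zero \<Rightarrow> 'v mvpoly) \<Rightarrow> 'a mvpoly \<Rightarrow> 'v mvpoly" where
  "lin_ext sc F u = (\<Sum>m\<in>Poly_Mapping.keys u. vmult sc (Poly_Mapping.single m 1) (F (Poly_Mapping.lookup u m)))"

section \<open>Lie conformal algebras and their modules\<close>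

text \<open>
  The polynomial \<open>[a\<^sub>\<lambda> b]\<close> is represented by \<open>br a b\<close> in the variable \<open>\<lambda> = \<lambda>\<^sub>0\<close>, and
  \<open>a\<^sub>\<lambda> v\<close> by \<open>act a v\<close>; \<open>[a\<^sub>x b]\<close> is \<open>vsubst sc [x] (br a b)\<close>.
\<close>

locale lie_conformal_algebra = module sc
  for sc :: "'f::field poly \<Rightarrow> 'a::ab_group_add \<Rightarrow> 'a" +
  fixes br :: "'a \<Rightarrow> 'a \<Rightarrow> 'a mvpoly"
  assumes br_poly: "br a b \<in> mvpolys 1"
    and br_add_left: "br (a + a') b = br a b + br a' b"
    and br_add_right: "br a (b + b') = br a b + br a b'"
    and br_scalar_left: "br (sc [:k:] a) b = vmult sc (scalar k) (br a b)"
    and br_scalar_right: "br a (sc [:k:] b) = vmult sc (scalar k) (br a b)"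
    and br_partial_left: "br (sc [:0, 1:] a) b = vmult sc (- lam 0) (br a b)"
    and br_partial_right: "br a (sc [:0, 1:] b) = vmult sc (dd + lam 0) (br a b)"
    and br_skew: "br a b = - vsubst sc [- lam 0 - dd] (br b a)"
    and br_jacobi:
      "lin_ext sc (\<lambda>e. vsubst sc [lam 0] (br a e)) (vsubst sc [lam 1] (br b c)) =
       lin_ext sc (\<lambda>e. vsubst sc [lam 0 + lam 1] (br e c)) (vsubst sc [lam 0] (br a b)) +
       lin_ext sc (\<lambda>e. vsubst sc [lam 1] (br b e)) (vsubst sc [lam 0] (br a c))"

locale lca_module =
  lie_conformal_algebra scA br + V: module scV
  for scA :: "'f::field poly \<Rightarrow> 'a::ab_group_add \<Rightarrow> 'a"
    and br :: "'a \<Rightarrow> 'a \<Rightarrow> 'a mvpoly"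
    and scV :: "'f poly \<Rightarrow> 'v::ab_group_add \<Rightarrow> 'v" +
  fixes act :: "'a \<Rightarrow> 'v \<Rightarrow> 'v mvpoly"
  assumes act_poly: "act a v \<in> mvpolys 1"
    and act_add_left: "act (a + a') v = act a v + act a' v"
    and act_add_right: "act a (v + v') = act a v + act a v'"
    and act_scalar_left: "act (scA [:k:] a) v = vmult scV (scalar k) (act a v)"
    and act_scalar_right: "act a (scV [:k:] v) = vmult scV (scalar k) (act a v)"
    and act_partial_left: "act (scA [:0, 1:] a) v = vmult scV (- lam 0) (act a v)"
    and act_partial_right: "act a (scV [:0, 1:] v) = vmult scV (dd + lam 0) (act a v)"
    and act_bracket:
      "lin_ext scV (\<lambda>e. vsubst scV [lam 0] (act a e)) (vsubst scV [lam 1] (act b v)) -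
       lin_ext scV (\<lambda>e. vsubst scV [lam 1] (act b e)) (vsubst scV [lam 0] (act a v)) =
       lin_ext scV (\<lambda>e. vsubst scV [lam 0 + lam 1] (act e v)) (vsubst scA [lam 0] (br a b))"

lemma (in lie_conformal_algebra) adjoint_module: "lca_module sc br sc br"
proof unfold_locales
  show "lin_ext sc (\<lambda>e. vsubst sc [lam 0] (br a e)) (vsubst sc [lam 1] (br b v)) -
      lin_ext sc (\<lambda>e. vsubst sc [lam 1] (br b e)) (vsubst sc [lam 0] (br a v)) =
      lin_ext sc (\<lambda>e. vsubst sc [lam 0 + lam 1] (br e v)) (vsubst sc [lam 0] (br a b))" for a b v
    using br_jacobi[of a b v] by simp
qed (fact br_poly br_add_left br_add_right br_scalar_left br_scalar_right
      br_partial_left br_partial_right)+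

section \<open>Cohomology\<close>

text \<open>
  A \<open>q\<close>-cochain \<open>f\<close> is a function of lists of arguments; \<open>f [a\<^sub>0, \<dots>, a\<^bsub>q-1\<^esub>]\<close> is the polynomial
  \<open>f\<^bsub>\<lambda>\<^sub>0,\<dots>,\<lambda>\<^bsub>q-1\<^esub>\<^esub>(a\<^sub>0, \<dots>, a\<^bsub>q-1\<^esub>)\<close>.  It is set to \<open>0\<close> on lists of any other length, so that
  equality of cochains is equality of functions.  A \<open>0\<close>-cochain is given by its value at \<open>[]\<close>,
  which is a constant polynomial, i.e. an element of \<open>V\<close>.
\<close>
definition cochains ::
    "('f::field poly \<Rightarrow> 'a::ab_group_add \<Rightarrow> 'a) \<Rightarrow> ('f poly \<Rightarrow> 'v::ab_group_add \<Rightarrow> 'v) \<Rightarrow>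
     nat \<Rightarrow> ('a list \<Rightarrow> 'v mvpoly) set" where
  "cochains scA scV q = {f.
     (\<forall>as. length as \<noteq> q \<longrightarrow> f as = 0) \<and>
     (\<forall>as. length as = q \<longrightarrow>
        f as \<in> mvpolys q \<and>
        (\<forall>i<q. \<forall>a b. f (as[i := a + b]) = f (as[i := a]) + f (as[i := b])) \<and>
        (\<forall>i<q. \<forall>c. f (as[i := scA [:c:] (as ! i)]) = vmult scV (scalar c) (f as)) \<and>
        (\<forall>i<q. f (as[i := scA [:0, 1:] (as ! i)]) = vmult scV (- lam i) (f as)) \<and>
        (\<forall>\<sigma>. \<sigma> permutes {..<q} \<longrightarrow>
           vsubst scV (map lam (permute_list \<sigma> [0..<q])) (f (permute_list \<sigma> as)) =
           vmult scV (of_int (sign \<sigma>)) (f as)))}"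

text \<open>
  \<open>nths as (- S)\<close> is \<open>as\<close> with the entries at the positions in \<open>S\<close> omitted.  Counting from \<open>0\<close>
  changes the sign \<open>(-1)\<^bsup>k+1\<^esup>\<close> into \<open>(-1)\<^bsup>k\<^esup>\<close> and leaves the sign \<open>(-1)\<^bsup>k+l\<^esup>\<close> unchanged.
\<close>
definition differential ::
    "('f::field poly \<Rightarrow> 'a::ab_group_add \<Rightarrow> 'a) \<Rightarrow> ('a \<Rightarrow> 'a \<Rightarrow> 'a mvpoly) \<Rightarrow>
     ('f poly \<Rightarrow> 'v::ab_group_add \<Rightarrow> 'v) \<Rightarrow> ('a \<Rightarrow> 'v \<Rightarrow> 'v mvpoly) \<Rightarrow>
     ('a list \<Rightarrow> 'v mvpoly) \<Rightarrow> 'a list \<Rightarrow> 'v mvpoly" where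
  "differential scA br scV act f as = (let n = length as; ls = map lam [0..<n] in
     (\<Sum>k<n. vmult scV ((- 1) ^ k)
        (lin_ext scV (\<lambda>v. vsubst scV [lam k] (act (as ! k) v))
           (vsubst scV (nths ls (- {k})) (f (nths as (- {k})))))) +
     (\<Sum>l<n. \<Sum>k<l. vmult scV ((- 1) ^ (k + l))
        (lin_ext scV
           (\<lambda>e. vsubst scV ((lam k + lam l) # nths ls (- {k, l})) (f (e # nths as (- {k, l}))))
           (vsubst scA [lam k] (br (as ! k) (as ! l))))))"

definition cochain_partial ::
    "('f::field poly \<Rightarrow> 'v::ab_group_add \<Rightarrow> 'v) \<Rightarrow>
     ('a list \<Rightarrow> 'v mvpoly) \<Rightarrow> 'a list \<Rightarrow> 'v mvpoly" where
  "cochain_partial scV f as = vmult scV (dd + (\<Sum>k<length as. lam k)) (f as)"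

text \<open>
  The cohomology of a cochain complex, as an abelian group; it is the zero vector space
  if and only if this group is trivial.
\<close>
definition coboundaries :: "(nat \<Rightarrow> 'c monoid) \<Rightarrow> (nat \<Rightarrow> 'c \<Rightarrow> 'c) \<Rightarrow> nat \<Rightarrow> 'c set" where
  "coboundaries C d q = (case q of 0 \<Rightarrow> {\<one>\<^bsub>C 0\<^esub>} | Suc p \<Rightarrow> d p ` carrier (C p))"

definition cohomology_group ::
    "(nat \<Rightarrow> 'c monoid) \<Rightarrow> (nat \<Rightarrow> 'c \<Rightarrow> 'c) \<Rightarrow> nat \<Rightarrow> 'c set monoid" where
  "cohomology_group C d q =
     (C q)\<lparr>carrier := kernel (C q) (C (Suc q)) (d q)\<rparr> Mod coboundaries C d q"

definition basic_group ::
    "('f::field poly \<Rightarrow> 'a::ab_group_add \<Rightarrow> 'a) \<Rightarrow> ('f poly \<Rightarrow> 'v::ab_group_add \<Rightarrow> 'v) \<Rightarrow>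
     nat \<Rightarrow> ('a list \<Rightarrow> 'v mvpoly) monoid" where
  "basic_group scA scV q =
     \<lparr>carrier = cochains scA scV q, mult = (\<lambda>f g as. f as + g as), one = (\<lambda>as. 0)\<rparr>"

definition basic_cohomology ::
    "('f::field poly \<Rightarrow> 'a::ab_group_add \<Rightarrow> 'a) \<Rightarrow> ('a \<Rightarrow> 'a \<Rightarrow> 'a mvpoly) \<Rightarrow>
     ('f poly \<Rightarrow> 'v::ab_group_add \<Rightarrow> 'v) \<Rightarrow> ('a \<Rightarrow> 'v \<Rightarrow> 'v mvpoly) \<Rightarrow>
     nat \<Rightarrow> ('a list \<Rightarrow> 'v mvpoly) set monoid" where
  "basic_cohomology scA br scV act q =
     cohomology_group (basic_group scA scV) (\<lambda>_. differential scA br scV act) q"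

definition partial_image ::
    "('f::field poly \<Rightarrow> 'a::ab_group_add \<Rightarrow> 'a) \<Rightarrow> ('f poly \<Rightarrow> 'v::ab_group_add \<Rightarrow> 'v) \<Rightarrow>
     nat \<Rightarrow> ('a list \<Rightarrow> 'v mvpoly) set" where
  "partial_image scA scV q = cochain_partial scV ` cochains scA scV q"

definition reduced_group ::
    "('f::field poly \<Rightarrow> 'a::ab_group_add \<Rightarrow> 'a) \<Rightarrow> ('f poly \<Rightarrow> 'v::ab_group_add \<Rightarrow> 'v) \<Rightarrow>
     nat \<Rightarrow> ('a list \<Rightarrow> 'v mvpoly) set monoid" where
  "reduced_group scA scV q = basic_group scA scV q Mod partial_image scA scV q"

text \<open>The differential induced on the quotient: the coset of \<open>f\<close> is sent to the coset of \<open>d f\<close>.\<close>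
definition reduced_differential ::
    "('f::field poly \<Rightarrow> 'a::ab_group_add \<Rightarrow> 'a) \<Rightarrow> ('a \<Rightarrow> 'a \<Rightarrow> 'a mvpoly) \<Rightarrow>
     ('f poly \<Rightarrow> 'v::ab_group_add \<Rightarrow> 'v) \<Rightarrow> ('a \<Rightarrow> 'v \<Rightarrow> 'v mvpoly) \<Rightarrow>
     nat \<Rightarrow> ('a list \<Rightarrow> 'v mvpoly) set \<Rightarrow> ('a list \<Rightarrow> 'v mvpoly) set" where
  "reduced_differential scA br scV act q X =
     (\<Union>f\<in>X. partial_image scA scV (Suc q) #>\<^bsub>basic_group scA scV (Suc q)\<^esub>
               differential scA br scV act f)"

definition reduced_cohomology ::
    "('f::field poly \<Rightarrow> 'a::ab_group_add \<Rightarrow> 'a) \<Rightarrow> ('a \<Rightarrow> 'a \<Rightarrow> 'a mvpoly) \<Rightarrow>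
     ('f poly \<Rightarrow> 'v::ab_group_add \<Rightarrow> 'v) \<Rightarrow> ('a \<Rightarrow> 'v \<Rightarrow> 'v mvpoly) \<Rightarrow>
     nat \<Rightarrow> ('a list \<Rightarrow> 'v mvpoly) set set monoid" where
  "reduced_cohomology scA br scV act q =
     cohomology_group (reduced_group scA scV) (reduced_differential scA br scV act) q"

section \<open>Casimir elements and derivations\<close>

definition integral_class ::
    "('f::field poly \<Rightarrow> 'a::ab_group_add \<Rightarrow> 'a) \<Rightarrow> 'a \<Rightarrow> 'a set" where
  "integral_class sc a = {a + sc [:0, 1:] b | b. True}"

definition bracket_at_0 :: "('a \<Rightarrow> 'a \<Rightarrow> 'a::zero mvpoly) \<Rightarrow> 'a \<Rightarrow> 'a \<Rightarrow> 'a" where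
  "bracket_at_0 br a b = Poly_Mapping.lookup (br a b) 0"

definition casimir_elements ::
    "('f::field poly \<Rightarrow> 'a::ab_group_add \<Rightarrow> 'a) \<Rightarrow> ('a \<Rightarrow> 'a \<Rightarrow> 'a mvpoly) \<Rightarrow> 'a set set" where
  "casimir_elements sc br = {integral_class sc a | a. \<forall>b. bracket_at_0 br a b = 0}"

definition derivation ::
    "('f::field poly \<Rightarrow> 'a::ab_group_add \<Rightarrow> 'a) \<Rightarrow> ('a \<Rightarrow> 'a \<Rightarrow> 'a mvpoly) \<Rightarrow> ('a \<Rightarrow> 'a) \<Rightarrow> bool" where
  "derivation sc br D \<longleftrightarrow> module_hom sc sc D \<and>
     (\<forall>a b. Poly_Mapping.map D (br a b) = br a (D b) + br (D a) b)"

definition inner_derivation :: "('a \<Rightarrow> 'a \<Rightarrow> 'a::zero mvpoly) \<Rightarrow> ('a \<Rightarrow> 'a) \<Rightarrow> bool" where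
  "inner_derivation br D \<longleftrightarrow> (\<exists>a. \<forall>b. D b = bracket_at_0 br a b)"

section \<open>The extended Schroedinger-Virasoro Lie conformal algebra\<close>

datatype sv_gen = Gen_L | Gen_M | Gen_Y | Gen_N

lemma UNIV_sv_gen: "UNIV = {Gen_L, Gen_M, Gen_Y, Gen_N}"
  using sv_gen.exhaust by auto

instance sv_gen :: finite
  by standard (simp add: UNIV_sv_gen)

text \<open>The free \<open>F[\<partial>]\<close>-module on the generators; the generator \<open>g\<close> is \<^term>\<open>axis g 1\<close>.\<close>
type_synonym 'f sv = "('f poly, sv_gen) vec"

definition sv_scale :: "'f::field poly \<Rightarrow> 'f sv \<Rightarrow> 'f sv" where
  "sv_scale p a = p *s a"

definition sv_mult :: "'f::field poly mvpoly \<Rightarrow> sv_gen \<Rightarrow> 'f sv mvpoly" where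
  "sv_mult P g = vmult sv_scale P (Poly_Mapping.single 0 (axis g 1))"

fun sv_gen_bracket :: "sv_gen \<Rightarrow> sv_gen \<Rightarrow> 'f::field_char_0 sv mvpoly" where
  "sv_gen_bracket Gen_L Gen_L = sv_mult (dd + 2 * lam 0) Gen_L"
| "sv_gen_bracket Gen_L Gen_M = sv_mult (dd + lam 0) Gen_M"
| "sv_gen_bracket Gen_L Gen_Y = sv_mult (dd + scalar (3/2) * lam 0) Gen_Y"
| "sv_gen_bracket Gen_M Gen_L = sv_mult (lam 0) Gen_M"
| "sv_gen_bracket Gen_Y Gen_L = sv_mult (scalar (1/2) * dd + scalar (3/2) * lam 0) Gen_Y"
| "sv_gen_bracket Gen_Y Gen_Y = sv_mult (dd + 2 * lam 0) Gen_M"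
| "sv_gen_bracket Gen_L Gen_N = sv_mult (dd + lam 0) Gen_N"
| "sv_gen_bracket Gen_N Gen_L = sv_mult (lam 0) Gen_N"
| "sv_gen_bracket Gen_N Gen_M = sv_mult 2 Gen_M"
| "sv_gen_bracket Gen_M Gen_N = sv_mult (- 2) Gen_M"
| "sv_gen_bracket Gen_N Gen_Y = sv_mult 1 Gen_Y"
| "sv_gen_bracket Gen_Y Gen_N = sv_mult (- 1) Gen_Y"
| "sv_gen_bracket _ _ = 0"

text \<open>\<open>psubst p x\<close> is \<open>p(x)\<close>, for \<open>p \<in> F[\<partial>]\<close> and \<open>x \<in> F[\<partial>][\<lambda>\<^sub>0, \<lambda>\<^sub>1, \<dots>]\<close>.\<close>
definition psubst :: "'f::field poly \<Rightarrow> 'f poly mvpoly \<Rightarrow> 'f poly mvpoly" where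
  "psubst p x = poly (map_poly scalar p) x"

text \<open>
  The \<open>\<lambda>\<close>-bracket is determined by its values on generators through
  \<open>[p(\<partial>)g\<^sub>\<lambda> r(\<partial>)h] = p(-\<lambda>) r(\<partial>+\<lambda>) [g\<^sub>\<lambda> h]\<close>.
\<close>
definition sv_bracket :: "'f::field_char_0 sv \<Rightarrow> 'f sv \<Rightarrow> 'f sv mvpoly" where
  "sv_bracket a b = (\<Sum>g\<in>UNIV. \<Sum>h\<in>UNIV.
     vmult sv_scale (psubst (a $ g) (- lam 0) * psubst (b $ h) (dd + lam 0)) (sv_gen_bracket g h))"

subsection \<open>Verification of the axioms\<close>

lemma sum_keys_superset:
  assumes "finite K" "Poly_Mapping.keys w \<subseteq> K" "\<And>m. G m 0 = 0"
  shows "(\<Sum>m\<in>Poly_Mapping.keys w. G m (Poly_Mapping.lookup w m)) =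
    (\<Sum>m\<in>K. G m (Poly_Mapping.lookup w m))"
  by (rule sum.mono_neutral_left) (use assms in \<open>auto simp: in_keys_iff\<close>)

lemma poly_mapping_sum_single:
  "(\<Sum>m\<in>Poly_Mapping.keys w. Poly_Mapping.single m (Poly_Mapping.lookup w m)) = w"
  by (rule poly_mapping_eqI) (auto simp: lookup_sum lookup_single when_def in_keys_iff)

definition coord :: "sv_gen \<Rightarrow> 'f::field sv mvpoly \<Rightarrow> 'f poly mvpoly" where
  "coord g w = Poly_Mapping.map (\<lambda>v. v $ g) w"

lemma lookup_coord: "Poly_Mapping.lookup (coord g w) m = Poly_Mapping.lookup w m $ g"
  unfolding coord_def by (simp add: map.rep_eq when_def)

lemma coord_eqI: "(\<And>g. coord g u = coord g w) \<Longrightarrow> u = w"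
  by (rule poly_mapping_eqI) (metis lookup_coord vec_eq_iff)

lemma coord_0 [simp]: "coord g 0 = 0" by (rule poly_mapping_eqI) (simp add: lookup_coord)
lemma coord_add [simp]: "coord g (u + w) = coord g u + coord g w"
  by (rule poly_mapping_eqI) (simp add: lookup_coord lookup_add)
lemma coord_uminus [simp]: "coord g (- u) = - coord g u"
  by (rule poly_mapping_eqI) (simp add: lookup_coord)
lemma coord_sum: "coord g (sum f A) = (\<Sum>x\<in>A. coord g (f x))"
  by (induction A rule: infinite_finite_induct) auto
lemma coord_single: "coord g (Poly_Mapping.single m v) = Poly_Mapping.single m (v $ g)"
  by (rule poly_mapping_eqI) (simp add: lookup_coord lookup_single when_def)
lemma keys_coord: "Poly_Mapping.keys (coord g w) \<subseteq> Poly_Mapping.keys w"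
  by (auto simp: in_keys_iff lookup_coord)

lemma coord_vmult [simp]: "coord g (vmult sv_scale P w) = P * coord g w"
proof -
  have "P * coord g w = (\<Sum>m\<in>Poly_Mapping.keys P. Poly_Mapping.single m (Poly_Mapping.lookup P m)) *
     coord g (\<Sum>m\<in>Poly_Mapping.keys w. Poly_Mapping.single m (Poly_Mapping.lookup w m))"
    by (simp add: poly_mapping_sum_single)
  also have "\<dots> = coord g (vmult sv_scale P w)"
    by (simp add: vmult_def coord_sum coord_single sum_product mult_single sv_scale_def)
  finally show ?thesis by simp
qed

lemma scalar_0 [simp]: "scalar 0 = 0" by (simp add: scalar_def)
lemma scalar_1 [simp]: "scalar 1 = 1" by (metis scalar_def one_pCons single_one)
lemma scalar_add: "scalar (a + b) = scalar a + scalar b"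
  by (simp add: scalar_def single_add[symmetric])
lemma scalar_mult: "scalar (a * b) = scalar a * scalar b"
  by (simp add: scalar_def mult_single mult.commute)

lemma psubst_0 [simp]: "psubst 0 x = 0" by (simp add: psubst_def)
lemma psubst_pCons [simp]: "psubst (pCons a p) x = scalar a + x * psubst p x"
  by (simp add: psubst_def map_poly_pCons)
lemma psubst_1 [simp]: "psubst 1 x = 1" by (simp add: one_pCons)
lemma psubst_add [simp]: "psubst (p + q) x = psubst p x + psubst q x"
  by (induction p q rule: poly_induct2) (simp_all add: scalar_add algebra_simps)
lemma psubst_smult [simp]: "psubst (smult a p) x = scalar a * psubst p x"
  by (induction p) (simp_all add: scalar_mult algebra_simps)
lemma psubst_mult [simp]: "psubst (p * q) x = psubst p x * psubst q x"
  by (induction p) (simp_all add: algebra_simps)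
lemma psubst_dd [simp]: "psubst p dd = Poly_Mapping.single 0 p"
  by (induction p) (simp_all add: scalar_def dd_def mult_single single_add[symmetric])

text \<open>The ring endomorphism fixing \<open>F\<close> with \<open>\<partial> \<mapsto> y\<close> and \<open>\<lambda>\<^sub>i \<mapsto> x i\<close>.\<close>
definition rhom :: "'f::field poly mvpoly \<Rightarrow> (nat \<Rightarrow> 'f poly mvpoly) \<Rightarrow> 'f poly mvpoly \<Rightarrow> 'f poly mvpoly" where
  "rhom y x P = (\<Sum>m\<in>Poly_Mapping.keys P. psubst (Poly_Mapping.lookup P m) y *
     (\<Prod>i\<in>Poly_Mapping.keys m. x i ^ Poly_Mapping.lookup m i))"

lemma rhom_add [simp]: "rhom y x (P + Q) = rhom y x P + rhom y x Q"
  unfolding rhom_def by (rule setsum_keys_plus_distrib) (simp_all add: algebra_simps)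
lemma rhom_0 [simp]: "rhom y x 0 = 0" by (simp add: rhom_def)
lemma rhom_sum: "rhom y x (sum f A) = (\<Sum>a\<in>A. rhom y x (f a))"
  by (induction A rule: infinite_finite_induct) auto
lemma rhom_single: "rhom y x (Poly_Mapping.single m p) =
   psubst p y * (\<Prod>i\<in>Poly_Mapping.keys m. x i ^ Poly_Mapping.lookup m i)"
  by (cases "p = 0") (simp_all add: rhom_def)
lemma mon_add: "(\<Prod>i\<in>Poly_Mapping.keys (m + n). x i ^ Poly_Mapping.lookup (m + n) i) =
   (\<Prod>i\<in>Poly_Mapping.keys m. x i ^ Poly_Mapping.lookup m i) *
   (\<Prod>i\<in>Poly_Mapping.keys n. (x i :: 'a::comm_monoid_mult) ^ Poly_Mapping.lookup n i)"
proof -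
  let ?K = "Poly_Mapping.keys m \<union> Poly_Mapping.keys n"
  have *: "(\<Prod>i\<in>Poly_Mapping.keys l. x i ^ Poly_Mapping.lookup l i) = (\<Prod>i\<in>?K. x i ^ Poly_Mapping.lookup l i)"
    if "Poly_Mapping.keys l \<subseteq> ?K" for l
    by (rule prod.mono_neutral_left) (use that in \<open>auto simp: in_keys_iff\<close>)
  show ?thesis
    using *[of m] *[of n] *[of "m + n"] Poly_Mapping.keys_add[of m n]
    by (simp add: lookup_add power_add prod.distrib)
qed
lemma rhom_mult [simp]: "rhom y x (P * Q) = rhom y x P * rhom y x Q"
proof -
  let ?s = "\<lambda>w. \<Sum>m\<in>Poly_Mapping.keys w. Poly_Mapping.single m (Poly_Mapping.lookup w m)"
  have "rhom y x (?s P * ?s Q) = rhom y x (?s P) * rhom y x (?s Q)"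
    by (simp add: sum_product rhom_sum mult_single rhom_single mon_add algebra_simps)
  then show ?thesis by (simp add: poly_mapping_sum_single)
qed
lemma rhom_scalar [simp]: "rhom y x (scalar a) = scalar a"
  by (simp add: scalar_def[of a] rhom_single)
lemma rhom_1 [simp]: "rhom y x 1 = 1" using rhom_scalar[of y x 1] by simp
lemma rhom_uminus [simp]: "rhom y x (- P) = - rhom y x P"
  using rhom_add[of y x P "- P"] by (simp add: add_eq_0_iff)
lemma rhom_diff [simp]: "rhom y x (P - Q) = rhom y x P - rhom y x Q"
  using rhom_add[of y x P "- Q"] by simp
lemma rhom_numeral [simp]: "rhom y x (numeral k) = numeral k"
  by (induction k) (simp_all only: numeral.simps rhom_add rhom_1)
lemma rhom_lam [simp]: "rhom y x (lam i) = x i"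
  by (simp add: lam_def rhom_single)
lemma rhom_dd [simp]: "rhom y x dd = y"
  by (simp add: dd_def rhom_single)
lemma rhom_psubst [simp]: "rhom y x (psubst p z) = psubst p (rhom y x z)"
  by (induction p) simp_all
lemma rhom_id [simp]: "rhom dd lam P = P"
proof -
  have *: "(\<Prod>i\<in>Poly_Mapping.keys m. lam i ^ Poly_Mapping.lookup m i) = (Poly_Mapping.single m 1 :: 'a poly mvpoly)" for m
  proof -
    have l: "(lam i :: 'a poly mvpoly) ^ k = Poly_Mapping.single (Poly_Mapping.single i k) 1" for i k
      by (induction k) (simp_all add: lam_def mult_single single_add[symmetric])
    have p: "(\<Prod>i\<in>A. (Poly_Mapping.single (h i) 1 :: 'a poly mvpoly)) = Poly_Mapping.single (\<Sum>i\<in>A. h i) 1" for h and A :: "nat set"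
      by (induction A rule: infinite_finite_induct) (simp_all add: mult_single)
    have "(\<Prod>i\<in>Poly_Mapping.keys m. lam i ^ Poly_Mapping.lookup m i :: 'a poly mvpoly) =
        (\<Prod>i\<in>Poly_Mapping.keys m. Poly_Mapping.single (Poly_Mapping.single i (Poly_Mapping.lookup m i)) 1)"
      by (simp only: l)
    then show ?thesis by (simp only: p poly_mapping_sum_single)
  qed
  show ?thesis
    unfolding rhom_def * by (simp add: mult_single poly_mapping_sum_single)
qed

lemma coord_vsubst [simp]: "coord k (vsubst sv_scale xs w) = rhom dd ((!) xs) (coord k w)"
proof -
  have "rhom dd ((!) xs) (coord k w) = (\<Sum>m\<in>Poly_Mapping.keys w. psubst (Poly_Mapping.lookup (coord k w) m) dd *
     (\<Prod>i\<in>Poly_Mapping.keys m. (xs ! i) ^ Poly_Mapping.lookup m i))"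
    unfolding rhom_def by (rule sum_keys_superset) (simp_all add: keys_coord)
  then show ?thesis
    by (simp add: vsubst_def coord_sum coord_single lookup_coord mult.commute)
qed

definition tab :: "sv_gen \<Rightarrow> sv_gen \<Rightarrow> sv_gen \<Rightarrow> 'f::field_char_0 poly mvpoly" where
  "tab g h k = coord k (sv_gen_bracket g h)"

lemma coord_sv_mult [simp]: "coord k (sv_mult P g) = (if k = g then P else 0)"
  by (simp add: sv_mult_def coord_single axis_def)

lemma coord_bracket: "coord k (sv_bracket a b) = (\<Sum>g\<in>UNIV. \<Sum>h\<in>UNIV.
   psubst (a $ g) (- lam 0) * psubst (b $ h) (dd + lam 0) * tab g h k)"
  by (simp add: sv_bracket_def coord_sum tab_def)

lemma coord_lin_ext:
  "coord k (lin_ext sv_scale F u) = (\<Sum>m\<in>Poly_Mapping.keys u. Poly_Mapping.single m 1 * coord k (F (Poly_Mapping.lookup u m)))"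
  by (simp add: lin_ext_def coord_sum)

lemma rhom_ext: "(\<Sum>m\<in>Poly_Mapping.keys u. Poly_Mapping.single m 1 * psubst (Poly_Mapping.lookup u m $ h) y) = rhom y lam (coord h u)"
proof -
  have *: "(\<Prod>i\<in>Poly_Mapping.keys m. lam i ^ Poly_Mapping.lookup m i) = (Poly_Mapping.single m 1 :: 'a poly mvpoly)" for m
    using rhom_id[of "Poly_Mapping.single m 1 :: 'a poly mvpoly"] by (simp add: rhom_single)
  have "rhom y lam (coord h u) = (\<Sum>m\<in>Poly_Mapping.keys u. psubst (Poly_Mapping.lookup (coord h u) m) y *
     (\<Prod>i\<in>Poly_Mapping.keys m. lam i ^ Poly_Mapping.lookup m i))"
    unfolding rhom_def by (rule sum_keys_superset) (simp_all add: keys_coord)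
  then show ?thesis by (simp add: * lookup_coord mult.commute)
qed

lemma ext_right: "coord k (lin_ext sv_scale (\<lambda>e. vsubst sv_scale [x] (sv_bracket a e)) u) =
  (\<Sum>g\<in>UNIV. \<Sum>h\<in>UNIV. psubst (a $ g) (- x) * rhom (dd + x) lam (coord h u) * rhom dd ((!) [x]) (tab g h k))"
  apply (simp add: coord_lin_ext coord_bracket rhom_sum rhom_ext[symmetric] sum_distrib_left sum_distrib_right)
  apply (subst sum.swap, rule sum.cong[OF refl])
  apply (subst sum.swap, rule sum.cong[OF refl])
  by (simp add: mult_ac)

lemma ext_left: "coord k (lin_ext sv_scale (\<lambda>e. vsubst sv_scale [x] (sv_bracket e c)) u) =
  (\<Sum>g\<in>UNIV. \<Sum>h\<in>UNIV. rhom (- x) lam (coord g u) * psubst (c $ h) (dd + x) * rhom dd ((!) [x]) (tab g h k))"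
  apply (simp add: coord_lin_ext coord_bracket rhom_sum rhom_ext[symmetric] sum_distrib_left sum_distrib_right)
  apply (subst sum.swap, rule sum.cong[OF refl])
  apply (subst sum.swap, rule sum.cong[OF refl])
  by (simp add: mult_ac)

lemma sv_bracket_generators: "sv_bracket (axis g 1) (axis h 1) = sv_gen_bracket g h"
proof (rule coord_eqI)
  fix k
  have *: "psubst (if P then 1 else 0) x = (if P then 1 else 0)" for P and x :: "'a poly mvpoly"
    by simp
  show "coord k (sv_bracket (axis g 1) (axis h 1)) = coord k (sv_gen_bracket g h :: 'a sv mvpoly)"
    by (cases g; cases h) (simp_all add: coord_bracket tab_def axis_def * UNIV_sv_gen)
qed

lemma sum_gen: "(\<Sum>g\<in>UNIV. f g) = f Gen_L + f Gen_M + f Gen_Y + f Gen_N"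
  by (simp add: UNIV_sv_gen add_ac)

lemma half: "2 * scalar (1/2 :: 'f::field_char_0) = 1" "scalar (3/2 :: 'f) = 3 * scalar (1/2)"
proof -
  have s: "scalar (numeral k :: 'f) = numeral k" for k
    by (induction k) (simp_all only: numeral.simps scalar_add scalar_1)
  show "2 * scalar (1/2 :: 'f) = 1" using scalar_mult[of 2 "1/2 :: 'f"] by (simp add: s)
  show "scalar (3/2 :: 'f) = 3 * scalar (1/2)" using scalar_mult[of 3 "1/2 :: 'f"] by (simp add: s)
qed

lemma reorder1:
  fixes A B C :: "sv_gen \<Rightarrow> 'a::comm_ring_1"
  shows "(\<Sum>g\<in>UNIV. \<Sum>r\<in>UNIV. A g * (\<Sum>h\<in>UNIV. \<Sum>i\<in>UNIV. B h * C i * S h i r) * T g r) =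
    (\<Sum>g\<in>UNIV. \<Sum>h\<in>UNIV. \<Sum>i\<in>UNIV. A g * B h * C i * (\<Sum>r\<in>UNIV. S h i r * T g r))"
  unfolding sum_distrib_left sum_distrib_right
  apply (rule sum.cong[OF refl])
  apply (subst sum.swap, rule sum.cong[OF refl])
  apply (subst sum.swap, rule sum.cong[OF refl])
  by (simp add: mult_ac)

lemma reorder2:
  fixes A B C :: "sv_gen \<Rightarrow> 'a::comm_ring_1"
  shows "(\<Sum>r\<in>UNIV. \<Sum>i\<in>UNIV. (\<Sum>g\<in>UNIV. \<Sum>h\<in>UNIV. A g * B h * S g h r) * C i * T r i) =
    (\<Sum>g\<in>UNIV. \<Sum>h\<in>UNIV. \<Sum>i\<in>UNIV. A g * B h * C i * (\<Sum>r\<in>UNIV. S g h r * T r i))"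
proof -
  have "(\<Sum>r\<in>UNIV. \<Sum>i\<in>UNIV. (\<Sum>g\<in>UNIV. \<Sum>h\<in>UNIV. A g * B h * S g h r) * C i * T r i) =
    (\<Sum>i\<in>UNIV. \<Sum>r\<in>UNIV. C i * (\<Sum>g\<in>UNIV. \<Sum>h\<in>UNIV. A g * B h * S g h r) * T r i)"
    by (subst sum.swap) (simp add: mult_ac)
  also have "\<dots> = (\<Sum>i\<in>UNIV. \<Sum>g\<in>UNIV. \<Sum>h\<in>UNIV. C i * A g * B h * (\<Sum>r\<in>UNIV. S g h r * T r i))"
    using reorder1[of C A B S "\<lambda>i r. T r i"] by simp
  also have "\<dots> = (\<Sum>g\<in>UNIV. \<Sum>h\<in>UNIV. \<Sum>i\<in>UNIV. A g * B h * C i * (\<Sum>r\<in>UNIV. S g h r * T r i))"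
  proof -
    have "(\<Sum>i\<in>UNIV. \<Sum>g\<in>UNIV. \<Sum>h\<in>UNIV. C i * A g * B h * (\<Sum>r\<in>UNIV. S g h r * T r i)) =
      (\<Sum>g\<in>UNIV. \<Sum>i\<in>UNIV. \<Sum>h\<in>UNIV. C i * A g * B h * (\<Sum>r\<in>UNIV. S g h r * T r i))"
      by (rule sum.swap)
    also have "\<dots> = (\<Sum>g\<in>UNIV. \<Sum>h\<in>UNIV. \<Sum>i\<in>UNIV. C i * A g * B h * (\<Sum>r\<in>UNIV. S g h r * T r i))"
      by (rule sum.cong[OF refl], rule sum.swap)
    also have "\<dots> = (\<Sum>g\<in>UNIV. \<Sum>h\<in>UNIV. \<Sum>i\<in>UNIV. A g * B h * C i * (\<Sum>r\<in>UNIV. S g h r * T r i))"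
      by (intro sum.cong refl) (simp only: mult_ac)
    finally show ?thesis .
  qed
  finally show ?thesis .
qed

lemma reorder3:
  fixes A B C :: "sv_gen \<Rightarrow> 'a::comm_ring_1"
  shows "(\<Sum>h\<in>UNIV. \<Sum>r\<in>UNIV. B h * (\<Sum>g\<in>UNIV. \<Sum>i\<in>UNIV. A g * C i * S g i r) * T h r) =
    (\<Sum>g\<in>UNIV. \<Sum>h\<in>UNIV. \<Sum>i\<in>UNIV. A g * B h * C i * (\<Sum>r\<in>UNIV. S g i r * T h r))"
  unfolding reorder1 by (subst sum.swap) (simp add: mult_ac)

lemma half_eqs:
  fixes H d l m :: "'a::comm_ring_1" assumes "2 * H = 1"
  shows "(H * (d + l) + 3 * H * m) * (d + 3 * H * l) =
      (- l - m + 3 * H * l) * (H * d + 3 * H * (l + m)) + (d + m + 2 * l) * (H * d + 3 * H * m)" (is "?a1 = ?b1")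
    and "(d + l + 2 * m) * (d + l) =
      (- l - m + 3 * H * l) * (d + (2 * l + 2 * m)) + (d + m + 3 * H * l) * (d + 2 * m)" (is "?a2 = ?b2")
    and "(d + l + 2 * m) * (H * d + 3 * H * l) =
      (H * (- l - m) + 3 * H * l) * (H * d + 3 * H * (l + m)) + (H * (d + m) + 3 * H * l) * (d + 3 * H * m)" (is "?a3 = ?b3")
    and "(d + l + 3 * H * m) * (d + 2 * l) =
      (H * (- l - m) + 3 * H * l) * (d + (2 * l + 2 * m)) + (d + m + 2 * l) * (d + m)" (is "?a4 = ?b4")
    and "- l - m = - (3 * H * l) - 3 * H * m - H * (- l - m)" (is "?a5 = ?b5")
    and "(H * (d + l) + 3 * H * m) * (d + 2 * l) =
      (l - m) * (l + m) + (H * (d + m) + 3 * H * l) * (d + 2 * m)" (is "?a6 = ?b6")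
proof -
  have *: "x = y" if "x - y = (1 - 2 * H) * c" for x y c
    using that by (simp add: assms)
  show "?a1 = ?b1" by (rule *[of _ _ "3 * H * l * l"]) (simp add: algebra_simps)
  show "?a2 = ?b2" by (rule *[of _ _ "3 * l * (d + l + 2 * m)"]) (simp add: algebra_simps)
  show "?a3 = ?b3" by (rule *[of _ _ "H * (l * d + 3 * l * l + 6 * l * m + m * d)"]) (simp add: algebra_simps)
  show "?a4 = ?b4" by (rule *[of _ _ "l * d - 2 * m * d - 2 * l * m + 2 * l * l - m * m"]) (simp add: algebra_simps)
  show "?a5 = ?b5" by (rule *[of _ _ "- (l + m)"]) (simp add: algebra_simps)
  show "?a6 = ?b6" by (rule *[of _ _ "m * m - l * l"]) (simp add: algebra_simps)
qed

lemma nth_Cons_0 [simp]: "(!) [x] 0 = x" by simp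

lemma sv_jacobi: "lin_ext sv_scale (\<lambda>e. vsubst sv_scale [lam 0] (sv_bracket a e)) (vsubst sv_scale [lam 1] (sv_bracket b c)) =
       lin_ext sv_scale (\<lambda>e. vsubst sv_scale [lam 0 + lam 1] (sv_bracket e c)) (vsubst sv_scale [lam 0] (sv_bracket a b)) +
       lin_ext sv_scale (\<lambda>e. vsubst sv_scale [lam 1] (sv_bracket b e)) (vsubst sv_scale [lam 0] (sv_bracket a c))"
  (is "?P = ?Q")
proof (rule coord_eqI)
  fix k :: sv_gen
  define H where "H = scalar (1/2 :: 'a)"
  have H: "2 * H = 1" "scalar (3/2 :: 'a) = 3 * H" "scalar (1/2 :: 'a) = H" by (simp_all add: H_def half)
  have rH: "rhom y x H = H" for y x by (simp add: H_def)
  have n: "dd + lam (Suc 0) + lam 0 = dd + (lam 0 + lam (Suc 0) :: 'a poly mvpoly)"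
    "dd + lam 0 + lam (Suc 0) = dd + (lam 0 + lam (Suc 0) :: 'a poly mvpoly)"
    "- lam 0 - lam (Suc 0) + lam 0 = (- lam (Suc 0) :: 'a poly mvpoly)" by simp_all
  have J: "(\<Sum>r\<in>UNIV. rhom (dd + lam 0) lam (rhom dd ((!) [lam 1]) (tab h i r)) * rhom dd ((!) [lam 0]) (tab g r k)) =
     (\<Sum>r\<in>UNIV. rhom (- (lam 0 + lam 1)) lam (rhom dd ((!) [lam 0]) (tab g h r)) * rhom dd ((!) [lam 0 + lam 1]) (tab r i k)) +
     (\<Sum>r\<in>UNIV. rhom (dd + lam 1) lam (rhom dd ((!) [lam 0]) (tab g i r)) * rhom dd ((!) [lam 1]) (tab h r (k :: sv_gen)) :: 'a poly mvpoly)"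
    for g h i
    using H(1)
    by (cases g; cases h; cases i; cases k; simp add: sum_gen tab_def H(2,3) rH; (simp add: algebra_simps; fail)?; (rule half_eqs; simp)?)
  have 1: "coord k ?P = (\<Sum>g\<in>UNIV. \<Sum>h\<in>UNIV. \<Sum>i\<in>UNIV. psubst (a $ g) (- lam 0) * psubst (b $ h) (- lam 1) * psubst (c $ i) (dd + (lam 0 + lam 1)) *
     (\<Sum>r\<in>UNIV. rhom (dd + lam 0) lam (rhom dd ((!) [lam 1]) (tab h i r)) * rhom dd ((!) [lam 0]) (tab g r k)))"
    unfolding ext_right coord_vsubst coord_bracket
    by (simp add: n rhom_sum) (rule reorder1)
  have 2: "coord k (lin_ext sv_scale (\<lambda>e. vsubst sv_scale [lam 0 + lam 1] (sv_bracket e c)) (vsubst sv_scale [lam 0] (sv_bracket a b))) = 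
     (\<Sum>g\<in>UNIV. \<Sum>h\<in>UNIV. \<Sum>i\<in>UNIV. psubst (a $ g) (- lam 0) * psubst (b $ h) (- lam 1) * psubst (c $ i) (dd + (lam 0 + lam 1)) *
     (\<Sum>r\<in>UNIV. rhom (- (lam 0 + lam 1)) lam (rhom dd ((!) [lam 0]) (tab g h r)) * rhom dd ((!) [lam 0 + lam 1]) (tab r i k)))"
    unfolding ext_left coord_vsubst coord_bracket
    by (simp add: n rhom_sum) (rule reorder2)
  have 3: "coord k (lin_ext sv_scale (\<lambda>e. vsubst sv_scale [lam 1] (sv_bracket b e)) (vsubst sv_scale [lam 0] (sv_bracket a c))) = 
     (\<Sum>g\<in>UNIV. \<Sum>h\<in>UNIV. \<Sum>i\<in>UNIV. psubst (a $ g) (- lam 0) * psubst (b $ h) (- lam 1) * psubst (c $ i) (dd + (lam 0 + lam 1)) *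
     (\<Sum>r\<in>UNIV. rhom (dd + lam 1) lam (rhom dd ((!) [lam 0]) (tab g i r)) * rhom dd ((!) [lam 1]) (tab h r k)))"
    unfolding ext_right coord_vsubst coord_bracket
    by (simp add: n rhom_sum) (rule reorder3)
  show "coord k ?P = coord k ?Q"
    by (simp only: coord_add 1 2 3 J distrib_left sum.distrib)
qed

lemma sv_skew: "sv_bracket a b = - vsubst sv_scale [- lam 0 - dd] (sv_bracket b a)"
proof (rule coord_eqI)
  fix k :: sv_gen
  define H where "H = scalar (1/2 :: 'a)"
  have H: "2 * H = 1" "scalar (3/2 :: 'a) = 3 * H" "scalar (1/2 :: 'a) = H" by (simp_all add: H_def half)
  have rH: "rhom y x H = H" for y x by (simp add: H_def)
  have H2: "H * (2 * x) = x" for x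
  proof -
    have "H * (2 * x) = (2 * H) * x" by (simp only: mult_ac)
    then show ?thesis by (simp add: H(1))
  qed
  show "coord k (sv_bracket a b) = coord k (- vsubst sv_scale [- lam 0 - dd] (sv_bracket b a))"
    apply (cases k)
    apply (simp_all add: coord_bracket sum_gen tab_def H(2,3) rH add.commute)
    apply (simp_all add: algebra_simps H2)
    done
qed

lemma mvpolys_add: "u \<in> mvpolys q \<Longrightarrow> w \<in> mvpolys q \<Longrightarrow> u + w \<in> mvpolys q"
  using Poly_Mapping.keys_add[of u w] by (force simp: mvpolys_def)
lemma mvpolys_0: "0 \<in> mvpolys q" by (simp add: mvpolys_def)
lemma mvpolys_sum: "(\<And>x. x \<in> A \<Longrightarrow> f x \<in> mvpolys q) \<Longrightarrow> sum f A \<in> mvpolys q"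
  by (induction A rule: infinite_finite_induct) (auto intro: mvpolys_add mvpolys_0)
lemma mvpolys_mult: "u \<in> mvpolys q \<Longrightarrow> w \<in> mvpolys q \<Longrightarrow> u * w \<in> mvpolys q"
  for u :: "'f::field poly mvpoly"
proof -
  assume *: "u \<in> mvpolys q" "w \<in> mvpolys q"
  have "Poly_Mapping.keys m \<subseteq> {..<q}" if m: "m \<in> Poly_Mapping.keys (u * w)" for m
  proof -
    obtain a b where "m = a + b" "a \<in> Poly_Mapping.keys u" "b \<in> Poly_Mapping.keys w"
      using keys_mult[of u w] m by blast
    then show ?thesis using * Poly_Mapping.keys_add[of a b] unfolding mvpolys_def by blast
  qed
  then show ?thesis by (simp add: mvpolys_def)
qed
lemma mvpolys_uminus: "u \<in> mvpolys q \<Longrightarrow> - u \<in> mvpolys q" for u :: "'v::ab_group_add mvpoly"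
  by (auto simp: mvpolys_def in_keys_iff)
lemma mvpolys_single_0: "Poly_Mapping.single 0 v \<in> mvpolys q"
  by (auto simp: mvpolys_def)
lemma mvpolys_lam: "i < q \<Longrightarrow> lam i \<in> mvpolys q"
  by (auto simp: mvpolys_def lam_def)
lemma mvpolys_psubst: "x \<in> mvpolys q \<Longrightarrow> psubst p x \<in> mvpolys q"
  by (induction p) (auto intro!: mvpolys_0 mvpolys_add mvpolys_mult simp: scalar_def intro: mvpolys_single_0)
lemma mvpolys_coord: "(\<And>g. coord g w \<in> mvpolys q) \<Longrightarrow> w \<in> mvpolys q"
proof -
  assume *: "\<And>g. coord g w \<in> mvpolys q"
  have "\<exists>g. m \<in> Poly_Mapping.keys (coord g w)" if "m \<in> Poly_Mapping.keys w" for m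
    using that by (auto simp: in_keys_iff lookup_coord vec_eq_iff)
  with * show ?thesis unfolding mvpolys_def by blast
qed
lemma mvpolys_numeral: "numeral n \<in> mvpolys q"
  unfolding single_numeral[symmetric] by (rule mvpolys_single_0)
lemma mvpolys_1: "1 \<in> mvpolys q"
  unfolding single_one[symmetric] by (rule mvpolys_single_0)
lemma sv_poly: "sv_bracket a b \<in> mvpolys 1"
proof (rule mvpolys_coord)
  fix k
  have t: "tab g h k \<in> mvpolys 1" for g h
    by (cases g; cases h) (auto simp: tab_def scalar_def dd_def intro!: mvpolys_0 mvpolys_1 mvpolys_numeral
       mvpolys_uminus mvpolys_add mvpolys_mult mvpolys_lam intro: mvpolys_single_0)
  show "coord k (sv_bracket a b) \<in> mvpolys 1"
    unfolding coord_bracket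
    by (intro mvpolys_sum mvpolys_mult mvpolys_psubst mvpolys_add mvpolys_uminus mvpolys_lam t)
      (simp_all add: dd_def mvpolys_single_0)
qed

lemma sv_scale_nth [simp]: "sv_scale p a $ g = p * a $ g"
  by (simp add: sv_scale_def)

lemma sv_left: "sv_bracket (sv_scale p a) b = vmult sv_scale (psubst p (- lam 0)) (sv_bracket a b)"
  by (rule coord_eqI) (simp add: coord_bracket sum_distrib_left mult_ac)
lemma sv_right: "sv_bracket a (sv_scale p b) = vmult sv_scale (psubst p (dd + lam 0)) (sv_bracket a b)"
  by (rule coord_eqI) (simp add: coord_bracket sum_distrib_left mult_ac)

theorem sv_lie_conformal_algebra:
  "lie_conformal_algebra (sv_scale :: 'f::field_char_0 poly \<Rightarrow> _) sv_bracket"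
proof unfold_locales
  show "sv_scale p (a + b) = sv_scale p a + sv_scale p b" for p and a b :: "'f sv"
    by (simp add: sv_scale_def vector_add_ldistrib)
  show "sv_scale (p + q) a = sv_scale p a + sv_scale q a" for p q and a :: "'f sv"
    by (simp add: sv_scale_def vector_sadd_rdistrib)
  show "sv_scale p (sv_scale q a) = sv_scale (p * q) a" for p q and a :: "'f sv"
    by (simp add: sv_scale_def vector_smult_assoc)
  show "sv_scale 1 a = a" for a :: "'f sv"
    by (simp add: sv_scale_def)
  show "sv_bracket (a + a') b = sv_bracket a b + sv_bracket a' b" for a a' b :: "'f sv"
    by (rule coord_eqI) (simp add: coord_bracket algebra_simps sum.distrib)
  show "sv_bracket a (b + b') = sv_bracket a b + sv_bracket a b'" for a b b' :: "'f sv"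
    by (rule coord_eqI) (simp add: coord_bracket algebra_simps sum.distrib)
  show "sv_bracket (sv_scale [:k:] a) b = vmult sv_scale (scalar k) (sv_bracket a b)" for k and a b :: "'f sv"
    by (simp add: sv_left)
  show "sv_bracket a (sv_scale [:k:] b) = vmult sv_scale (scalar k) (sv_bracket a b)" for k and a b :: "'f sv"
    by (simp add: sv_right)
  show "sv_bracket (sv_scale [:0, 1:] a) b = vmult sv_scale (- lam 0) (sv_bracket a b)" for a b :: "'f sv"
    by (simp add: sv_left)
  show "sv_bracket a (sv_scale [:0, 1:] b) = vmult sv_scale (dd + lam 0) (sv_bracket a b)" for a b :: "'f sv"
    by (simp add: sv_right)
qed (fact sv_poly sv_skew sv_jacobi)+

end

theory Submission
  imports Defs
begin

text \<open>
  A basic cochain is determined by the coefficients of the polynomials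
  \<open>f\<^bsub>\<lambda>\<^sub>0,\<dots>,\<lambda>\<^bsub>q-1\<^esub>\<^esub>(g\<^sub>0, \<dots>, g\<^bsub>q-1\<^esub>)\<close> at generators.  With the coefficient of \<open>\<lambda>\<^sup>n\<close> multiplied by \<open>n!\<close>
  these coefficients form an alternating function of pairs \<open>(g, n)\<close>, where \<open>(g, n)\<close> stands for the
  basis element \<open>g\<^bsub>(n)\<^esub>\<close> of the annihilation Lie algebra, and the differential of the basic complex
  becomes the Chevalley-Eilenberg differential (\<open>coeffs_of_adjoint_d\<close>).  Every alternating function
  of bounded support arises in this way (\<open>realize_coefficients\<close>), so the basic cohomology is that
  of a Lie algebra with an explicit basis.

  There Cartan's formula \<open>d \<iota>\<^sub>x + \<iota>\<^sub>x d = \<theta>\<^sub>x\<close> makes each Lie derivative \<open>\<theta>\<^sub>x\<close> homotopic to zero.  For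
  \<open>x = L\<^bsub>(1)\<^esub>\<close>, which measures conformal weight, and \<open>x = N\<^bsub>(0)\<^esub>\<close>, which counts charge (\<open>2\<close> for \<open>M\<close>, \<open>1\<close>
  for \<open>Y\<close>), the operator \<open>\<theta>\<^sub>x\<close> is diagonal; hence a closed cochain is cohomologous to its part of
  weight and charge zero (\<open>diagonal_reduction\<close>).  Very little is left of that part: an alternating
  cochain does not take the same label twice, and among the basis elements of the Lie algebra only
  \<open>L\<^bsub>(0)\<^esub>\<close> and \<open>Y\<^bsub>(0)\<^esub>\<close> lower the weight.  Apart from \<open>L\<^bsub>(1)\<^esub>\<close> and \<open>N\<^bsub>(0)\<^esub>\<close>, which may be adjoined
  freely, the possible sets of arguments are \<open>{L\<^bsub>(0)\<^esub>}\<close>, \<open>{L\<^bsub>(0)\<^esub>, M\<^bsub>(0)\<^esub>}\<close>, \<open>{L\<^bsub>(0)\<^esub>, Y\<^bsub>(0)\<^esub>}\<close> and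
  \<open>{L\<^bsub>(0)\<^esub>, Y\<^bsub>(0)\<^esub>, Y\<^bsub>(1)\<^esub>}\<close>, with values in \<open>F N\<close>, \<open>F M\<close>, \<open>F Y\<close> and \<open>F M\<close> (\<open>invariant_shape\<close>).  This
  complex is contracted by inserting \<open>M\<^bsub>(0)\<^esub>\<close> and sending \<open>M\<close> to \<open>N\<close>, corrected by inserting \<open>Y\<^bsub>(1)\<^esub>\<close>
  and sending \<open>M\<close> to \<open>Y\<close> (\<open>contraction\<close>).

  The reduced complex inherits exactness because \<open>\<partial>\<close> is injective on cochains and commutes with
  the differential: if \<open>d f = \<partial> g\<close>, then \<open>\<partial> d g = 0\<close>, so \<open>g = d h\<close>, and \<open>f - \<partial> h\<close> is closed.  Casimir
  elements and derivations are determined directly, from the zeroth and first products with the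
  generators.
\<close>


section \<open>Chevalley-Eilenberg cochains as functions of lists of basis labels\<close>

text \<open>
  A Lie algebra with a basis such that the bracket of two basis elements is a multiple \<open>c x y\<close> of a
  single basis element \<open>e x y\<close>, acting on a vector space.  Cochains are functions of lists of
  basis elements.  The labels \<open>e x y\<close> with \<open>c x y = 0\<close> carry no information, which is why
  the Jacobi identity compares the values of an arbitrary function \<open>\<phi>\<close> of labels.
\<close>
locale labelled_lie_module = vector_space scl
  for scl :: "'f::field \<Rightarrow> 'v::ab_group_add \<Rightarrow> 'v" +
  fixes c :: "'b \<Rightarrow> 'b \<Rightarrow> 'f" and e :: "'b \<Rightarrow> 'b \<Rightarrow> 'b" and act :: "'b \<Rightarrow> 'v \<Rightarrow> 'v"
  assumes c_skew: "c y x = - c x y"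
    and e_comm: "e y x = e x y"
    and jacobi: "scl (c x y * c (e x y) z) (\<phi> (e (e x y) z)) =
       scl (c y z * c x (e y z)) (\<phi> (e x (e y z))) - scl (c x z * c y (e x z)) (\<phi> (e y (e x z)))"
    and act_add: "act x (u + v) = act x u + act x v"
    and act_scl: "act x (scl a v) = scl a (act x v)"
    and act_bracket: "scl (c x y) (act (e x y) v) = act x (act y v) - act y (act x v)"
begin

lemma act_zero [simp]: "act x 0 = 0"
  using act_add[of x 0 0] by simp

lemma act_minus: "act x (- v) = - act x v"
  using act_add[of x v "- v"] by (simp add: eq_neg_iff_add_eq_0 add.commute)

lemma act_diff: "act x (u - v) = act x u - act x v"
  using act_add[of x u "- v"] by (simp add: act_minus)

text \<open>
  The Lie derivative along \<open>x\<close>.  The recursion peels off the first argument, so that everything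
  below is proved by induction on the list of arguments with the cochain arbitrary.
\<close>
fun lie :: "'b \<Rightarrow> ('b list \<Rightarrow> 'v) \<Rightarrow> 'b list \<Rightarrow> 'v" where
  "lie x F [] = act x (F [])"
| "lie x F (y # ys) = lie x (\<lambda>zs. F (y # zs)) ys - scl (c x y) (F (e x y # ys))"

text \<open>
  The Chevalley-Eilenberg differential.  The recursion is Cartan's formula
  \<open>\<iota>\<^sub>x d = \<theta>\<^sub>x - d \<iota>\<^sub>x\<close>, where \<open>\<iota>\<^sub>x F\<close> inserts \<open>x\<close> in front; the usual alternating sum, which agrees
  with it on alternating functions only, is \<open>ce\<close> below.
\<close>
fun cd :: "('b list \<Rightarrow> 'v) \<Rightarrow> 'b list \<Rightarrow> 'v" where
  "cd F [] = 0"
| "cd F (x # xs) = lie x F xs - cd (\<lambda>zs. F (x # zs)) xs"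

lemma lie_diff: "lie x (\<lambda>zs. F zs - G zs) ys = lie x F ys - lie x G ys"
  by (induction ys arbitrary: F G) (simp_all add: act_diff scale_right_diff_distrib)

lemma lie_scl: "lie x (\<lambda>zs. scl a (F zs)) ys = scl a (lie x F ys)"
  by (induction ys arbitrary: F) (simp_all add: act_scl scale_right_diff_distrib scale_left_commute)

lemma lie_zero: "lie x (\<lambda>zs. 0) ys = 0"
  using lie_diff[of x "\<lambda>_. 0" "\<lambda>_. 0" ys] by simp

lemma lie_minus: "lie x (\<lambda>zs. - F zs) ys = - lie x F ys"
  using lie_diff[of x "\<lambda>_. 0" F ys] by (simp add: lie_zero)

lemma cd_diff: "cd (\<lambda>zs. F zs - G zs) ys = cd F ys - cd G ys"
  by (induction ys arbitrary: F G) (simp_all add: lie_diff)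

lemma cd_scl: "cd (\<lambda>zs. scl a (F zs)) ys = scl a (cd F ys)"
  by (induction ys arbitrary: F) (simp_all add: lie_scl scale_right_diff_distrib)

lemma cd_zero: "cd (\<lambda>zs. 0) ys = 0"
  using cd_diff[of "\<lambda>_. 0" "\<lambda>_. 0" ys] by simp

lemma cd_minus: "cd (\<lambda>zs. - F zs) ys = - cd F ys"
  using cd_diff[of "\<lambda>_. 0" F ys] by (simp add: cd_zero)

lemma cd_add: "cd (\<lambda>zs. F zs + G zs) ys = cd F ys + cd G ys"
  using cd_diff[of F "\<lambda>zs. - G zs" ys] by (simp add: cd_minus)

text \<open>
  The terms in which \<open>x\<close> and \<open>y\<close> act on different arguments cancel; on a single argument this is the
  Jacobi identity, and on the value it is the module axiom.
\<close>
lemma lie_lie: "lie x (lie y F) zs - lie y (lie x F) zs = scl (c x y) (lie (e x y) F zs)"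
proof (induction zs arbitrary: F)
  case Nil
  then show ?case by (simp add: act_bracket)
next
  case (Cons z zs)
  have "lie x (lie y F) (z # zs) - lie y (lie x F) (z # zs) =
     (lie x (lie y (\<lambda>zs. F (z # zs))) zs - lie y (lie x (\<lambda>zs. F (z # zs))) zs)
     - (scl (c x z * c y (e x z)) (- F (e y (e x z) # zs)) - scl (c y z * c x (e y z)) (- F (e x (e y z) # zs)))"
    by (simp add: lie_diff lie_scl scale_right_diff_distrib mult.commute)
  also have "\<dots> = scl (c x y) (lie (e x y) F (z # zs))"
    using jacobi[of x y z "\<lambda>w. F (w # zs)"]
    by (simp add: Cons.IH scale_right_diff_distrib)
  finally show ?case .
qed

text \<open>
  By Cartan's formula, both sides satisfy the same recursion up to the commutator of two Lie
  derivatives.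
\<close>
lemma lie_cd: "lie x (cd F) zs = cd (lie x F) zs"
proof (induction zs arbitrary: F)
  case (Cons y ys)
  show ?case
    using lie_lie[of x y F ys]
    by (simp add: lie_diff lie_scl cd_diff cd_scl Cons.IH scale_right_diff_distrib diff_eq_eq)
qed simp

text \<open>
  Cartan's formula turns \<open>\<iota>\<^sub>x d d\<close> into \<open>\<theta>\<^sub>x d - d \<theta>\<^sub>x + d d \<iota>\<^sub>x\<close>.
\<close>
lemma cd_cd: "cd (cd F) zs = 0"
  by (induction zs arbitrary: F) (simp_all add: cd_diff lie_cd)

text \<open>
  Only neighbouring transpositions are required; they generate, see \<open>alt_permute\<close>.
\<close>
definition alt :: "('b list \<Rightarrow> 'v) \<Rightarrow> bool" where
  "alt F \<longleftrightarrow> (\<forall>us x y vs. F (us @ x # y # vs) = - F (us @ y # x # vs))"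

lemma altD: "alt F \<Longrightarrow> F (us @ x # y # vs) = - F (us @ y # x # vs)"
  unfolding alt_def by blast

lemma altD0: "alt F \<Longrightarrow> F (x # y # vs) = - F (y # x # vs)"
  using altD[of F "[]" x y vs] by simp

lemma alt_ins: assumes "alt F" shows "alt (\<lambda>zs. F (x # zs))"
  unfolding alt_def
proof (intro allI)
  fix us a b vs
  show "F (x # us @ a # b # vs) = - F (x # us @ b # a # vs)"
    using altD[OF assms, of "x # us" a b vs] by simp
qed

lemma alt_lie: assumes "alt F" shows "alt (lie z F)"
  unfolding alt_def
proof (intro allI)
  fix us x y vs
  show "lie z F (us @ x # y # vs) = - lie z F (us @ y # x # vs)"
    using assms
  proof (induction us arbitrary: F)
    case Nil
    have "lie z (\<lambda>zs. F (x # y # zs)) vs = - lie z (\<lambda>zs. F (y # x # zs)) vs"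
      by (simp only: altD0[OF Nil, of x] lie_minus)
    then show ?case
      using altD0[OF Nil, of "e z x" y vs] altD0[OF Nil, of "e z y" x vs] by simp
  next
    case (Cons u us)
    show ?case
      using altD[OF Cons.prems, of "e z u # us" x y vs] Cons.IH[OF alt_ins[OF Cons.prems], of u] by simp
  qed
qed

text \<open>
  Applying Cartan's formula twice, \<open>(\<iota>\<^sub>y \<iota>\<^sub>x + \<iota>\<^sub>x \<iota>\<^sub>y) d F\<close> reduces to terms that cancel because the bracket
  is skew.
\<close>
lemma alt_cd: assumes "alt F" shows "alt (cd F)"
  unfolding alt_def
proof (intro allI)
  fix us x y vs
  show "cd F (us @ x # y # vs) = - cd F (us @ y # x # vs)"
    using assms
  proof (induction us arbitrary: F)
    case Nil
    have "cd (\<lambda>zs. F (x # y # zs)) vs = - cd (\<lambda>zs. F (y # x # zs)) vs"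
      by (simp only: altD0[OF Nil, of x] cd_minus)
    then show ?case
      using c_skew[of x y] by (simp add: e_comm[of x y])
  next
    case (Cons u us)
    show ?case
      using altD[OF alt_lie[OF Cons.prems], of u us x y vs] Cons.IH[OF alt_ins[OF Cons.prems], of u] by simp
  qed
qed

lemma lie_explicit:
  "lie x F ys = act x (F ys) - (\<Sum>i<length ys. scl (c x (ys ! i)) (F (ys[i := e x (ys ! i)])))"
proof (induction ys arbitrary: F)
  case (Cons y ys)
  then show ?case by (simp add: sum.lessThan_Suc_shift del: sum.lessThan_Suc)
qed simp

lemma alt_move: "alt F \<Longrightarrow> i < length xs \<Longrightarrow> F (y # nths xs (- {i})) = scl ((- 1) ^ i) (F (xs[i := y]))"
proof (induction i arbitrary: F xs)
  case 0
  then show ?case by (cases xs) (simp_all add: nths_Cons nths_all)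
next
  case (Suc i)
  then obtain a as where xs: "xs = a # as" by (cases xs) auto
  have "{j. j \<noteq> i} = - {i}" by auto
  then show ?case
    using Suc.IH[OF alt_ins[OF Suc.prems(1)], of as a] Suc.prems altD0[OF Suc.prems(1), of y a "nths as (- {i})"]
    by (simp add: xs nths_Cons)
qed

definition ce :: "('b list \<Rightarrow> 'v) \<Rightarrow> 'b list \<Rightarrow> 'v" where
  "ce F xs = (\<Sum>k<length xs. scl ((- 1) ^ k) (act (xs ! k) (F (nths xs (- {k}))))) +
     (\<Sum>l<length xs. \<Sum>k<l. scl ((- 1) ^ (k + l))
        (scl (c (xs ! k) (xs ! l)) (F (e (xs ! k) (xs ! l) # nths xs (- {k, l})))))"

text \<open>
  The explicit sum satisfies the recursion of \<open>cd\<close>: the terms that involve the first argument make up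
  the Lie derivative once the bracket, which \<open>ce\<close> puts in front, is moved back to the place of the
  argument it replaces.
\<close>
lemma ce_eq_cd: "alt F \<Longrightarrow> ce F xs = cd F xs"
proof (induction xs arbitrary: F)
  case Nil
  then show ?case by (simp add: ce_def)
next
  case (Cons x xs)
  have s: "{j. Suc j \<in> - {0}} = UNIV" "{j. Suc j \<in> - {Suc k}} = - {k}"
    "{j. Suc j \<in> - {0, Suc l}} = - {l}" "{j. Suc j \<in> - {Suc k, Suc l}} = - {k, l}" for k l
    by auto
  have n: "nths (x # xs) (- {0}) = xs" "nths (x # xs) (- {Suc k}) = x # nths xs (- {k})"
    "nths (x # xs) (- {0, Suc l}) = nths xs (- {l})"
    "nths (x # xs) (- {Suc k, Suc l}) = x # nths xs (- {k, l})" for k l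
    by (simp_all only: nths_Cons s) (simp_all add: nths_all)
  have move: "F (y # nths xs (- {l})) = scl ((- 1) ^ l) (F (xs[l := y]))" if "l < length xs" for l y
    using alt_move[OF Cons.prems that] .
  have swap: "F (y # x # vs) = - F (x # y # vs)" for y vs
    by (rule altD0[OF Cons.prems])
  have pw: "(- 1 :: 'f) ^ l * (- 1) ^ l = 1" for l
    by (simp flip: power_mult_distrib)
  have A: "(\<Sum>l<length xs. scl ((- 1) ^ l * c x (xs ! l)) (F (e x (xs ! l) # nths xs (- {l})))) =
      (\<Sum>l<length xs. scl (c x (xs ! l)) (F (xs[l := e x (xs ! l)])))"
  proof (rule sum.cong[OF refl])
    fix l assume "l \<in> {..<length xs}"
    then show "scl ((- 1) ^ l * c x (xs ! l)) (F (e x (xs ! l) # nths xs (- {l}))) =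
        scl (c x (xs ! l)) (F (xs[l := e x (xs ! l)]))"
      using move[of l "e x (xs ! l)"] pw[of l] by (simp add: mult.commute mult.left_commute)
  qed
  have "ce F (x # xs) = lie x F xs - ce (\<lambda>zs. F (x # zs)) xs"
    unfolding ce_def lie_explicit length_Cons sum.lessThan_Suc_shift nth_Cons_0 nth_Cons_Suc n
    unfolding sum.distrib sum.lessThan_Suc_shift o_def n add_0
    by (simp add: n swap A sum_negf sum.distrib)
  then show ?case using Cons.IH[OF alt_ins[OF Cons.prems]] by simp
qed

lemma alt_swap: "alt F \<Longrightarrow> F (us @ x # vs @ y # ws) = - F (us @ y # vs @ x # ws)"
proof (induction vs arbitrary: us)
  case (Cons v vs)
  show ?case
    using Cons.IH[of "us @ [v]"] Cons.prems altD[of F us x v "vs @ y # ws"] altD[of F us v y "vs @ x # ws"] by simp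
next
  case Nil
  then show ?case using altD[of F us x y ws] by simp
qed

lemma alt_swap_nth:
  assumes "alt F" "i < j" "j < length xs"
  shows "F (xs[i := xs ! j, j := xs ! i]) = - F xs"
proof -
  define us vs ws where "us = take i xs" and "vs = take (j - Suc i) (drop (Suc i) xs)" and "ws = drop (Suc j) xs"
  define x y where "x = xs ! i" and "y = xs ! j"
  have ij: "length us = i" "length vs = j - Suc i" using assms by (auto simp: us_def vs_def)
  have "drop (Suc i) xs = vs @ drop (Suc i) xs ! (j - Suc i) # drop (Suc (j - Suc i)) (drop (Suc i) xs)"
    unfolding vs_def by (rule id_take_nth_drop) (use assms in simp)
  then have d: "drop (Suc i) xs = vs @ y # ws"
    using assms by (simp add: ws_def y_def)
  have "xs = us @ x # drop (Suc i) xs"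
    unfolding us_def x_def by (rule id_take_nth_drop) (use assms in simp)
  then have x: "xs = us @ x # vs @ y # ws" by (simp only: d)
  have "xs[i := xs ! j, j := xs ! i] = us @ y # vs @ x # ws"
    unfolding x_def[symmetric] y_def[symmetric] unfolding x using ij assms(2)
    by (simp add: list_update_append nth_append Suc_diff_Suc[symmetric] del: Suc_diff_Suc)
  then show ?thesis using alt_swap[OF assms(1), of us y vs x ws] x by simp
qed

lemma alt_permute:
  assumes "alt F" "\<sigma> permutes {..<length xs}"
  shows "F (permute_list \<sigma> xs) = scl (of_int (sign \<sigma>)) (F xs)"
proof -
  define n where "n = length xs"
  have "\<forall>xs. length xs = n \<longrightarrow> F (permute_list \<sigma> xs) = scl (of_int (sign \<sigma>)) (F xs)"
    using assms(2)[folded n_def] finite_lessThan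
  proof (induction \<sigma> rule: permutes_induct)
    case id
    show ?case by (simp add: sign_id)
  next
    case (swap a b p)
    have p: "p permutes {..<n}" "permutation p" using swap by (auto simp: permutation_permutes)
    have t: "Transposition.transpose a b permutes {..<n}" using swap by (auto intro: permutes_swap_id)
    show ?case
    proof (intro allI impI)
      fix xs :: "'b list" assume l: "length xs = n"
      have 1: "F (ys[a := ys ! b, b := ys ! a]) = - F ys" if "length ys = n" for ys
        using alt_swap_nth[OF assms(1), of a b ys] alt_swap_nth[OF assms(1), of b a ys] swap that
        by (cases "a < b") (auto simp: list_update_swap)
      have "permute_list (Transposition.transpose a b) xs = xs[a := xs ! b, b := xs ! a]"
        using swap l by (intro nth_equalityI) (auto simp: permute_list_nth[OF t[folded l]] nth_list_update Transposition.transpose_def)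
      moreover have "permute_list (Transposition.transpose a b \<circ> p) xs = permute_list p (permute_list (Transposition.transpose a b) xs)"
        using p l by (subst permute_list_compose) auto
      moreover have "length (permute_list (Transposition.transpose a b) xs) = n" using l by simp
      ultimately show "F (permute_list (Transposition.transpose a b \<circ> p) xs) = scl (of_int (sign (Transposition.transpose a b \<circ> p))) (F xs)"
        using swap p 1[OF l] by (simp add: sign_compose permutation_swap_id sign_swap_id)
    qed
  qed
  then show ?thesis by (simp add: n_def)
qed

end

section \<open>The annihilation algebra of the extended Schroedinger-Virasoro algebra\<close>

type_synonym label = "sv_gen \<times> nat"

text \<open>
  The \<open>\<lambda>\<close>-brackets on generators are \<open>[g\<^sub>\<lambda> h] = (\<alpha> \<partial> + \<beta> \<lambda> + \<gamma>) (tgt g h)\<close> with \<open>\<alpha> = alpha g h\<close> and so on.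
  The values of \<open>tgt\<close> at pairs with vanishing bracket are chosen so that \<open>tgt\<close> is commutative and
  associative.
\<close>
fun tgt :: "sv_gen \<Rightarrow> sv_gen \<Rightarrow> sv_gen" where
  "tgt Gen_L h = h"
| "tgt g Gen_L = g"
| "tgt Gen_N h = h"
| "tgt g Gen_N = g"
| "tgt _ _ = Gen_M"

fun alpha :: "sv_gen \<Rightarrow> sv_gen \<Rightarrow> 'f::field_char_0" where
  "alpha Gen_L h = 1"
| "alpha Gen_Y Gen_L = 1/2"
| "alpha Gen_Y Gen_Y = 1"
| "alpha _ _ = 0"

fun beta :: "sv_gen \<Rightarrow> sv_gen \<Rightarrow> 'f::field_char_0" where
  "beta Gen_L Gen_L = 2"
| "beta Gen_L Gen_Y = 3/2"
| "beta Gen_L h = 1"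
| "beta Gen_Y Gen_L = 3/2"
| "beta g Gen_L = 1"
| "beta Gen_Y Gen_Y = 2"
| "beta _ _ = 0"

fun gamma :: "sv_gen \<Rightarrow> sv_gen \<Rightarrow> 'f::field_char_0" where
  "gamma Gen_N Gen_M = 2"
| "gamma Gen_M Gen_N = - 2"
| "gamma Gen_N Gen_Y = 1"
| "gamma Gen_Y Gen_N = - 1"
| "gamma _ _ = 0"

text \<open>
  The degree of the polynomial \<open>\<alpha> \<partial> + \<beta> \<lambda> + \<gamma>\<close>, which is homogeneous; \<open>1\<close> if it is zero.
\<close>
fun shift :: "sv_gen \<Rightarrow> sv_gen \<Rightarrow> nat" where
  "shift Gen_N Gen_M = 0"
| "shift Gen_M Gen_N = 0"
| "shift Gen_N Gen_Y = 0"
| "shift Gen_Y Gen_N = 0"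
| "shift _ _ = 1"

lemma tab_eq: "tab g h k =
    (if k = tgt g h then scalar (alpha g h) * dd + scalar (beta g h) * lam 0 + scalar (gamma g h) else 0)"
proof -
  have s: "scalar (numeral n :: 'a) = numeral n" for n
    by (induction n) (simp_all only: numeral.simps scalar_add scalar_1)
  have n: "scalar (- a :: 'a) = - scalar a" for a
    using scalar_add[of a "- a"] by (simp add: eq_neg_iff_add_eq_0 add.commute)
  show ?thesis
    by (cases g; cases h; simp add: tab_def s n)
qed

text \<open>
  The label \<open>(g, m)\<close> stands for \<open>g\<^bsub>(m)\<^esub>\<close>, which is \<open>m!\<close> times the coefficient of \<open>\<lambda>\<^sup>m\<close>.  In these terms
  \<open>[g\<^bsub>(m)\<^esub>, h\<^bsub>(n)\<^esub>]\<close> is the multiple by \<open>coef (g, m) (h, n)\<close> of the basis element \<open>lab (g, m) (h, n)\<close>.  The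
  truncated subtraction in \<open>lab\<close> does no harm: if \<open>m + n < shift g h\<close>, then \<open>m = n = 0\<close> and the
  coefficient vanishes.
\<close>
fun coef :: "label \<Rightarrow> label \<Rightarrow> 'f::field_char_0" where
  "coef (g, m) (h, n) = (beta g h - alpha g h) * of_nat m - alpha g h * of_nat n + gamma g h"

fun lab :: "label \<Rightarrow> label \<Rightarrow> label" where
  "lab (g, m) (h, n) = (tgt g h, m + n - shift g h)"

abbreviation scl :: "'f::field_char_0 \<Rightarrow> 'f sv \<Rightarrow> 'f sv" where
  "scl a v \<equiv> sv_scale [:a:] v"

definition Dn :: "nat \<Rightarrow> 'f::field_char_0 poly \<Rightarrow> 'f poly" where
  "Dn n p = (pderiv ^^ n) p"

lemma Dn_0 [simp]: "Dn 0 p = p" by (simp add: Dn_def)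
lemma Dn_Suc: "Dn (Suc n) p = pderiv (Dn n p)" by (simp add: Dn_def)
lemma Dn_Dn: "Dn m (Dn n p) = Dn (m + n) p" by (simp add: Dn_def funpow_add)
lemma Dn_zero [simp]: "Dn n 0 = 0" by (induction n) (simp_all add: Dn_Suc)
lemma Dn_add: "Dn n (p + q) = Dn n p + Dn n q"
  by (induction n) (simp_all add: Dn_Suc pderiv_add)
lemma Dn_smult: "Dn n (smult a p) = smult a (Dn n p)"
  by (induction n) (simp_all add: Dn_Suc pderiv_smult)
text \<open>
  The Leibniz rule for the \<open>n\<close>-th derivative of \<open>\<partial> p(\<partial>)\<close>.
\<close>
lemma Dn_pCons: "Dn n (pCons 0 p) = pCons 0 (Dn n p) + smult (of_nat n) (Dn (n - 1) p)"
proof (induction n)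
  case (Suc n)
  show ?case
  proof (cases n)
    case k: (Suc k)
    have "Dn (Suc n) (pCons 0 p) = pderiv (pCons 0 (Dn n p) + smult (of_nat n) (Dn (n - 1) p))"
      using Suc.IH by (simp only: Dn_Suc)
    also have "\<dots> = pCons 0 (Dn (Suc n) p) + smult (of_nat (Suc n)) (Dn n p)"
      by (simp add: k Dn_Suc pderiv_add pderiv_smult pderiv_pCons smult_add_left numeral_poly)
    finally show ?thesis by simp
  qed (simp add: Dn_Suc pderiv_pCons)
qed simp

text \<open>
  The component of \<open>g\<^bsub>(n)\<^esub> (p h)\<close> along \<open>tgt g h\<close>: by Taylor's formula, \<open>n!\<close> times the coefficient of \<open>\<lambda>\<^sup>n\<close> in
  \<open>p(\<partial> + \<lambda>)\<close> is the \<open>n\<close>-th derivative of \<open>p\<close>.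
\<close>
definition amap :: "sv_gen \<Rightarrow> sv_gen \<Rightarrow> nat \<Rightarrow> 'f::field_char_0 poly \<Rightarrow> 'f poly" where
  "amap g h n p = smult (alpha g h) (pCons 0 (Dn n p)) + smult (beta g h * of_nat n) (Dn (n - 1) p) +
     smult (gamma g h) (Dn n p)"

lemma amap_zero [simp]: "amap g h n 0 = 0" by (simp add: amap_def)
lemma amap_add: "amap g h n (p + q) = amap g h n p + amap g h n q"
  by (simp add: amap_def Dn_add smult_add_right algebra_simps)
lemma amap_smult: "amap g h n (smult a p) = smult a (amap g h n p)"
  by (simp add: amap_def Dn_smult smult_add_right mult.commute)

fun act :: "label \<Rightarrow> 'f::field_char_0 sv \<Rightarrow> 'f sv" where
  "act (g, n) v = (\<chi> k. \<Sum>h\<in>UNIV. if k = tgt g h then amap g h n (v $ h) else 0)"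

lemma sv_scale_0 [simp]: "sv_scale 0 v = 0"
  by (simp add: vec_eq_iff)

lemma sv_vector_space: "vector_space (scl :: 'f::field_char_0 \<Rightarrow> _)"
  by unfold_locales (simp_all add: vec_eq_iff smult_add_left smult_add_right mult.commute)

lemma coef_skew: "coef y x = - coef x y"
proof -
  have "coef (h,n) (g,m) = - (coef (g,m) (h,n) :: 'a)" for g h m n
    by (cases g; cases h; simp add: field_simps)
  then show ?thesis by (cases x; cases y) blast
qed

lemma lab_commute: "lab y x = lab x y"
proof -
  have "lab (h,n) (g,m) = lab (g,m) (h,n)" for g h m n
    by (cases g; cases h; simp)
  then show ?thesis by (cases x; cases y) blast
qed

text \<open>
  With the truncated subtraction removed from the coefficient, the Jacobi identity becomes an identity
  between polynomials in \<open>m\<close>, \<open>n\<close> and \<open>p\<close>.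
\<close>
lemma iterated_bracket:
  fixes \<phi> :: "label \<Rightarrow> 'f::field_char_0 sv" and m n p :: nat
  defines "M \<equiv> of_nat m" and "N \<equiv> of_nat n" and "P \<equiv> of_nat p"
  shows "scl (coef (g,m) (h,n) * coef (lab (g,m) (h,n)) (i,p)) (\<phi> (lab (lab (g,m) (h,n)) (i,p))) =
     scl (((beta g h - alpha g h) * M - alpha g h * N + gamma g h) *
       ((beta (tgt g h) i - alpha (tgt g h) i) * (M + N - of_nat (shift g h)) - alpha (tgt g h) i * P + gamma (tgt g h) i))
      (\<phi> (tgt (tgt g h) i, m + n + p - (shift g h + shift (tgt g h) i)))"
proof (cases "m + n \<ge> shift g h")
  case True
  then show ?thesis
    by (simp add: M_def N_def P_def of_nat_diff)
next
  case False
  have "shift g h \<le> 1" by (cases g; cases h; simp)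
  with False have 0: "m = 0" "n = 0" and "shift g h = 1" by auto
  from this(3) have "gamma g h = (0 :: 'f)" by (cases g; cases h; simp)
  then show ?thesis by (simp add: M_def N_def 0 vec_eq_iff)
qed

lemma lab_jacobi:
  fixes \<phi> :: "label \<Rightarrow> 'f::field_char_0 sv"
  shows "scl (coef (g,m) (h,n) * coef (lab (g,m) (h,n)) (i,p)) (\<phi> (lab (lab (g,m) (h,n)) (i,p))) =
     scl (coef (h,n) (i,p) * coef (g,m) (lab (h,n) (i,p))) (\<phi> (lab (g,m) (lab (h,n) (i,p)))) -
     scl (coef (g,m) (i,p) * coef (h,n) (lab (g,m) (i,p))) (\<phi> (lab (h,n) (lab (g,m) (i,p))))"
proof -
  interpret vector_space "scl :: 'f \<Rightarrow> _" by (rule sv_vector_space)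
  define M N P T where "M = (of_nat m :: 'f)" "N = (of_nat n :: 'f)" "P = (of_nat p :: 'f)" "T = m + n + p"
  note D = this
  have T: "n + p + m = T" "m + p + n = T" by (simp_all add: D)
  have swap: "scl (coef x y * coef z (lab x y)) (\<phi> (lab z (lab x y))) = - scl (coef x y * coef (lab x y) z) (\<phi> (lab (lab x y) z))" for x y z
    by (simp add: coef_skew[of z "lab x y"] lab_commute[of z "lab x y"])
  have comb: "scl a u = - scl b u - - scl c u" if "a = c - b" for a b c and u :: "'f sv"
    using that by (simp add: scale_left_diff_distrib)
  show ?thesis
    unfolding swap iterated_bracket D[symmetric] T
    by (cases g; cases h; cases i;
        simp only: tgt.simps shift.simps add_0_left add_0_right;
        (rule comb)?; simp; (simp add: field_simps; fail)?)
qed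

lemma poly_amap: "poly (amap g h n p) x = alpha g h * (x * poly (Dn n p) x) +
    beta g h * of_nat n * poly (Dn (n - 1) p) x + gamma g h * poly (Dn n p) x"
  by (simp add: amap_def)

text \<open>
  The coefficients vanish whenever the subtraction in the order of the derivative next to them is
  truncated.
\<close>
lemma poly_amap_amap:
  fixes p :: "'f::field_char_0 poly"
  defines "E \<equiv> \<lambda>m i x. poly (Dn (m - i) p) x"
  shows "poly (amap g h m (amap g' h' n p)) x =
    alpha g h * alpha g' h' * x * (x * E (m + n) 0 x + of_nat m * E (m + n) 1 x) +
    alpha g h * x * (beta g' h' * of_nat n * E (m + n) 1 x + gamma g' h' * E (m + n) 0 x) +
    beta g h * of_nat m * (alpha g' h' * (x * E (m + n) 1 x + (of_nat m - 1) * E (m + n) 2 x) +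
       beta g' h' * of_nat n * E (m + n) 2 x + gamma g' h' * E (m + n) 1 x) +
    gamma g h * (alpha g' h' * (x * E (m + n) 0 x + of_nat m * E (m + n) 1 x) +
       beta g' h' * of_nat n * E (m + n) 1 x + gamma g' h' * E (m + n) 0 x)"
proof -
  show ?thesis
    by (cases m; cases n; cases "m - 1")
      (simp_all add: E_def amap_def Dn_add Dn_smult Dn_pCons Dn_Dn numeral_2_eq_2, simp_all add: algebra_simps)
qed

text \<open>
  These are the coefficients of \<open>amap_bracket\<close> with respect to the products of powers of \<open>m\<close>, \<open>n\<close> and \<open>x\<close>
  with the derivatives of \<open>p\<close> of orders \<open>m + n\<close>, \<open>m + n - 1\<close> and \<open>m + n - 2\<close> at \<open>x\<close>.
\<close>
lemma structure_constants:
  fixes g h i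
  defines "c \<equiv> beta g h - alpha g h :: 'f::field_char_0" and "d \<equiv> - alpha g h"
  shows "alpha g (tgt h i) * alpha h i - alpha h (tgt g i) * alpha g i = (0 :: 'f)"
    and "alpha g (tgt h i) * gamma h i + gamma g (tgt h i) * alpha h i
       - alpha h (tgt g i) * gamma g i - gamma h (tgt g i) * alpha g i = (gamma g h * alpha (tgt g h) i :: 'f)"
    and "gamma g (tgt h i) * gamma h i - gamma h (tgt g i) * gamma g i = (gamma g h * gamma (tgt g h) i :: 'f)"
    and "alpha g (tgt h i) * alpha h i + beta g (tgt h i) * alpha h i - alpha h (tgt g i) * beta g i = c * alpha (tgt g h) i"
    and "alpha g (tgt h i) * beta h i - alpha h (tgt g i) * alpha g i - beta h (tgt g i) * alpha g i = d * alpha (tgt g h) i"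
    and "beta g (tgt h i) * gamma h i + gamma g (tgt h i) * alpha h i - gamma h (tgt g i) * beta g i =
       c * gamma (tgt g h) i + gamma g h * beta (tgt g h) i"
    and "gamma g (tgt h i) * beta h i - beta h (tgt g i) * gamma g i - gamma h (tgt g i) * alpha g i =
       d * gamma (tgt g h) i + gamma g h * beta (tgt g h) i"
    and "beta g (tgt h i) * alpha h i = c * beta (tgt g h) i"
    and "beta h (tgt g i) * alpha g i = - d * beta (tgt g h) i"
    and "beta g (tgt h i) * beta h i - beta h (tgt g i) * beta g i = (c + d) * beta (tgt g h) i"
  unfolding c_def d_def by ((cases g; cases h; cases i; simp)+)

lemma amap_bracket:
  fixes p :: "'f::field_char_0 poly"
  shows "smult (coef (g,m) (h,n)) (amap (tgt g h) i (m + n - shift g h) p) =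
    amap g (tgt h i) m (amap h i n p) - amap h (tgt g i) n (amap g i m p)"
proof -
  define a b e c d where "a = (alpha (tgt g h) i :: 'f)" and "b = (beta (tgt g h) i :: 'f)"
    and "e = (gamma (tgt g h) i :: 'f)" and "c = (beta g h - alpha g h :: 'f)" and "d = (- alpha g h :: 'f)"
  note sc = structure_constants[where g=g and h=h and i=i and 'f='f, folded a_def b_def c_def d_def e_def]
  have "poly (smult (coef (g,m) (h,n)) (amap (tgt g h) i (m + n - shift g h) p)) x =
    poly (amap g (tgt h i) m (amap h i n p) - amap h (tgt g i) n (amap g i m p)) x" for x
  proof -
    define E0 E1 E2 M K where "E0 = poly (Dn (m + n) p) x" "E1 = poly (Dn (m + n - 1) p) x"
      "E2 = poly (Dn (m + n - 2) p) x" "M = (of_nat m :: 'f)" "K = (of_nat n :: 'f)"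
    note E = this
    have "poly (amap g (tgt h i) m (amap h i n p) - amap h (tgt g i) n (amap g i m p)) x =
      (alpha g (tgt h i) * alpha h i - alpha h (tgt g i) * alpha g i) * x * x * E0 +
      (alpha g (tgt h i) * gamma h i + gamma g (tgt h i) * alpha h i
       - alpha h (tgt g i) * gamma g i - gamma h (tgt g i) * alpha g i) * x * E0 +
      (gamma g (tgt h i) * gamma h i - gamma h (tgt g i) * gamma g i) * E0 +
      (alpha g (tgt h i) * alpha h i + beta g (tgt h i) * alpha h i - alpha h (tgt g i) * beta g i) * M * x * E1 +
      (alpha g (tgt h i) * beta h i - alpha h (tgt g i) * alpha g i - beta h (tgt g i) * alpha g i) * K * x * E1 +
      (beta g (tgt h i) * gamma h i + gamma g (tgt h i) * alpha h i - gamma h (tgt g i) * beta g i) * M * E1 +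
      (gamma g (tgt h i) * beta h i - beta h (tgt g i) * gamma g i - gamma h (tgt g i) * alpha g i) * K * E1 +
      (beta g (tgt h i) * alpha h i) * M * (M - 1) * E2 + (- (beta h (tgt g i) * alpha g i)) * K * (K - 1) * E2 +
      (beta g (tgt h i) * beta h i - beta h (tgt g i) * beta g i) * M * K * E2"
      unfolding poly_diff poly_amap_amap add.commute[of n m] diff_zero E[symmetric]
      by (simp add: algebra_simps)
    also have "\<dots> = gamma g h * (a * x * E0 + b * (M + K) * E1 + e * E0) +
       (c * M + d * K) * (a * x * E1 + b * (M + K - 1) * E2 + e * E1)"
      unfolding sc(1-7) unfolding sc(8-10) by (simp add: algebra_simps)
    also have "\<dots> = poly (smult (coef (g,m) (h,n)) (amap (tgt g h) i (m + n - shift g h) p)) x"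
    proof (cases "shift g h = 0")
      case True
      then have "c = 0" "d = 0" by (cases g; cases h; simp add: c_def d_def)+
      then show ?thesis using True
        by (simp add: poly_amap a_def b_def e_def c_def d_def E algebra_simps)
    next
      case False
      then have s: "shift g h = 1" and g: "gamma g h = (0 :: 'f)" by (cases g; cases h; simp)+
      have N: "(c * M + d * K) * of_nat (m + n - 1) = (c * M + d * K) * (M + K - 1)"
        by (cases m; cases n) (simp_all add: E algebra_simps)
      have co: "coef (g,m) (h,n) = c * M + d * K" by (simp add: c_def d_def E g)
      have "poly (smult (coef (g,m) (h,n)) (amap (tgt g h) i (m + n - shift g h) p)) x =
         (c * M + d * K) * (a * x * E1) + ((c * M + d * K) * of_nat (m + n - 1)) * (b * E2) + (c * M + d * K) * (e * E1)"
        unfolding co s poly_smult poly_amap a_def[symmetric] b_def[symmetric] e_def[symmetric] E[symmetric]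
        by (simp add: E algebra_simps numeral_2_eq_2)
      then show ?thesis unfolding N g by (simp add: algebra_simps)
    qed
    finally show ?thesis by simp
  qed
  then show ?thesis
    unfolding poly_eq_poly_eq_iff[symmetric] by (rule ext)
qed

lemma tgt_left_commute: "tgt g (tgt h i) = tgt h (tgt g i)"
  by (cases g; cases h; cases i) simp_all
lemma tgt_assoc: "tgt (tgt g h) i = tgt g (tgt h i)"
  by (cases g; cases h; cases i) simp_all

lemma act_act: "act (g,m) (act (h,n) v) $ k =
   (\<Sum>i\<in>UNIV. if k = tgt g (tgt h i) then amap g (tgt h i) m (amap h i n (v $ i)) else 0)"
  by (cases g; cases h; cases k) (simp_all add: sum_gen amap_add)

lemma smult_sum_right: "smult a (sum f A) = (\<Sum>x\<in>A. smult (a::'f::field) (f x))"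
  by (induction A rule: infinite_finite_induct) (simp_all add: smult_add_right)

lemma act_bracket:
  fixes v :: "'f::field_char_0 sv"
  shows "scl (coef (g,m) (h,n)) (act (lab (g,m) (h,n)) v) = act (g,m) (act (h,n) v) - act (h,n) (act (g,m) v)"
proof -
  have s: "smult a (if P then q else 0) = (if P then smult a q else 0)" for a P and q :: "'f poly" by simp
  have "scl (coef (g,m) (h,n)) (act (lab (g,m) (h,n)) v) $ k = (act (g,m) (act (h,n) v) - act (h,n) (act (g,m) v)) $ k" for k
  proof -
    have "scl (coef (g,m) (h,n)) (act (lab (g,m) (h,n)) v) $ k =
      (\<Sum>i\<in>UNIV. if k = tgt g (tgt h i) then smult (coef (g,m) (h,n)) (amap (tgt g h) i (m + n - shift g h) (v $ i)) else 0)"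
      by (simp add: tgt_assoc smult_sum_right s del: coef.simps)
    also have "\<dots> = (\<Sum>i\<in>UNIV. (if k = tgt g (tgt h i) then amap g (tgt h i) m (amap h i n (v $ i)) else 0) -
       (if k = tgt h (tgt g i) then amap h (tgt g i) n (amap g i m (v $ i)) else 0))"
      unfolding amap_bracket by (intro sum.cong refl) (simp add: tgt_left_commute)
    also have "\<dots> = (act (g,m) (act (h,n) v) - act (h,n) (act (g,m) v)) $ k"
      unfolding vector_minus_component act_act by (simp add: sum_subtractf)
    finally show ?thesis .
  qed
  then show ?thesis by (simp only: vec_eq_iff) simp
qed

lemma sv_labelled:
  "labelled_lie_module (scl :: 'f::field_char_0 \<Rightarrow> _) coef lab act"
proof -
  interpret vector_space "scl :: 'f \<Rightarrow> _" by (rule sv_vector_space)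
  show ?thesis
  proof unfold_locales
    fix x y z :: label and u v :: "'f sv" and a :: 'f and \<phi> :: "label \<Rightarrow> 'f sv"
    show "coef y x = - (coef x y :: 'f)"
      by (rule coef_skew)
    show "lab y x = lab x y"
      by (rule lab_commute)
    show "scl (coef x y * coef (lab x y) z) (\<phi> (lab (lab x y) z)) =
       scl (coef y z * coef x (lab y z)) (\<phi> (lab x (lab y z))) - scl (coef x z * coef y (lab x z)) (\<phi> (lab y (lab x z)))"
      using lab_jacobi[of "fst x" "snd x" "fst y" "snd y" "fst z" "snd z" \<phi>] by simp
    show "act x (u + v) = act x u + act x v"
      by (cases x) (auto simp: vec_eq_iff amap_add sum.distrib[symmetric] intro!: sum.cong)
    show "act x (scl a v) = scl a (act x v)"
      by (cases x) (auto simp: vec_eq_iff amap_smult sum_distrib_left intro!: sum.cong)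
    show "scl (coef x y) (act (lab x y) v) = act x (act y v) - act y (act x v)"
      using act_bracket[of "fst x" "snd x" "fst y" "snd y" v] by (simp only: prod.collapse)
  qed
qed

interpretation sv: labelled_lie_module "scl :: 'f::field_char_0 \<Rightarrow> 'f sv \<Rightarrow> 'f sv" coef lab act
  by (rule sv_labelled)

section \<open>Vanishing of the cohomology of the annihilation algebra\<close>

definition bounded_support :: "(label list \<Rightarrow> 'v::zero) \<Rightarrow> bool" where
  "bounded_support F \<longleftrightarrow> (\<exists>N. \<forall>xs. (\<exists>x\<in>set xs. N \<le> snd x) \<longrightarrow> F xs = 0)"

lemma sv_eqI: "(\<And>k j. coeff (v $ k) j = coeff (w $ k) j) \<Longrightarrow> v = (w :: 'f::field_char_0 sv)"
  by (simp add: vec_eq_iff poly_eq_iff)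

lemma alt_repeat:
  fixes F :: "label list \<Rightarrow> 'f::field_char_0 sv"
  assumes "sv.alt F" "\<not> distinct xs"
  shows "F xs = 0"
proof -
  obtain us x vs ws where xs: "xs = us @ x # vs @ x # ws"
    using not_distinct_decomp[OF assms(2)] by auto
  have "F xs = - F xs" unfolding xs by (rule sv.alt_swap[OF assms(1)])
  then have "coeff (F xs $ k) j = - coeff (F xs $ k) j" for k j
    by (metis coeff_minus vector_uminus_component)
  then show ?thesis by (intro sv_eqI) simp
qed

lemma alt_front:
  fixes F :: "label list \<Rightarrow> 'f::field_char_0 sv"
  shows "sv.alt F \<Longrightarrow> F (us @ x # vs) = scl ((- 1) ^ length us) (F (x # us @ vs))"
proof (induction us arbitrary: F)
  case (Cons u us)
  show ?case
    using Cons.IH[OF sv.alt_ins[OF Cons.prems], of u] sv.altD0[OF Cons.prems, of u x "us @ vs"] by simp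
qed simp

lemma alt_same_set:
  fixes F :: "label list \<Rightarrow> 'f::field_char_0 sv"
  assumes "sv.alt F" "distinct xs" "distinct ys" "set xs = set ys" "F ys = 0"
  shows "F xs = 0"
proof -
  have "mset xs = mset ys" using assms set_eq_iff_mset_eq_distinct by blast
  then obtain p where "p permutes {..<length ys}" "permute_list p ys = xs"
    using mset_eq_permutation by metis
  then show ?thesis using sv.alt_permute[OF assms(1), of p ys] assms(5) by simp
qed

subsection \<open>The two diagonal operators\<close>

text \<open>
  The eigenvalue of \<open>\<theta>\<^sub>x\<close>, for \<open>x = L\<^bsub>(1)\<^esub>\<close> or \<open>x = N\<^bsub>(0)\<^esub>\<close>, on the cochains that are supported at \<open>xs\<close> and its
  permutations and have values in \<open>F \<partial>\<^sup>j k\<close>.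
\<close>
definition eig :: "label \<Rightarrow> label list \<Rightarrow> sv_gen \<Rightarrow> nat \<Rightarrow> 'f::field_char_0" where
  "eig x xs k j = (if x = (Gen_L, 1) then of_nat j + beta Gen_L k else gamma Gen_N k)
     - (\<Sum>y\<leftarrow>xs. coef x y)"

text \<open>
  Both elements act diagonally on the algebra and on the basis of the Lie algebra.
\<close>
lemma lie_diagonal:
  fixes F :: "label list \<Rightarrow> 'f::field_char_0 sv"
  assumes "x = (Gen_L, 1) \<or> x = (Gen_N, 0)"
  shows "coeff (sv.lie x F xs $ k) j = eig x xs k j * coeff (F xs $ k) j"
proof -
  have lab: "scl (coef x y) (F (xs[i := lab x y])) = scl (coef x y) (F xs)" if "xs ! i = y" for i y
  proof (cases "coef x y = (0 :: 'f)")
    case False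
    then have "lab x y = y" using assms by (cases y; cases "fst y") auto
    then show ?thesis using that by auto
  qed simp
  have "sv.lie x F xs = act x (F xs) - (\<Sum>i<length xs. scl (coef x (xs ! i)) (F xs))"
    by (simp add: sv.lie_explicit lab)
  also have "(\<Sum>i<length xs. scl (coef x (xs ! i)) (F xs)) = scl (\<Sum>y\<leftarrow>xs. coef x y) (F xs)"
    by (simp add: sv.scale_sum_left[symmetric] sum_list_sum_nth atLeast0LessThan)
  finally have *: "sv.lie x F xs = act x (F xs) - scl (\<Sum>y\<leftarrow>xs. coef x y) (F xs)" .
  have "coeff (act x v $ k) j = (if x = (Gen_L, 1) then of_nat j + beta Gen_L k else gamma Gen_N k) * coeff (v $ k) j"
    for v :: "'f sv"
  proof -
    have "coeff (pCons 0 (pderiv p)) j = of_nat j * coeff p j" for p :: "'f poly"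
      by (cases j) (simp_all add: coeff_pderiv)
    moreover have "Dn (Suc 0) p = pderiv p" for p :: "'f poly" by (simp add: Dn_Suc)
    ultimately show ?thesis
      using assms by (cases k) (auto simp: sum_gen amap_def algebra_simps)
  qed
  then show ?thesis by (simp add: * eig_def algebra_simps)
qed

definition cmul :: "(nat \<Rightarrow> 'f::field_char_0) \<Rightarrow> 'f poly \<Rightarrow> 'f poly" where
  "cmul r p = (\<Sum>j\<le>degree p. monom (r j * coeff p j) j)"

lemma coeff_cmul [simp]: "coeff (cmul r p) j = r j * coeff p j"
proof -
  have "coeff (cmul r p) j = (\<Sum>i\<le>degree p. if i = j then r i * coeff p i else 0)"
    by (simp add: cmul_def coeff_sum)
  also have "\<dots> = r j * coeff p j"
    by (cases "j \<le> degree p") (auto simp: coeff_eq_0)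
  finally show ?thesis .
qed

text \<open>
  Multiplies each coefficient of a cochain by a scalar; used to invert diagonal operators and to
  project onto their kernels.
\<close>
definition mul :: "(label list \<Rightarrow> sv_gen \<Rightarrow> nat \<Rightarrow> 'f) \<Rightarrow> (label list \<Rightarrow> 'f::field_char_0 sv) \<Rightarrow> label list \<Rightarrow> 'f sv" where
  "mul \<rho> F xs = (\<chi> k. cmul (\<rho> xs k) (F xs $ k))"

lemma coeff_mul [simp]: "coeff (mul \<rho> F xs $ k) j = \<rho> xs k j * coeff (F xs $ k) j"
  by (simp add: mul_def)

lemma mul_zero: "F xs = 0 \<Longrightarrow> mul \<rho> F xs = 0"
  by (rule sv_eqI) simp

lemma bounded_mul: "bounded_support F \<Longrightarrow> bounded_support (mul \<rho> F)"
  unfolding bounded_support_def using mul_zero by metis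

lemma eig_swap: "eig x (us @ y # z # vs) k j = eig x (us @ z # y # vs) k j"
  by (simp add: eig_def)

lemma alt_mul:
  assumes "sv.alt F"
  shows "sv.alt (mul (\<lambda>xs k j. r (eig x xs k j)) F)"
  unfolding sv.alt_def
proof (intro allI)
  fix us y z vs
  show "mul (\<lambda>xs k j. r (eig x xs k j)) F (us @ y # z # vs) = - mul (\<lambda>xs k j. r (eig x xs k j)) F (us @ z # y # vs)"
    by (rule sv_eqI) (simp add: sv.altD[OF assms, of us y] eig_swap[of x us y])
qed

text \<open>
  Let \<open>F\<^sub>0\<close> be the projection of \<open>F\<close> to the kernel of \<open>\<theta>\<^sub>x\<close>, and let \<open>G\<close> be \<open>\<theta>\<^sub>x\<^sup>-\<^sup>1\<close> of the rest.  As \<open>d\<close>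
  commutes with \<open>\<theta>\<^sub>x\<close>, it preserves the two parts, so \<open>d F = 0\<close> gives \<open>d F\<^sub>0 = 0\<close> and \<open>d G = 0\<close>; then
  \<open>F - F\<^sub>0 = \<theta>\<^sub>x G = d \<iota>\<^sub>x G\<close>.
\<close>
lemma diagonal_reduction:
  fixes F :: "label list \<Rightarrow> 'f::field_char_0 sv"
  assumes x: "x = (Gen_L, 1) \<or> x = (Gen_N, 0)"
    and F: "sv.alt F" "bounded_support F" "\<And>xs. length xs \<noteq> q \<Longrightarrow> F xs = 0"
    and closed: "\<And>xs. sv.cd F xs = 0"
  obtains F0 H where "sv.alt F0" "bounded_support F0" "\<And>xs. sv.cd F0 xs = 0"
    "\<And>xs k j. coeff (F xs $ k) j = 0 \<or> eig x xs k j \<noteq> (0 :: 'f) \<Longrightarrow> coeff (F0 xs $ k) j = 0"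
    "sv.alt H" "bounded_support H" "\<And>xs. Suc (length xs) \<noteq> q \<Longrightarrow> H xs = 0"
    "\<And>xs. F xs = F0 xs + sv.cd H xs"
proof -
  note D = lie_diagonal[OF x]
  define G where "G = mul (\<lambda>xs k j. inverse (eig x xs k j)) F"
  define G2 where "G2 = mul (\<lambda>xs k j. inverse (eig x xs k j)) G"
  define F0 where "F0 = mul (\<lambda>xs k j. if eig x xs k j = (0::'f) then 1 else 0) F"
  have F1: "sv.lie x G xs = F xs - F0 xs" for xs
    by (rule sv_eqI) (auto simp: D G_def F0_def)
  have G2: "sv.lie x G2 = G"
    by (rule ext, rule sv_eqI) (auto simp: D G2_def G_def)
  have l0: "sv.lie x F0 = (\<lambda>xs. 0)"
    by (rule ext, rule sv_eqI) (simp add: D F0_def)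
  have c1: "sv.cd (\<lambda>xs. F xs - F0 xs) xs = sv.lie x (sv.cd G) xs" for xs
    using sv.lie_cd[of x G xs] by (simp add: F1[abs_def])
  then have sum: "sv.lie x (sv.cd G) xs = - sv.cd F0 xs" for xs
    by (simp add: sv.cd_diff closed)
  have c0: "sv.lie x (sv.cd F0) xs = 0" for xs
    using sv.lie_cd[of x F0 xs] by (simp add: l0 sv.cd_zero)
  have closed0: "sv.cd F0 xs = 0" for xs
  proof (rule sv_eqI)
    fix k j
    have "coeff (sv.lie x (sv.cd G) xs $ k) j = - coeff (sv.cd F0 xs $ k) j" by (simp add: sum)
    moreover have "coeff (sv.lie x (sv.cd F0) xs $ k) j = 0" by (simp add: c0)
    ultimately show "coeff (sv.cd F0 xs $ k) j = coeff (0 $ k) j" by (auto simp: D)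
  qed
  have closedG: "sv.cd G xs = 0" for xs
  proof (rule sv_eqI)
    fix k j
    have "coeff (sv.lie x (sv.cd G) xs $ k) j = 0" by (simp add: sum closed0)
    moreover have "coeff (sv.cd G xs $ k) j = coeff (sv.lie x (sv.cd G2) xs $ k) j"
      using sv.lie_cd[of x G2 xs] by (simp add: G2)
    ultimately show "coeff (sv.cd G xs $ k) j = coeff (0 $ k) j" by (auto simp: D)
  qed
  have G: "sv.alt G" "bounded_support G"
    unfolding G_def by (intro alt_mul bounded_mul F)+
  show ?thesis
  proof (rule that[of F0 "\<lambda>zs. G (x # zs)"])
    show "sv.alt F0" unfolding F0_def by (rule alt_mul[where r = "\<lambda>a::'f. if a = 0 then 1 else 0"]) (rule F)
    show "bounded_support F0" unfolding F0_def by (intro bounded_mul F)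
    show "sv.cd F0 xs = 0" for xs by (rule closed0)
    show "coeff (F0 xs $ k) j = 0" if "coeff (F xs $ k) j = 0 \<or> eig x xs k j \<noteq> (0 :: 'f)" for xs k j
      using that by (auto simp: F0_def)
    show "sv.alt (\<lambda>zs. G (x # zs))" by (rule sv.alt_ins[OF G(1)])
    show "bounded_support (\<lambda>zs. G (x # zs))"
      using G(2) unfolding bounded_support_def by (meson list.set_intros(2))
    show "G (x # xs) = 0" if "Suc (length xs) \<noteq> q" for xs
      unfolding G_def by (rule mul_zero, rule F(3)) (use that in simp)
    show "F xs = F0 xs + sv.cd (\<lambda>zs. G (x # zs)) xs" for xs
      using F1[of xs] closedG[of "x # xs"] by (simp add: diff_eq_eq add.commute)
  qed
qed

subsection \<open>Invariant cochains\<close>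

text \<open>
  The cochains of weight and charge zero.
\<close>
definition invariant :: "(label list \<Rightarrow> 'f::field_char_0 sv) \<Rightarrow> bool" where
  "invariant F \<longleftrightarrow> (\<forall>xs k j. eig (Gen_L, 1) xs k j \<noteq> (0 :: 'f) \<or> eig (Gen_N, 0) xs k j \<noteq> (0 :: 'f) \<longrightarrow>
     coeff (F xs $ k) j = 0)"

lemma invariant_iff: "invariant F \<longleftrightarrow> (\<forall>xs. sv.lie (Gen_L, 1) F xs = 0) \<and> (\<forall>xs. sv.lie (Gen_N, 0) F xs = 0)"
  unfolding invariant_def vec_eq_iff poly_eq_iff by (simp add: lie_diagonal) blast

definition charge :: "sv_gen \<Rightarrow> nat" where
  "charge g = (case g of Gen_M \<Rightarrow> 2 | Gen_Y \<Rightarrow> 1 | _ \<Rightarrow> 0)"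

text \<open>
  Twice the conformal weight, to stay within the integers.
\<close>
definition weight2 :: "sv_gen \<Rightarrow> int" where
  "weight2 g = (case g of Gen_L \<Rightarrow> 4 | Gen_M \<Rightarrow> 2 | Gen_Y \<Rightarrow> 3 | Gen_N \<Rightarrow> 2)"

lemma invariant_support:
  fixes F :: "label list \<Rightarrow> 'f::field_char_0 sv"
  assumes "invariant F" "coeff (F xs $ k) j \<noteq> 0"
  shows "2 * int j + weight2 k = (\<Sum>y\<leftarrow>xs. weight2 (fst y) - 2 - 2 * int (snd y))"
    and "charge k = (\<Sum>y\<leftarrow>xs. charge (fst y))"
proof -
  have e: "eig (Gen_L, 1) xs k j = (0 :: 'f)" "eig (Gen_N, 0) xs k j = (0 :: 'f)"
    using assms by (auto simp: invariant_def)
  have b: "2 * beta Gen_L g = (of_int (weight2 g) :: 'f)" for g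
    by (cases g) (simp_all add: weight2_def)
  have a: "alpha Gen_L g = (1 :: 'f)" for g by (cases g) simp_all
  have w: "2 * coef (Gen_L, 1) y = (of_int (weight2 (fst y) - 2 - 2 * int (snd y)) :: 'f)" for y
    by (cases y) (simp add: b a algebra_simps)
  have g: "gamma Gen_N g = (of_nat (charge g) :: 'f)" for g
    by (cases g) (simp_all add: charge_def)
  have z: "beta Gen_N g * 0 = (0 :: 'f)" "alpha Gen_N g = (0 :: 'f)" for g by (cases g; simp)+
  have c: "coef (Gen_N, 0) y = (of_nat (charge (fst y)) :: 'f)" for y
    by (cases y) (simp add: g z)
  have s: "(\<Sum>y\<leftarrow>ys. 2 * coef (Gen_L, 1) y) = (of_int (\<Sum>y\<leftarrow>ys. weight2 (fst y) - 2 - 2 * int (snd y)) :: 'f)" for ys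
    by (induction ys) (simp_all only: w list.map sum_list.Nil sum_list.Cons of_int_0 of_int_add)
  have "2 * of_nat j + of_int (weight2 k) = 2 * (\<Sum>y\<leftarrow>xs. coef (Gen_L, 1) y :: 'f)"
    using arg_cong[OF e(1), of "\<lambda>a. 2 * a"] by (simp add: eig_def b[symmetric] algebra_simps)
  also have "\<dots> = (of_int (\<Sum>y\<leftarrow>xs. weight2 (fst y) - 2 - 2 * int (snd y)) :: 'f)"
    unfolding s[symmetric] by (simp add: sum_list_const_mult)
  finally have "(of_int (2 * int j + weight2 k) :: 'f) = of_int (\<Sum>y\<leftarrow>xs. weight2 (fst y) - 2 - 2 * int (snd y))"
    by simp
  then show "2 * int j + weight2 k = (\<Sum>y\<leftarrow>xs. weight2 (fst y) - 2 - 2 * int (snd y))"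
    by (simp only: of_int_eq_iff)
  have s: "(\<Sum>y\<leftarrow>ys. coef (Gen_N, 0) y) = (of_nat (\<Sum>y\<leftarrow>ys. charge (fst y)) :: 'f)" for ys
    by (induction ys) (simp_all only: c list.map sum_list.Nil sum_list.Cons of_nat_0 of_nat_add)
  have "(of_nat (charge k) :: 'f) = of_nat (\<Sum>y\<leftarrow>xs. charge (fst y))"
    using e(2) s[of xs] by (simp add: eig_def g)
  then show "charge k = (\<Sum>y\<leftarrow>xs. charge (fst y))"
    by (simp only: of_nat_eq_iff)
qed

text \<open>
  Compare weights.  With the arguments \<open>S\<close> split into those of positive charge (\<open>A\<close>) and those of charge
  zero (\<open>B\<close>), the charge of the value leaves at most two elements in \<open>A\<close>, while in \<open>B\<close> every label
  other than \<open>L\<^bsub>(0)\<^esub>\<close> has weight at least \<open>1\<close>.  The value has weight at least \<open>1\<close>, and only \<open>L\<^bsub>(0)\<^esub>\<close>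
  and \<open>Y\<^bsub>(0)\<^esub>\<close> can balance it.
\<close>
lemma invariant_shape:
  fixes F :: "label list \<Rightarrow> 'f::field_char_0 sv"
  assumes inv: "invariant F" and alt: "sv.alt F" and nz: "F xs \<noteq> 0"
    and no: "(Gen_L, 1) \<notin> set xs" "(Gen_N, 0) \<notin> set xs"
  shows "distinct xs" and "set xs \<in> {{(Gen_L,0)}, {(Gen_L,0),(Gen_M,0)}, {(Gen_L,0),(Gen_Y,0)}, {(Gen_L,0),(Gen_Y,0),(Gen_Y,1)}}"
proof -
  show d: "distinct xs" using alt_repeat[OF alt] nz by blast
  obtain k j where kj: "coeff (F xs $ k) j \<noteq> 0"
    using nz by (auto simp: vec_eq_iff poly_eq_iff)
  define S where "S = set xs"
  define w where "w = (\<lambda>y :: label. weight2 (fst y) - 2 - 2 * int (snd y))"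
  define A where "A = {y \<in> S. charge (fst y) > 0}"
  define B where "B = {y \<in> S. charge (fst y) = 0}"
  define B' where "B' = B - {(Gen_L, 0)}"
  have fin: "finite S" "finite A" "finite B" "finite B'" by (auto simp: S_def A_def B_def B'_def)
  have chA: "charge (fst y) > 0" if "y \<in> A" for y using that by (simp add: A_def)
  have AB: "S = A \<union> B" "A \<inter> B = {}" by (auto simp: A_def B_def)
  have W: "2 * int j + weight2 k = sum w A + sum w B"
    using invariant_support(1)[OF inv kj] d AB fin
    by (simp add: sum_list_distinct_conv_sum_set w_def[symmetric] S_def[symmetric] sum.union_disjoint)
  have "charge k = (\<Sum>y\<in>S. charge (fst y))"
    using invariant_support(2)[OF inv kj] d by (simp add: sum_list_distinct_conv_sum_set S_def)
  also have "\<dots> = (\<Sum>y\<in>A. charge (fst y))"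
    by (rule sum.mono_neutral_right) (auto simp: A_def fin)
  finally have C: "charge k = (\<Sum>y\<in>A. charge (fst y))" .
  have "w y \<le> - 2" if "y \<in> B'" for y
  proof -
    obtain g n where y: "y = (g, n)" by (cases y)
    have "(Gen_L, Suc 0) \<notin> S" "(Gen_N, 0) \<notin> S" using no by (simp_all add: S_def)
    then show ?thesis using that y
      by (cases g; cases n; cases "n - 1") (auto simp: B'_def B_def w_def weight2_def charge_def)
  qed
  then have "sum w B' \<le> (\<Sum>y\<in>B'. - 2)" by (rule sum_mono)
  then have B'w: "sum w B' \<le> - 2 * int (card B')" by simp
  have L0w: "w (Gen_L, 0) = 2" by (simp add: w_def weight2_def)
  have Bw: "(Gen_L, 0) \<in> B \<and> sum w B \<le> 2 - 2 * int (card B') \<or> (Gen_L, 0) \<notin> B \<and> sum w B \<le> 0"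
  proof (cases "(Gen_L, 0) \<in> B")
    case True
    then have "sum w B = 2 + sum w B'" unfolding B'_def by (simp add: sum.remove[OF fin(3)] L0w)
    with True B'w show ?thesis by simp
  next
    case False
    then have "B' = B" by (simp add: B'_def)
    with False B'w show ?thesis by simp
  qed
  have Seq: "S = insert (Gen_L, 0) A" if "(Gen_L, 0) \<in> B" "card B' = 0"
  proof -
    have "B' = {}" using that fin(4) by simp
    with that(1) have "B = {(Gen_L, 0)}" by (auto simp: B'_def)
    then show ?thesis using AB(1) by simp
  qed
  have "card A = (\<Sum>y\<in>A. 1)" by simp
  also have "\<dots> \<le> (\<Sum>y\<in>A. charge (fst y))" by (rule sum_mono) (auto simp: A_def)
  finally have cA: "card A \<le> charge k" using C by simp
  then have "card A \<le> 2" by (cases k) (simp_all add: charge_def)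
  then consider "card A = 0" | "card A = 1" | "card A = 2" by linarith
  then have "S \<in> {{(Gen_L,0)}, {(Gen_L,0),(Gen_M,0)}, {(Gen_L,0),(Gen_Y,0)}, {(Gen_L,0),(Gen_Y,0),(Gen_Y,1)}}"
  proof cases
    case 1
    then have A: "A = {}" using fin by simp
    then have "charge k = 0" using C by simp
    then have "weight2 k \<ge> 2" by (cases k) (simp_all add: charge_def weight2_def)
    moreover have "weight2 k \<noteq> 3" using \<open>charge k = 0\<close> by (cases k) (simp_all add: charge_def weight2_def)
    ultimately have "(Gen_L, 0) \<in> B" "card B' = 0" using Bw W A by auto
    then show ?thesis using Seq A by simp
  next
    case 2
    then obtain y where A: "A = {y}" by (auto simp: card_1_singleton_iff)
    obtain g n where y: "y = (g, n)" by (cases y)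
    have cg: "charge k = charge g" "charge g > 0" using C A y chA by auto
    then have "g = k" by (cases g; cases k; simp add: charge_def)
    with cg(2) consider "g = Gen_M" "k = Gen_M" | "g = Gen_Y" "k = Gen_Y" by (cases g) (auto simp: charge_def)
    then show ?thesis
    proof cases
      case 1
      then have "w y = - 2 * int n" by (simp add: w_def y weight2_def)
      then have "(Gen_L, 0) \<in> B" "card B' = 0" "n = 0" using W Bw A 1 by (auto simp: weight2_def)
      then show ?thesis using Seq A y 1 by simp
    next
      case 2
      then have "w y = 1 - 2 * int n" by (simp add: w_def y weight2_def)
      then have "(Gen_L, 0) \<in> B" "card B' = 0" "n = 0" using W Bw A 2 by (auto simp: weight2_def)
      then show ?thesis using Seq A y 2 by simp
    qed
  next
    case 3
    then have ck: "charge k = 2" using cA by (cases k) (simp_all add: charge_def)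
    then have k: "k = Gen_M" by (cases k) (simp_all add: charge_def)
    from 3 obtain y z where A: "A = {y, z}" "y \<noteq> z" by (auto simp: card_2_iff)
    obtain g m h n where yz: "y = (g, m)" "z = (h, n)" by (cases y; cases z)
    have "charge g + charge h = 2" "charge g > 0" "charge h > 0"
      using C A ck yz chA[of y] chA[of z] by auto
    then have gh: "g = Gen_Y" "h = Gen_Y" by (cases g; cases h; simp add: charge_def)+
    then have mn: "m \<noteq> n" using A yz by auto
    have "sum w A = 2 - 2 * int m - 2 * int n" using A yz gh by (simp add: w_def weight2_def)
    then have *: "(Gen_L, 0) \<in> B" "card B' = 0" "m + n = 1"
      using W Bw mn by (auto simp: k weight2_def)
    then have "{m, n} = {0, 1}" using mn by auto
    then have "A = {(Gen_Y, 0), (Gen_Y, 1)}" using A yz gh mn by (auto simp: doubleton_eq_iff)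
    then show ?thesis using Seq[OF *(1,2)] by simp
  qed
  then show "set xs \<in> {{(Gen_L,0)}, {(Gen_L,0),(Gen_M,0)}, {(Gen_L,0),(Gen_Y,0)}, {(Gen_L,0),(Gen_Y,0),(Gen_Y,1)}}"
    by (simp only: S_def)
qed

subsection \<open>A contraction of the invariant cochains\<close>

text \<open>
  Insert \<open>M\<^bsub>(0)\<^esub>\<close> and send \<open>M\<close> to \<open>N\<close>, or insert \<open>Y\<^bsub>(1)\<^esub>\<close> and send \<open>M\<close> to \<open>Y\<close>.  Both operations preserve weight
  and charge, and the sign between them makes the differential of the result equal to \<open>- 2 F\<close> for closed \<open>F\<close> on
  all four types of arguments.
\<close>
definition contract :: "(label list \<Rightarrow> 'f::field_char_0 sv) \<Rightarrow> label list \<Rightarrow> 'f sv" where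
  "contract F xs = axis Gen_N (F ((Gen_M, 0) # xs) $ Gen_M) - axis Gen_Y (F ((Gen_Y, 1) # xs) $ Gen_M)"

lemma coeff_contract: "coeff (contract F xs $ k) j = (if k = Gen_N then coeff (F ((Gen_M, 0) # xs) $ Gen_M) j
   else if k = Gen_Y then - coeff (F ((Gen_Y, 1) # xs) $ Gen_M) j else 0)"
  by (simp add: contract_def axis_def)

lemma alt_contract: assumes "sv.alt F" shows "sv.alt (contract F)"
  unfolding sv.alt_def
proof (intro allI)
  fix us x y vs
  show "contract F (us @ x # y # vs) = - contract F (us @ y # x # vs)"
    using sv.altD[OF assms, of "(Gen_M, 0) # us" x y vs] sv.altD[OF assms, of "(Gen_Y, 1) # us" x y vs]
    by (intro sv_eqI) (simp add: coeff_contract)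
qed

lemma bounded_contract: "bounded_support F \<Longrightarrow> bounded_support (contract F)"
proof -
  assume "bounded_support F"
  then obtain N where N: "\<And>xs x. x \<in> set xs \<Longrightarrow> N \<le> snd x \<Longrightarrow> F xs = 0"
    unfolding bounded_support_def by blast
  have "contract F xs = 0" if "x \<in> set xs" "N \<le> snd x" for xs x
    using N[of x "(Gen_M, 0) # xs"] N[of x "(Gen_Y, 1) # xs"] that
    by (intro sv_eqI) (simp add: coeff_contract)
  then show ?thesis unfolding bounded_support_def by blast
qed

lemma contract_ins:
  assumes "sv.alt F"
  shows "contract F (x # xs) = - contract (\<lambda>zs. F (x # zs)) xs"
  using sv.altD0[OF assms, of "(Gen_M, 0)" x xs] sv.altD0[OF assms, of "(Gen_Y, 1)" x xs]
  by (intro sv_eqI) (simp add: coeff_contract)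

lemma invariant_contract: assumes "invariant F" shows "invariant (contract F)"
  unfolding invariant_def
proof (intro allI impI)
  fix xs k j
  assume *: "eig (Gen_L, 1) xs k j \<noteq> (0 :: 'a) \<or> eig (Gen_N, 0) xs k j \<noteq> (0 :: 'a)"
  have "eig (Gen_L, 1) xs Gen_N j = (eig (Gen_L, 1) ((Gen_M, 0) # xs) Gen_M j :: 'a)"
    "eig (Gen_N, 0) xs Gen_N j = (eig (Gen_N, 0) ((Gen_M, 0) # xs) Gen_M j :: 'a)"
    "eig (Gen_L, 1) xs Gen_Y j = (eig (Gen_L, 1) ((Gen_Y, 1) # xs) Gen_M j :: 'a)"
    "eig (Gen_N, 0) xs Gen_Y j = (eig (Gen_N, 0) ((Gen_Y, 1) # xs) Gen_M j :: 'a)"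
    by (simp_all add: eig_def field_simps)
  then show "coeff (contract F xs $ k) j = 0"
    using assms * by (auto simp: coeff_contract invariant_def)
qed

lemma invariant_ins:
  assumes "invariant F" "x = (Gen_L, 1) \<or> x = (Gen_N, 0)"
  shows "invariant (\<lambda>zs. F (x # zs))"
proof -
  have "eig y (x # xs) k j = (eig y xs k j :: 'a)" if "y = (Gen_L, 1) \<or> y = (Gen_N, 0)" for y xs k j
    using that assms(2) by (auto simp: eig_def)
  then show ?thesis using assms(1) unfolding invariant_def by metis
qed

text \<open>
  In the first and the third case the closedness of \<open>F\<close> is used: evaluated at \<open>L\<^bsub>(0)\<^esub>, M\<^bsub>(0)\<^esub>\<close> it
  gives \<open>F(L\<^bsub>(0)\<^esub>) = 0\<close>, and at \<open>L\<^bsub>(0)\<^esub>, Y\<^bsub>(0)\<^esub>, Y\<^bsub>(1)\<^esub>\<close> it relates the coefficients of \<open>F(L\<^bsub>(0)\<^esub>, M\<^bsub>(0)\<^esub>)\<close> and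
  \<open>F(L\<^bsub>(0)\<^esub>, Y\<^bsub>(0)\<^esub>)\<close>.
\<close>
lemma contraction_base:
  fixes F :: "label list \<Rightarrow> 'f::field_char_0 sv"
  assumes alt: "sv.alt F" and inv: "invariant F" and closed: "\<And>xs. sv.cd F xs = 0"
    and xs: "xs \<in> {[(Gen_L,0)], [(Gen_L,0),(Gen_M,0)], [(Gen_L,0),(Gen_Y,0)], [(Gen_L,0),(Gen_Y,0),(Gen_Y,1)]}"
  shows "sv.cd (contract F) xs = - scl 2 (F xs)"
proof -
  have Z: "F ys $ k = 0" if "\<And>j. 2 * int j + weight2 k \<noteq> (\<Sum>y\<leftarrow>ys. weight2 (fst y) - 2 - 2 * int (snd y)) \<or>
     charge k \<noteq> (\<Sum>y\<leftarrow>ys. charge (fst y))" for ys k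
  proof (rule poly_eqI, rule ccontr)
    fix j assume "coeff (F ys $ k) j \<noteq> coeff 0 j"
    then have "coeff (F ys $ k) j \<noteq> 0" by simp
    from invariant_support[OF inv this] that[of j] show False by simp
  qed
  have K: "F ys $ k = [:coeff (F ys $ k) 0:]" if "weight2 k = (\<Sum>y\<leftarrow>ys. weight2 (fst y) - 2 - 2 * int (snd y))" for ys k
  proof (rule poly_eqI)
    fix j
    show "coeff (F ys $ k) j = coeff [:coeff (F ys $ k) 0:] j"
      using invariant_support(1)[OF inv, of ys k j] that by (cases j) auto
  qed
  have all: "v = w" if "v $ Gen_L = w $ Gen_L" "v $ Gen_M = w $ Gen_M" "v $ Gen_Y = w $ Gen_Y" "v $ Gen_N = w $ Gen_N" for v w :: "'f sv"
    unfolding vec_eq_iff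
  proof
    fix k show "v $ k = w $ k" using that by (cases k) simp_all
  qed
  note defs = weight2_def charge_def
  \<comment> \<open>The coefficients that weight and charge allow on the four lists.\<close>
  define a u v w where "a = coeff (F [(Gen_L,0)] $ Gen_N) 0" "u = coeff (F [(Gen_L,0),(Gen_M,0)] $ Gen_M) 0"
    "v = coeff (F [(Gen_L,0),(Gen_Y,0)] $ Gen_Y) 0" "w = coeff (F [(Gen_L,0),(Gen_Y,0),(Gen_Y,1)] $ Gen_M) 0"
  note d = this
  have z1: "F [x] = 0" if "x \<in> {(Gen_M,0), (Gen_Y,0), (Gen_Y,1)}" for x
    by (rule all; simp, rule Z) (use that in \<open>auto simp: defs\<close>)
  have F_L: "F [(Gen_L,0)] = axis Gen_N [:a:]"
  proof (rule all)
    have "F [(Gen_L,0)] $ Gen_N = [:a:]" unfolding d by (rule K) (simp add: defs)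
    then show "F [(Gen_L,0)] $ Gen_N = axis Gen_N [:a:] $ Gen_N" by (simp add: axis_def)
  qed (simp_all add: Z defs axis_def)
  have F_LM: "F [(Gen_L,0),(Gen_M,0)] = axis Gen_M [:u:]"
  proof (rule all)
    have "F [(Gen_L,0),(Gen_M,0)] $ Gen_M = [:u:]" unfolding d by (rule K) (simp add: defs)
    then show "F [(Gen_L,0),(Gen_M,0)] $ Gen_M = axis Gen_M [:u:] $ Gen_M" by (simp add: axis_def)
  qed (simp_all add: Z defs axis_def)
  have F_LY: "F [(Gen_L,0),(Gen_Y,0)] = axis Gen_Y [:v:]"
  proof (rule all)
    have "F [(Gen_L,0),(Gen_Y,0)] $ Gen_Y = [:v:]" unfolding d by (rule K) (simp add: defs)
    then show "F [(Gen_L,0),(Gen_Y,0)] $ Gen_Y = axis Gen_Y [:v:] $ Gen_Y" by (simp add: axis_def)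
  qed (simp_all add: Z defs axis_def)
  have F_LYY: "F [(Gen_L,0),(Gen_Y,0),(Gen_Y,1)] = axis Gen_M [:w:]"
  proof (rule all)
    have "F [(Gen_L,0),(Gen_Y,0),(Gen_Y,1)] $ Gen_M = [:w:]" unfolding d by (rule K) (simp add: defs)
    then show "F [(Gen_L,0),(Gen_Y,0),(Gen_Y,1)] $ Gen_M = axis Gen_M [:w:] $ Gen_M" by (simp add: axis_def)
  qed (simp_all add: Z defs axis_def)
  have F_LY1: "F [(Gen_L,0),(Gen_Y,1)] = 0" and F_YY: "F [(Gen_Y,0),(Gen_Y,1)] = 0"
    by (rule all; simp add: Z defs; fail)+
  have F_ML: "F [(Gen_M,0),(Gen_L,0)] = axis Gen_M [:- u:]"
    using sv.altD0[OF alt, of "(Gen_M,0)" "(Gen_L,0)" "[]"] by (rule_tac all) (simp_all add: F_LM axis_def)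
  have F_YLY: "F [(Gen_Y,1),(Gen_L,0),(Gen_Y,0)] = axis Gen_M [:w:]"
    using sv.altD0[OF alt, of "(Gen_Y,1)" "(Gen_L,0)" "[(Gen_Y,0)]"] sv.altD[OF alt, of "[(Gen_L,0)]" "(Gen_Y,1)" "(Gen_Y,0)" "[]"]
    by (simp add: F_LYY[simplified])
  have F_Y0Y0: "F [(Gen_Y,0),(Gen_Y,0)] = 0" by (rule alt_repeat[OF alt]) simp
  have act_one: "act (g, n) (axis h [:c:]) = (\<chi> k. if k = tgt g h then amap g h n [:c:] else 0)" for g n h and c :: 'f
    by (rule all) (cases h; simp add: sum_gen axis_def)+
  have am: "amap Gen_M Gen_N 0 [:c:] = [:- 2 * c:]" "amap Gen_Y Gen_N 0 [:c:] = [:- c:]"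
    "amap Gen_Y Gen_Y (Suc 0) [:c:] = [:2 * c:]" for c :: 'f
    by (simp_all add: amap_def Dn_Suc)
  have "sv.cd F [(Gen_L,0),(Gen_M,0)] = - act (Gen_M,0) (F [(Gen_L,0)])"
    using z1[of "(Gen_M,0)"] by simp
  then have a0: "a = 0"
    unfolding closed F_L act_one by (auto simp: am vec_eq_iff dest!: spec[of _ Gen_M])
  have "sv.cd F [(Gen_L,0),(Gen_Y,0),(Gen_Y,1)] = act (Gen_Y,1) (F [(Gen_L,0),(Gen_Y,0)]) - F [(Gen_L,0),(Gen_M,0)]"
    using F_LY1 F_YY F_Y0Y0 by simp
  then have uv: "u = 2 * v"
    unfolding closed F_LY F_LM act_one by (auto simp: am vec_eq_iff axis_def dest!: spec[of _ Gen_M])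
  note c = contract_def[of F]
  have c0: "contract F [] = 0" by (rule all) (simp_all add: c Z defs axis_def)
  have c1: "contract F [x] = 0" if "x \<in> {(Gen_M,0), (Gen_Y,0), (Gen_Y,1)}" for x
    by (rule all) (use that in \<open>auto simp: c Z defs axis_def\<close>)
  have cL: "contract F [(Gen_L,0)] = axis Gen_N [:- u:]"
    by (rule all) (simp_all add: c Z defs axis_def F_ML)
  have cLY: "contract F [(Gen_L,0),(Gen_Y,0)] = axis Gen_Y [:- w:]"
    using F_YLY by (rule_tac all) (simp_all add: c Z defs axis_def)
  have cz: "contract F [x, y] = 0" if "(x, y) \<in> {((Gen_L,0),(Gen_Y,1)), ((Gen_Y,0),(Gen_Y,1)), ((Gen_L,0),(Gen_M,0)), ((Gen_Y,0),(Gen_Y,0))}" for x y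
    by (rule all) (use that in \<open>auto simp: c Z defs axis_def\<close>)
  consider "xs = [(Gen_L,0)]" | "xs = [(Gen_L,0),(Gen_M,0)]" | "xs = [(Gen_L,0),(Gen_Y,0)]" | "xs = [(Gen_L,0),(Gen_Y,0),(Gen_Y,1)]"
    using xs by blast
  then show ?thesis
  proof cases
    case 1
    then show ?thesis by (simp add: c0 F_L a0 axis_def vec_eq_iff)
  next
    case 2
    have "sv.cd (contract F) xs = - act (Gen_M,0) (contract F [(Gen_L,0)])"
      using c1[of "(Gen_M,0)"] by (simp add: 2)
    then show ?thesis unfolding cL act_one am 2 F_LM by (simp add: vec_eq_iff axis_def)
  next
    case 3
    have "sv.cd (contract F) xs = - act (Gen_Y,0) (contract F [(Gen_L,0)])"
      using c1[of "(Gen_Y,0)"] by (simp add: 3)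
    then show ?thesis unfolding cL act_one am 3 F_LY uv by (simp add: vec_eq_iff axis_def)
  next
    case 4
    have "sv.cd (contract F) xs = act (Gen_Y,1) (contract F [(Gen_L,0),(Gen_Y,0)])"
      using cz by (simp add: 4)
    then show ?thesis unfolding cLY act_one am 4 F_LYY by (simp add: vec_eq_iff axis_def amap_def Dn_Suc)
  qed
qed

text \<open>
  Inserting \<open>L\<^bsub>(1)\<^esub>\<close> or \<open>N\<^bsub>(0)\<^esub>\<close> anticommutes with the contraction, and on invariant cochains also with \<open>d\<close>,
  because the Lie derivative in Cartan's formula vanishes there.  So by induction these two arguments
  can be removed, which leaves the four lists of \<open>contraction_base\<close>.
\<close>
lemma contraction:
  fixes F :: "label list \<Rightarrow> 'f::field_char_0 sv"
  assumes "sv.alt F" "invariant F" "\<And>xs. sv.cd F xs = 0"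
  shows "sv.cd (contract F) xs = - scl 2 (F xs)"
  using assms
proof (induction "length xs" arbitrary: F xs)
  case 0
  have "F [] = 0"
    using invariant_shape(2)[OF 0(3,2), of "[]"] by auto
  then show ?case using 0 by simp
next
  case (Suc n)
  define G where "G = (\<lambda>zs. sv.cd (contract F) zs + scl 2 (F zs))"
  have altG: "sv.alt G"
    unfolding sv.alt_def
  proof (intro allI)
    fix us x y vs
    show "G (us @ x # y # vs) = - G (us @ y # x # vs)"
      using sv.altD[OF sv.alt_cd[OF alt_contract[OF Suc.prems(1)]], of us x y vs] sv.altD[OF Suc.prems(1), of us x y vs]
      by (simp add: G_def)
  qed
  have ins: "G (x # zs) = 0" if x: "x = (Gen_L, 1) \<or> x = (Gen_N, 0)" and "length zs = n" for x zs
  proof -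
    have "sv.cd (contract F) (x # zs) = - sv.cd (\<lambda>ys. contract F (x # ys)) zs"
      using invariant_contract[OF Suc.prems(2)] x by (auto simp: invariant_iff)
    also have "\<dots> = sv.cd (contract (\<lambda>ys. F (x # ys))) zs"
      by (simp add: contract_ins[OF Suc.prems(1)] sv.cd_minus)
    also have "\<dots> = - scl 2 (F (x # zs))"
    proof (rule Suc.hyps(1))
      show "sv.cd (\<lambda>ys. F (x # ys)) ys = 0" for ys
        using Suc.prems(3)[of "x # ys"] Suc.prems(2) x by (auto simp: invariant_iff)
    qed (use that in \<open>auto intro: sv.alt_ins Suc.prems invariant_ins\<close>)
    finally show ?thesis by (simp add: G_def)
  qed
  have "G xs = 0"
  proof (cases "(Gen_L, 1) \<in> set xs \<or> (Gen_N, 0) \<in> set xs")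
    case True
    then obtain x where x: "x = (Gen_L, 1) \<or> x = (Gen_N, 0)" and "x \<in> set xs" by blast
    then obtain us vs where "xs = us @ x # vs" by (meson split_list)
    then show ?thesis using alt_front[OF altG, of us x vs] ins[OF x, of "us @ vs"] Suc.hyps(2) by simp
  next
    case False
    have invG: "invariant G"
    proof -
      have "sv.lie x (contract F) = (\<lambda>_. 0)" if "x = (Gen_L, 1) \<or> x = (Gen_N, 0)" for x
        using invariant_contract[OF Suc.prems(2)] that by (auto simp: invariant_iff)
      then have "invariant (sv.cd (contract F))"
        unfolding invariant_iff by (simp add: sv.lie_cd sv.cd_zero)
      then show ?thesis
        using Suc.prems(2) unfolding invariant_def G_def by simp
    qed
    show ?thesis
    proof (rule ccontr)
      assume nz: "G xs \<noteq> 0"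
      from False have no: "(Gen_L, 1) \<notin> set xs" "(Gen_N, 0) \<notin> set xs" by blast+
      note shape = invariant_shape[OF invG altG nz no]
      let ?Y = "{[(Gen_L,0)], [(Gen_L,0),(Gen_M,0)], [(Gen_L,0),(Gen_Y,0)], [(Gen_L,0),(Gen_Y,0),(Gen_Y,1)]} :: label list set"
      have "set xs \<in> set ` ?Y" using shape(2) by simp
      then obtain ys where ys: "ys \<in> ?Y" "set xs = set ys" by blast
      have "distinct ys" using ys(1) by auto
      moreover have "G ys = 0" using contraction_base[OF Suc.prems ys(1)] by (simp add: G_def)
      ultimately have "G xs = 0" using alt_same_set[OF altG shape(1) _ ys(2)] by blast
      with nz show False by blast
    qed
  qed
  then show ?case by (simp add: G_def eq_neg_iff_add_eq_0)
qed

theorem labelled_cohomology_vanishes: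
  fixes F :: "label list \<Rightarrow> 'f::field_char_0 sv"
  assumes F: "sv.alt F" "bounded_support F" "\<And>xs. length xs \<noteq> q \<Longrightarrow> F xs = 0"
    and closed: "\<And>xs. sv.cd F xs = 0"
  obtains G where "sv.alt G" "bounded_support G" "\<And>xs. Suc (length xs) \<noteq> q \<Longrightarrow> G xs = 0"
    "\<And>xs. F xs = sv.cd G xs"
proof -
  obtain F1 H1 where 1: "sv.alt F1" "bounded_support F1" "\<And>xs. sv.cd F1 xs = 0"
    "\<And>xs k j. coeff (F xs $ k) j = 0 \<or> eig (Gen_L, 1) xs k j \<noteq> (0 :: 'f) \<Longrightarrow> coeff (F1 xs $ k) j = 0"
    "sv.alt H1" "bounded_support H1" "\<And>xs. Suc (length xs) \<noteq> q \<Longrightarrow> H1 xs = 0" "\<And>xs. F xs = F1 xs + sv.cd H1 xs"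
    using diagonal_reduction[of "(Gen_L, 1)" F q] F closed by blast
  have len1: "F1 xs = 0" if "length xs \<noteq> q" for xs
    by (rule sv_eqI) (simp add: 1(4) F(3)[OF that])
  obtain F2 H2 where 2: "sv.alt F2" "bounded_support F2" "\<And>xs. sv.cd F2 xs = 0"
    "\<And>xs k j. coeff (F1 xs $ k) j = 0 \<or> eig (Gen_N, 0) xs k j \<noteq> (0 :: 'f) \<Longrightarrow> coeff (F2 xs $ k) j = 0"
    "sv.alt H2" "bounded_support H2" "\<And>xs. Suc (length xs) \<noteq> q \<Longrightarrow> H2 xs = 0" "\<And>xs. F1 xs = F2 xs + sv.cd H2 xs"
    using diagonal_reduction[of "(Gen_N, 0)" F1 q] 1(1,2,3) len1 by blast
  have inv: "invariant F2"
    unfolding invariant_def using 1(4) 2(4) by blast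
  have len2: "F2 xs = 0" if "length xs \<noteq> q" for xs
    by (rule sv_eqI) (simp add: 2(4) len1[OF that])
  \<comment> \<open>\<open>H1\<close> and \<open>H2\<close> reduce to weight zero and charge zero; \<open>C\<close> is a primitive of what is left.\<close>
  define C where "C = (\<lambda>xs. scl (- 1/2) (contract F2 xs))"
  define G where "G = (\<lambda>xs. H1 xs + (H2 xs + C xs))"
  have "sv.cd C xs = F2 xs" for xs
    using contraction[OF 2(1) inv 2(3), of xs] unfolding C_def sv.cd_scl by simp
  then have "F xs = sv.cd G xs" for xs
    by (simp add: G_def sv.cd_add 1(8) 2(8) add_ac)
  moreover have "sv.alt G"
    unfolding sv.alt_def
  proof (intro allI)
    fix us x y vs
    show "G (us @ x # y # vs) = - G (us @ y # x # vs)"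
      using sv.altD[OF 1(5), of us x y vs] sv.altD[OF 2(5), of us x y vs] sv.altD[OF alt_contract[OF 2(1)], of us x y vs]
      by (simp add: G_def C_def)
  qed
  moreover have "bounded_support G"
  proof -
    obtain N1 N2 N3 where "\<And>xs x. x \<in> set xs \<Longrightarrow> N1 \<le> snd x \<Longrightarrow> H1 xs = 0"
      "\<And>xs x. x \<in> set xs \<Longrightarrow> N2 \<le> snd x \<Longrightarrow> H2 xs = 0" "\<And>xs x. x \<in> set xs \<Longrightarrow> N3 \<le> snd x \<Longrightarrow> contract F2 xs = 0"
      using 1(6) 2(6) bounded_contract[OF 2(2)] unfolding bounded_support_def by metis
    then have "G xs = 0" if "x \<in> set xs" "N1 + N2 + N3 \<le> snd x" for xs x
      using that by (simp add: G_def C_def)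
    then show ?thesis unfolding bounded_support_def by blast
  qed
  moreover have "G xs = 0" if "Suc (length xs) \<noteq> q" for xs
    using 1(7)[OF that] 2(7)[OF that] len2[of "(Gen_M, 0) # xs"] len2[of "(Gen_Y, 1) # xs"] that
    by (simp add: G_def C_def) (rule sv_eqI, simp add: coeff_contract)
  ultimately show ?thesis using that by blast
qed

section \<open>Coefficients of polynomials in several variables\<close>

text \<open>
  The exponent of \<open>\<lambda>\<^sub>0\<^bsup>n\<^sub>0\<^esup> \<lambda>\<^sub>1\<^bsup>n\<^sub>1\<^esup> \<dots>\<close> for \<open>ns = [n\<^sub>0, n\<^sub>1, \<dots>]\<close>; \<open>spread js es\<close> is the exponent of the
  product of the \<open>es ! i\<close>-th powers of the variables with index \<open>js ! i\<close>.
\<close>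
definition monomial :: "nat list \<Rightarrow> (nat \<Rightarrow>\<^sub>0 nat)" where
  "monomial ns = (\<Sum>i<length ns. Poly_Mapping.single i (ns ! i))"

definition spread :: "nat list \<Rightarrow> nat list \<Rightarrow> (nat \<Rightarrow>\<^sub>0 nat)" where
  "spread js es = (\<Sum>i<length js. Poly_Mapping.single (js ! i) (es ! i))"

lemma lookup_monomial: "Poly_Mapping.lookup (monomial ns) i = (if i < length ns then ns ! i else 0)"
  by (simp add: monomial_def lookup_sum lookup_single when_def)

lemma monomial_of_lookup: "Poly_Mapping.keys m \<subseteq> {..<q} \<Longrightarrow> m = monomial (map (Poly_Mapping.lookup m) [0..<q])"
  by (rule poly_mapping_eqI) (auto simp: lookup_monomial in_keys_iff)

lemma lookup_spread:
  assumes "distinct js" "i < length js"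
  shows "Poly_Mapping.lookup (spread js es) (js ! i) = es ! i"
proof -
  have "(\<Sum>l<length js. if js ! l = js ! i then es ! l else 0) = (\<Sum>l<length js. if l = i then es ! l else 0)"
    by (rule sum.cong) (use assms in \<open>auto simp: nth_eq_iff_index_eq\<close>)
  then show ?thesis using assms(2) by (simp add: spread_def lookup_sum lookup_single when_def)
qed

lemma keys_spread: "Poly_Mapping.keys (spread js es) \<subseteq> set js"
  by (auto simp: in_keys_iff spread_def lookup_sum lookup_single when_def split: if_splits intro: ccontr)

lemma lookup_mult_single:
  fixes A :: "'f::field poly mvpoly" and c :: "'f poly"
  shows "Poly_Mapping.lookup (A * Poly_Mapping.single b c) M = (\<Sum>a\<in>Poly_Mapping.keys A. if a + b = M then Poly_Mapping.lookup A a * c else 0)"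
proof -
  have "A * Poly_Mapping.single b c = (\<Sum>a\<in>Poly_Mapping.keys A. Poly_Mapping.single a (Poly_Mapping.lookup A a)) * Poly_Mapping.single b c"
    by (simp only: poly_mapping_sum_single)
  then show ?thesis
    by (simp add: sum_distrib_right lookup_sum mult_single lookup_single when_def)
qed

lemma lookup_dd_mult:
  fixes A :: "'f::field poly mvpoly"
  shows "Poly_Mapping.lookup (dd * A) M = pCons 0 (Poly_Mapping.lookup A M)"
  unfolding mult.commute[of dd A] unfolding dd_def lookup_mult_single by (simp add: in_keys_iff)

lemma lookup_scalar_mult:
  fixes A :: "'f::field poly mvpoly"
  shows "Poly_Mapping.lookup (scalar a * A) M = smult a (Poly_Mapping.lookup A M)"
  unfolding mult.commute[of "scalar a" A] unfolding scalar_def lookup_mult_single by (simp add: in_keys_iff mult.commute)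

lemma lookup_lam_mult:
  fixes A :: "'f::field poly mvpoly"
  assumes "i \<notin> Poly_Mapping.keys M"
  shows "Poly_Mapping.lookup (lam i * A) (Poly_Mapping.single i n + M) =
     (if n = 0 then 0 else Poly_Mapping.lookup A (Poly_Mapping.single i (n - 1) + M))"
proof (cases n)
  case 0
  have "a + Poly_Mapping.single i 1 \<noteq> Poly_Mapping.single i n + M" for a
  proof
    assume "a + Poly_Mapping.single i 1 = Poly_Mapping.single i n + M"
    then have "Poly_Mapping.lookup (a + Poly_Mapping.single i 1) i = Poly_Mapping.lookup (Poly_Mapping.single i n + M) i"
      by simp
    then show False using assms 0 by (simp add: lookup_add in_keys_iff)
  qed
  then show ?thesis unfolding mult.commute[of "lam i" A] unfolding lam_def lookup_mult_single using 0 by simp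
next
  case (Suc k)
  have "a + Poly_Mapping.single i 1 = Poly_Mapping.single i n + M \<longleftrightarrow> a = Poly_Mapping.single i k + M" for a
  proof -
    have "Poly_Mapping.single i n + M = (Poly_Mapping.single i k + M) + Poly_Mapping.single i 1"
      by (simp add: Suc single_add[symmetric] add_ac flip: add.assoc)
    then show ?thesis by simp
  qed
  then show ?thesis unfolding mult.commute[of "lam i" A] unfolding lam_def lookup_mult_single using Suc
    by (simp add: in_keys_iff)
qed

lemma prod_lam:
  fixes n :: nat
  shows "(\<Prod>i<n. lam (js i) ^ e i) = Poly_Mapping.single (\<Sum>i<n. Poly_Mapping.single (js i) (e i)) (1 :: 'f::field poly)"
proof (induction n)
  case (Suc n)
  have "(lam i :: 'f poly mvpoly) ^ k = Poly_Mapping.single (Poly_Mapping.single i k) 1" for i k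
    by (induction k) (simp_all add: lam_def mult_single single_add[symmetric])
  with Suc show ?case by (simp add: mult_single)
qed simp

text \<open>
  The first factor and the product involve disjoint sets of variables, so the coefficient factors.
\<close>
lemma lookup_shuffle:
  fixes A :: "'f::field poly mvpoly"
  assumes A: "\<And>m. m \<in> Poly_Mapping.keys A \<Longrightarrow> Poly_Mapping.keys m \<subseteq> S"
    and js: "distinct js" "set js \<inter> S = {}" and M: "Poly_Mapping.keys M \<subseteq> S"
    and es: "length es = length js"
  shows "Poly_Mapping.lookup (A * (\<Prod>i<length js. lam (js ! i) ^ e i)) (M + spread js es) =
     (if \<forall>i<length js. e i = es ! i then Poly_Mapping.lookup A M else 0)"
proof -
  define b where "b = spread js (map e [0..<length js])"
  have b: "(\<Sum>i<length js. Poly_Mapping.single (js ! i) (e i)) = b"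
    by (simp add: b_def spread_def)
  have iff: "a + b = M + spread js es \<longleftrightarrow> a = M \<and> (\<forall>i<length js. e i = es ! i)" if "a \<in> Poly_Mapping.keys A" for a
  proof
    assume eq: "a + b = M + spread js es"
    have 0: "Poly_Mapping.lookup m j = 0" if "Poly_Mapping.keys m \<subseteq> S" "j \<in> set js" for m :: "nat \<Rightarrow>\<^sub>0 nat" and j
      using js(2) that by (auto simp: in_keys_iff)
    have "e i = es ! i" if i: "i < length js" for i
    proof -
      have "Poly_Mapping.lookup (a + b) (js ! i) = Poly_Mapping.lookup (M + spread js es) (js ! i)"
        by (simp add: eq)
      then show ?thesis
        using 0[OF A[OF \<open>a \<in> _\<close>], of "js ! i"] 0[OF M, of "js ! i"] i by (simp add: lookup_add b_def lookup_spread js(1))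
    qed
    moreover from this have "b = spread js es"
      by (simp add: b_def spread_def)
    ultimately show "a = M \<and> (\<forall>i<length js. e i = es ! i)" using eq by simp
  next
    assume "a = M \<and> (\<forall>i<length js. e i = es ! i)"
    then show "a + b = M + spread js es" by (simp add: b_def spread_def)
  qed
  have "Poly_Mapping.lookup (A * (\<Prod>i<length js. lam (js ! i) ^ e i)) (M + spread js es) =
     (\<Sum>a\<in>Poly_Mapping.keys A. if a + b = M + spread js es then Poly_Mapping.lookup A a * 1 else 0)"
    unfolding prod_lam b by (rule lookup_mult_single)
  also have "\<dots> = (\<Sum>a\<in>Poly_Mapping.keys A. if a = M then (if \<forall>i<length js. e i = es ! i then Poly_Mapping.lookup A a else 0) else 0)"
    by (rule sum.cong) (auto simp: iff)
  also have "\<dots> = (if \<forall>i<length js. e i = es ! i then Poly_Mapping.lookup A M else 0)"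
    by (auto simp: in_keys_iff)
  finally show ?thesis .
qed

lemma monomial_split:
  assumes "distinct js" "set js = {..<length ns} - K" "K \<subseteq> {..<length ns}"
  shows "monomial ns = (\<Sum>k\<in>K. Poly_Mapping.single k (ns ! k)) + spread js (map ((!) ns) js)"
proof -
  have "monomial ns = (\<Sum>i\<in>K. Poly_Mapping.single i (ns ! i)) + (\<Sum>i\<in>{..<length ns} - K. Poly_Mapping.single i (ns ! i))"
    unfolding monomial_def using assms(3) by (metis add.commute finite_lessThan sum.subset_diff)
  also have "(\<Sum>i\<in>{..<length ns} - K. Poly_Mapping.single i (ns ! i)) = spread js (map ((!) ns) js)"
    unfolding assms(2)[symmetric] spread_def
    by (simp add: sum.reindex_bij_betw[OF bij_betw_nth[OF assms(1) refl refl], symmetric])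
  finally show ?thesis .
qed

lemma mvpoly_eqI:
  assumes "w \<in> mvpolys q" "w' \<in> mvpolys q"
    and "\<And>ns. length ns = q \<Longrightarrow> Poly_Mapping.lookup w (monomial ns) = Poly_Mapping.lookup w' (monomial ns)"
  shows "w = w'"
proof (rule poly_mapping_eqI)
  fix m
  show "Poly_Mapping.lookup w m = Poly_Mapping.lookup w' m"
  proof (cases "Poly_Mapping.keys m \<subseteq> {..<q}")
    case True
    from monomial_of_lookup[OF this] assms(3)[of "map (Poly_Mapping.lookup m) [0..<q]"] show ?thesis by simp
  next
    case False
    then have "m \<notin> Poly_Mapping.keys w" "m \<notin> Poly_Mapping.keys w'" using assms(1,2) by (auto simp: mvpolys_def)
    then show ?thesis by (simp add: in_keys_iff)
  qed
qed

lemma prod_keys_lessThan: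
  fixes m :: "nat \<Rightarrow>\<^sub>0 nat"
  assumes "Poly_Mapping.keys m \<subseteq> {..<q}"
  shows "(\<Prod>i\<in>Poly_Mapping.keys m. x i ^ Poly_Mapping.lookup m i) = (\<Prod>i<q. x i ^ Poly_Mapping.lookup m i)"
  by (rule prod.mono_neutral_left) (use assms in \<open>auto simp: in_keys_iff\<close>)

lemma rhom_rhom: "rhom y x (rhom y' x' P) = rhom (rhom y x y') (\<lambda>i. rhom y x (x' i)) P"
proof -
  have pr: "rhom y x (\<Prod>i\<in>A. h i) = (\<Prod>i\<in>A. rhom y x (h i))" for h and A :: "nat set"
    by (induction A rule: infinite_finite_induct) simp_all
  have pw: "rhom y x (u ^ n) = rhom y x u ^ n" for u n
    by (induction n) simp_all
  show ?thesis
    unfolding rhom_def[of y' x'] rhom_def[of "rhom y x y'"] by (simp add: rhom_sum pr pw)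
qed

lemma rhom_cong:
  assumes "P \<in> mvpolys q" "\<And>i. i < q \<Longrightarrow> x i = x' i"
  shows "rhom y x P = rhom y x' P"
proof -
  have "(\<Prod>i\<in>Poly_Mapping.keys m. x i ^ Poly_Mapping.lookup m i) = (\<Prod>i\<in>Poly_Mapping.keys m. x' i ^ Poly_Mapping.lookup m i)"
    if "m \<in> Poly_Mapping.keys P" for m
    by (rule prod.cong) (use assms that in \<open>auto simp: mvpolys_def subset_iff\<close>)
  then show ?thesis by (simp add: rhom_def)
qed

lemma mvpolys_prod: "(\<And>i. i \<in> A \<Longrightarrow> h i \<in> mvpolys q) \<Longrightarrow> prod h A \<in> mvpolys q"
  for h :: "'b \<Rightarrow> 'f::field poly mvpoly"
  by (induction A rule: infinite_finite_induct) (auto intro: mvpolys_mult mvpolys_1)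

lemma mvpolys_power: "u \<in> mvpolys q \<Longrightarrow> u ^ n \<in> mvpolys q" for u :: "'f::field poly mvpoly"
  by (induction n) (auto intro: mvpolys_mult mvpolys_1)

lemma mvpolys_rhom:
  assumes "P \<in> mvpolys p" "\<And>i. i < p \<Longrightarrow> x i \<in> mvpolys q" "y \<in> mvpolys q"
  shows "rhom y x P \<in> mvpolys q"
  unfolding rhom_def
  by (intro mvpolys_sum mvpolys_mult mvpolys_psubst mvpolys_prod mvpolys_power assms)
    (use assms(1) in \<open>auto simp: mvpolys_def\<close>)

lemma coord_mvpolys: "w \<in> mvpolys q \<Longrightarrow> coord k w \<in> mvpolys q"
  using keys_coord[of k w] by (auto simp: mvpolys_def)

definition polys_in :: "nat set \<Rightarrow> 'f::field poly mvpoly \<Rightarrow> bool" where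
  "polys_in S w \<longleftrightarrow> (\<forall>m\<in>Poly_Mapping.keys w. Poly_Mapping.keys m \<subseteq> S)"

lemma polys_in_add: "polys_in S u \<Longrightarrow> polys_in S w \<Longrightarrow> polys_in S (u + w)"
  using Poly_Mapping.keys_add[of u w] by (force simp: polys_in_def)
lemma polys_in_diff: "polys_in S u \<Longrightarrow> polys_in S w \<Longrightarrow> polys_in S (u - w)"
  using keys_diff[of u w] by (force simp: polys_in_def)
lemma polys_in_mult: "polys_in S u \<Longrightarrow> polys_in S w \<Longrightarrow> polys_in S (u * w)"
proof -
  assume *: "polys_in S u" "polys_in S w"
  have "Poly_Mapping.keys m \<subseteq> S" if m: "m \<in> Poly_Mapping.keys (u * w)" for m
  proof -
    obtain a b where "m = a + b" "a \<in> Poly_Mapping.keys u" "b \<in> Poly_Mapping.keys w"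
      using keys_mult[of u w] m by blast
    then show ?thesis using * Poly_Mapping.keys_add[of a b] unfolding polys_in_def by blast
  qed
  then show ?thesis by (simp add: polys_in_def)
qed
lemma polys_in_single_0: "polys_in S (Poly_Mapping.single 0 p)" by (simp add: polys_in_def)
lemma polys_in_scalar: "polys_in S (scalar c)" by (simp add: scalar_def polys_in_single_0)
lemma polys_in_dd: "polys_in S dd" by (simp add: dd_def polys_in_single_0)
lemma polys_in_lam: "i \<in> S \<Longrightarrow> polys_in S (lam i)" by (simp add: polys_in_def lam_def)
lemma polys_in_power: "polys_in S u \<Longrightarrow> polys_in S (u ^ n)"
  by (induction n) (auto intro: polys_in_mult polys_in_scalar[of S 1, simplified])
lemma polys_in_psubst: "polys_in S x \<Longrightarrow> polys_in S (psubst p x)"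
  by (induction p) (auto intro: polys_in_mult polys_in_add polys_in_scalar polys_in_scalar[of S 0, simplified])

subsection \<open>Taylor coefficients\<close>

text \<open>
  Taylor's formula for \<open>p(\<partial> + \<lambda>)\<close>.
\<close>
lemma lookup_psubst_shift:
  "smult (fact n) (Poly_Mapping.lookup (psubst p (dd + lam k)) (Poly_Mapping.single k n)) = Dn n (p :: 'f::field_char_0 poly)"
proof (induction p arbitrary: n)
  case (pCons a p)
  let ?A = "psubst p (dd + lam k)"
  have l: "Poly_Mapping.lookup (lam k * ?A) (Poly_Mapping.single k n) =
     (if n = 0 then 0 else Poly_Mapping.lookup ?A (Poly_Mapping.single k (n - 1)))"
    using lookup_lam_mult[of k 0 ?A n] by simp
  have s: "Poly_Mapping.lookup (scalar a) (Poly_Mapping.single k n) = (if n = 0 then [:a:] else 0)"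
  proof -
    have "0 = Poly_Mapping.single k n \<longleftrightarrow> n = 0" by (metis lookup_single_eq lookup_zero single_zero)
    then show ?thesis by (simp add: scalar_def lookup_single when_def)
  qed
  have D: "Dn n (pCons a p) = (if n = 0 then [:a:] else 0) + Dn n (pCons 0 p)"
  proof -
    have "Dn n [:a:] = (if n = 0 then [:a:] else 0)"
      by (induction n) (simp_all add: Dn_Suc pderiv_pCons)
    moreover have "Dn n (pCons a p) = Dn n ([:a:] + pCons 0 p)" by simp
    ultimately show ?thesis by (simp only: Dn_add)
  qed
  show ?case
  proof (cases n)
    case 0
    then show ?thesis
      unfolding psubst_pCons distrib_right lookup_add lookup_dd_mult l s D using pCons.IH[of n] by simp
  next
    case (Suc n')
    have "smult (fact n) (pCons 0 (Poly_Mapping.lookup ?A (Poly_Mapping.single k n))) = pCons 0 (Dn n p)"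
      using pCons.IH[of n] by simp
    moreover have "smult (fact n) (Poly_Mapping.lookup ?A (Poly_Mapping.single k n')) = smult (of_nat n) (Dn n' p)"
      unfolding pCons.IH[of n', symmetric] by (simp add: Suc)
    moreover have "Poly_Mapping.lookup (psubst (pCons a p) (dd + lam k)) (Poly_Mapping.single k n) =
        pCons 0 (Poly_Mapping.lookup ?A (Poly_Mapping.single k n)) + Poly_Mapping.lookup ?A (Poly_Mapping.single k n')"
      unfolding psubst_pCons distrib_right lookup_add lookup_dd_mult l s using Suc by simp
    moreover have "Dn n (pCons a p) = pCons 0 (Dn n p) + smult (of_nat n) (Dn n' p)"
      unfolding D Dn_pCons using Suc by simp
    ultimately show ?thesis by (simp only: smult_add_right)
  qed
qed simp

lemma lookup_action:
  "smult (fact n) (Poly_Mapping.lookup (psubst p (dd + lam k) * (scalar (alpha g h) * dd + scalar (beta g h) * lam k + scalar (gamma g h)))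
     (Poly_Mapping.single k n)) = amap g h n (p :: 'f::field_char_0 poly)"
proof -
  let ?A = "psubst p (dd + lam k)"
  have e: "?A * (scalar (alpha g h) * dd + scalar (beta g h) * lam k + scalar (gamma g h)) =
     scalar (alpha g h) * (dd * ?A) + scalar (beta g h) * (lam k * ?A) + scalar (gamma g h) * ?A"
    by (simp add: algebra_simps)
  have l: "Poly_Mapping.lookup (lam k * ?A) (Poly_Mapping.single k n) =
     (if n = 0 then 0 else Poly_Mapping.lookup ?A (Poly_Mapping.single k (n - 1)))"
    using lookup_lam_mult[of k 0 ?A n] by simp
  have m: "smult (fact n) (Poly_Mapping.lookup (lam k * ?A) (Poly_Mapping.single k n)) = smult (of_nat n) (Dn (n - 1) p)"
    unfolding l lookup_psubst_shift[of "n - 1" p k, symmetric] by (cases n) simp_all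
  have d: "smult (fact n) (Poly_Mapping.lookup (dd * ?A) (Poly_Mapping.single k n)) = pCons 0 (Dn n p)"
    unfolding lookup_dd_mult lookup_psubst_shift[of n p k, symmetric] by simp
  have "smult (fact n) (Poly_Mapping.lookup (?A * (scalar (alpha g h) * dd + scalar (beta g h) * lam k + scalar (gamma g h))) (Poly_Mapping.single k n)) =
    smult (alpha g h) (smult (fact n) (Poly_Mapping.lookup (dd * ?A) (Poly_Mapping.single k n))) +
    smult (beta g h) (smult (fact n) (Poly_Mapping.lookup (lam k * ?A) (Poly_Mapping.single k n))) +
    smult (gamma g h) (smult (fact n) (Poly_Mapping.lookup ?A (Poly_Mapping.single k n)))"
    unfolding e by (simp add: lookup_add lookup_scalar_mult smult_add_right mult.commute[of "fact n"])
  then show ?thesis unfolding d m lookup_psubst_shift by (simp add: amap_def)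
qed

lemma lookup_binomial:
  assumes "k \<noteq> l"
  shows "smult (fact a * fact b) (Poly_Mapping.lookup ((lam k + lam l) ^ N) (Poly_Mapping.single k a + Poly_Mapping.single l b))
    = (if a + b = N then [:fact N:] else (0 :: 'f::field_char_0 poly))"
proof (induction N arbitrary: a b)
  case 0
  have "Poly_Mapping.single k a + Poly_Mapping.single l b = 0 \<longleftrightarrow> a = 0 \<and> b = 0"
  proof
    assume *: "Poly_Mapping.single k a + Poly_Mapping.single l b = 0"
    have "Poly_Mapping.lookup (Poly_Mapping.single k a + Poly_Mapping.single l b) k = 0"
      "Poly_Mapping.lookup (Poly_Mapping.single k a + Poly_Mapping.single l b) l = 0" by (simp_all only: * lookup_zero)
    then show "a = 0 \<and> b = 0" using assms by (simp add: lookup_add lookup_single when_def split: if_splits)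
  qed simp
  then show ?case by (auto simp: lookup_one when_def)
next
  case (Suc N)
  let ?E = "\<lambda>a b. Poly_Mapping.lookup ((lam k + lam l) ^ N :: 'f poly mvpoly) (Poly_Mapping.single k a + Poly_Mapping.single l b)"
  have "Poly_Mapping.lookup (lam l * (lam k + lam l) ^ N :: 'f poly mvpoly) (Poly_Mapping.single k a + Poly_Mapping.single l b) =
     (if b = 0 then 0 else ?E a (b - 1))"
    using lookup_lam_mult[of l "Poly_Mapping.single k a" "(lam k + lam l) ^ N :: 'f poly mvpoly" b] assms
    by (simp add: add.commute in_keys_iff lookup_single when_def)
  moreover have "Poly_Mapping.lookup (lam k * (lam k + lam l) ^ N :: 'f poly mvpoly) (Poly_Mapping.single k a + Poly_Mapping.single l b) =
     (if a = 0 then 0 else ?E (a - 1) b)"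
    using lookup_lam_mult[of k "Poly_Mapping.single l b" "(lam k + lam l) ^ N :: 'f poly mvpoly" a] assms
    by (simp add: in_keys_iff lookup_single when_def)
  ultimately have "Poly_Mapping.lookup ((lam k + lam l) ^ Suc N :: 'f poly mvpoly) (Poly_Mapping.single k a + Poly_Mapping.single l b) =
     (if a = 0 then 0 else ?E (a - 1) b) + (if b = 0 then 0 else ?E a (b - 1))"
    by (simp add: distrib_right lookup_add)
  moreover have "smult (fact a * fact b) (if a = 0 then 0 else ?E (a - 1) b) = (if a + b = Suc N then [:of_nat a * fact N:] else 0)"
  proof (cases a)
    case a: (Suc a')
    have "smult (fact a * fact b) (?E a' b) = smult (of_nat a) (smult (fact a' * fact b) (?E a' b))"
      by (simp add: a mult_ac)
    then show ?thesis unfolding Suc.IH by (simp add: a)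
  qed simp
  moreover have "smult (fact a * fact b) (if b = 0 then 0 else ?E a (b - 1)) = (if a + b = Suc N then [:of_nat b * fact N:] else 0)"
  proof (cases b)
    case b: (Suc b')
    have "smult (fact a * fact b) (?E a b') = smult (of_nat b) (smult (fact a * fact b') (?E a b'))"
      by (simp add: b mult_ac)
    then show ?thesis unfolding Suc.IH by (simp add: b)
  qed simp
  ultimately show ?case by (simp add: smult_add_right flip: distrib_right of_nat_add)
qed

text \<open>
  A cochain of degree \<open>N\<close> in the variable of the bracket contributes \<open>(\<lambda>\<^sub>k + \<lambda>\<^sub>l)\<^sup>N\<close>; with divided powers the
  binomial coefficients disappear, and what remains is the structure constant of the Lie algebra.
\<close>
lemma lookup_bracket:
  assumes "k \<noteq> l"
  shows "smult (fact m * fact n) (Poly_Mapping.lookup ((scalar (beta g h - alpha g h) * lam k - scalar (alpha g h) * lam l + scalar (gamma g h))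
      * (lam k + lam l) ^ N) (Poly_Mapping.single k m + Poly_Mapping.single l n)) =
    (if N = m + n - shift g h then [:coef (g, m) (h, n) * fact N:] else (0 :: 'f::field_char_0 poly))"
proof -
  let ?Q = "(lam k + lam l) ^ N :: 'f poly mvpoly" and ?M = "Poly_Mapping.single k m + Poly_Mapping.single l n"
  define E where "E = (\<lambda>a b. Poly_Mapping.lookup ?Q (Poly_Mapping.single k a + Poly_Mapping.single l b))"
  have E: "smult (fact a * fact b) (E a b) = (if a + b = N then [:fact N:] else 0)" for a b
    unfolding E_def by (rule lookup_binomial[OF assms])
  have L: "Poly_Mapping.lookup (lam l * ?Q) ?M = (if n = 0 then 0 else E m (n - 1))"
    using lookup_lam_mult[of l "Poly_Mapping.single k m" ?Q n] assms
    by (simp add: E_def add.commute in_keys_iff lookup_single when_def)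
  have K: "Poly_Mapping.lookup (lam k * ?Q) ?M = (if m = 0 then 0 else E (m - 1) n)"
    using lookup_lam_mult[of k "Poly_Mapping.single l n" ?Q m] assms
    by (simp add: E_def in_keys_iff lookup_single when_def)
  have L': "smult (fact m * fact n) (Poly_Mapping.lookup (lam l * ?Q) ?M) = (if m + n = Suc N then [:of_nat n * fact N:] else 0)"
  proof (cases n)
    case (Suc n')
    have "smult (fact m * fact n) (E m n') = smult (of_nat n) (smult (fact m * fact n') (E m n'))"
      by (simp add: Suc mult_ac)
    then show ?thesis unfolding E L by (simp add: Suc)
  qed (unfold L, simp)
  have K': "smult (fact m * fact n) (Poly_Mapping.lookup (lam k * ?Q) ?M) = (if m + n = Suc N then [:of_nat m * fact N:] else 0)"
  proof (cases m)
    case (Suc m')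
    have "smult (fact m * fact n) (E m' n) = smult (of_nat m) (smult (fact m' * fact n) (E m' n))"
      by (simp add: Suc mult_ac)
    then show ?thesis unfolding E K by (simp add: Suc)
  qed (unfold K, simp)
  have e: "(scalar (beta g h - alpha g h) * lam k - scalar (alpha g h) * lam l + scalar (gamma g h)) * ?Q =
     scalar (beta g h - alpha g h) * (lam k * ?Q) + scalar (- alpha g h) * (lam l * ?Q) + scalar (gamma g h) * ?Q"
  proof -
    have "scalar (- a) = - scalar a" for a :: 'f
      using scalar_add[of a "- a"] by (simp add: eq_neg_iff_add_eq_0 add.commute)
    then show ?thesis by (simp add: algebra_simps)
  qed
  have "smult (fact m * fact n) (Poly_Mapping.lookup ((scalar (beta g h - alpha g h) * lam k - scalar (alpha g h) * lam l + scalar (gamma g h)) * ?Q) ?M) =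
    smult (beta g h - alpha g h) (smult (fact m * fact n) (Poly_Mapping.lookup (lam k * ?Q) ?M)) +
    smult (- alpha g h) (smult (fact m * fact n) (Poly_Mapping.lookup (lam l * ?Q) ?M)) +
    smult (gamma g h) (smult (fact m * fact n) (E m n))"
    unfolding e by (simp add: E_def lookup_add lookup_scalar_mult smult_add_right smult_diff_right mult.commute[of "fact m * fact n"])
  also have "\<dots> = (if N = m + n - shift g h then [:coef (g, m) (h, n) * fact N:] else 0)"
  proof (cases "shift g h = 0")
    case True
    then have "beta g h = (0 :: 'f)" "alpha g h = (0 :: 'f)" by (cases g; cases h; simp)+
    then show ?thesis unfolding E K' L' using True by auto
  next
    case False
    then have s: "shift g h = 1" and "gamma g h = (0 :: 'f)" by (cases g; cases h; simp)+
    then show ?thesis unfolding E K' L' by (cases m; cases n) (auto simp: algebra_simps)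
  qed
  finally show ?thesis .
qed

section \<open>Semilinear maps\<close>

text \<open>
  Additive, with \<open>\<partial>\<close> on the argument acting as multiplication by \<open>x\<close>.
\<close>
definition semilinear :: "'f::field poly mvpoly \<Rightarrow> ('f sv \<Rightarrow> 'f sv mvpoly) \<Rightarrow> bool" where
  "semilinear x \<Phi> \<longleftrightarrow> (\<forall>a b. \<Phi> (a + b) = \<Phi> a + \<Phi> b) \<and>
     (\<forall>p a. \<Phi> (sv_scale p a) = vmult sv_scale (psubst p x) (\<Phi> a))"

lemma semilinear_coord:
  assumes "semilinear x \<Phi>"
  shows "coord k (\<Phi> a) = (\<Sum>g\<in>UNIV. psubst (a $ g) x * coord k (\<Phi> (axis g 1)))"
proof -
  have z: "\<Phi> 0 = 0" using assms unfolding semilinear_def by (metis add_cancel_right_right)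
  have s: "\<Phi> (sum h A) = (\<Sum>i\<in>A. \<Phi> (h i))" for h and A :: "sv_gen set"
    by (induction A rule: infinite_finite_induct) (use assms z in \<open>auto simp: semilinear_def\<close>)
  have "a = (\<Sum>g\<in>UNIV. sv_scale (a $ g) (axis g 1))"
    unfolding vec_eq_iff
  proof
    fix k show "a $ k = (\<Sum>g\<in>UNIV. sv_scale (a $ g) (axis g 1)) $ k"
      by (cases k) (simp_all add: sum_gen axis_def)
  qed
  then have "coord k (\<Phi> a) = coord k (\<Phi> (\<Sum>g\<in>UNIV. sv_scale (a $ g) (axis g 1)))" by simp
  then show ?thesis using assms by (simp add: s coord_sum semilinear_def)
qed

lemma semilinearI:
  assumes "\<And>k a. coord k (\<Phi> a) = (\<Sum>g\<in>UNIV. psubst (a $ g) x * C k g)"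
  shows "semilinear x \<Phi>"
  unfolding semilinear_def
  by (intro conjI allI coord_eqI) (simp_all add: assms ring_distribs sum.distrib sum_distrib_left mult_ac)

lemma semilinear_add: "semilinear x \<Phi> \<Longrightarrow> semilinear x \<Psi> \<Longrightarrow> semilinear x (\<lambda>a. \<Phi> a + \<Psi> a)"
  unfolding semilinear_def by (intro conjI allI coord_eqI) (simp_all add: algebra_simps)

lemma semilinear_sum: "(\<And>i. i \<in> A \<Longrightarrow> semilinear x (\<Phi> i)) \<Longrightarrow> semilinear x (\<lambda>a. \<Sum>i\<in>A. \<Phi> i a)"
proof (induction A rule: infinite_finite_induct)
  case (insert i A)
  then show ?case by (simp add: semilinear_add)
qed (auto simp: semilinear_def intro!: coord_eqI)

lemma semilinear_vmult: "semilinear x \<Phi> \<Longrightarrow> semilinear x (\<lambda>a. vmult sv_scale P (\<Phi> a))"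
  unfolding semilinear_def by (intro conjI allI coord_eqI) (simp_all add: algebra_simps)

lemma semilinear_vsubst: "semilinear x \<Phi> \<Longrightarrow> semilinear (rhom dd ((!) L) x) (\<lambda>a. vsubst sv_scale L (\<Phi> a))"
  unfolding semilinear_def by (intro conjI allI coord_eqI) simp_all

lemma semilinear_action:
  fixes \<Phi> :: "'f::field_char_0 sv \<Rightarrow> 'f sv mvpoly"
  shows "semilinear x \<Phi> \<Longrightarrow>
  semilinear (rhom (dd + y) lam x) (\<lambda>a. lin_ext sv_scale (\<lambda>v. vsubst sv_scale [y] (sv_bracket b v)) (\<Phi> a))"
  unfolding semilinear_def
  by (intro conjI allI coord_eqI) (simp_all add: ext_right distrib_left distrib_right sum.distrib sum_distrib_left mult_ac)

lemma semilinear_bracket: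
  fixes u :: "'f::field_char_0 sv mvpoly"
  shows "semilinear (- y) (\<lambda>a. lin_ext sv_scale (\<lambda>v. vsubst sv_scale [y] (sv_bracket a v)) u)"
proof (rule semilinearI)
  fix k and a :: "'f sv"
  show "coord k (lin_ext sv_scale (\<lambda>v. vsubst sv_scale [y] (sv_bracket a v)) u) =
     (\<Sum>g\<in>UNIV. psubst (a $ g) (- y) * (\<Sum>h\<in>UNIV. rhom (dd + y) lam (coord h u) * rhom dd ((!) [y]) (tab g h k)))"
    by (simp add: ext_right sum_distrib_left mult_ac)
qed

lemma semilinear_lin_ext:
  "(\<And>e. semilinear x (\<lambda>a. F a e)) \<Longrightarrow> semilinear x (\<lambda>a. lin_ext sv_scale (F a) u)"
  unfolding semilinear_def
  by (intro conjI allI coord_eqI) (simp_all add: coord_lin_ext distrib_left sum.distrib sum_distrib_left mult_ac)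

text \<open>
  The factor by which \<open>[g\<^bsub>\<lambda>\<^sub>k\<^esub> h]\<close> acts in a slot where \<open>\<partial>\<close> means multiplication by
  \<open>- (\<lambda>\<^sub>k + \<lambda>\<^sub>l)\<close>.
\<close>
definition bracket_poly :: "nat \<Rightarrow> nat \<Rightarrow> sv_gen \<Rightarrow> sv_gen \<Rightarrow> 'f::field_char_0 poly mvpoly" where
  "bracket_poly k l g h = scalar (beta g h - alpha g h) * lam k - scalar (alpha g h) * lam l + scalar (gamma g h)"

text \<open>
  On \<open>b\<close>, \<open>\<partial>\<close> acts first as \<open>\<partial> + \<lambda>\<^sub>k\<close> by the rule for the bracket, which \<open>F\<close> turns into
  \<open>- (\<lambda>\<^sub>k + \<lambda>\<^sub>l) + \<lambda>\<^sub>k = - \<lambda>\<^sub>l\<close>.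
\<close>
lemma coord_lin_ext_bracket:
  fixes F :: "'f::field_char_0 sv \<Rightarrow> 'f sv mvpoly"
  assumes "semilinear (- (lam k + lam l)) F"
  shows "coord r (lin_ext sv_scale F (vsubst sv_scale [lam k] (sv_bracket a b))) =
    (\<Sum>g\<in>UNIV. \<Sum>h\<in>UNIV. psubst (a $ g) (- lam k) * psubst (b $ h) (- lam l) *
       (bracket_poly k l g h * coord r (F (axis (tgt g h) 1))))"
proof -
  let ?y = "- (lam k + lam l) :: 'f poly mvpoly"
  let ?u = "vsubst sv_scale [lam k] (sv_bracket a b)"
  have "coord r (lin_ext sv_scale F ?u) =
    (\<Sum>m\<in>Poly_Mapping.keys ?u. \<Sum>s\<in>UNIV. Poly_Mapping.single m 1 * psubst (Poly_Mapping.lookup ?u m $ s) ?y * coord r (F (axis s 1)))"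
    unfolding coord_lin_ext semilinear_coord[OF assms, of r "Poly_Mapping.lookup ?u _"]
    by (simp only: sum_distrib_left mult.assoc)
  also have "\<dots> = (\<Sum>s\<in>UNIV. rhom ?y lam (coord s ?u) * coord r (F (axis s 1)))"
    by (subst sum.swap) (simp only: sum_distrib_right[symmetric] rhom_ext)
  also have "\<dots> = (\<Sum>s\<in>UNIV. \<Sum>g\<in>UNIV. \<Sum>h\<in>UNIV. psubst (a $ g) (- lam k) * psubst (b $ h) (- lam l) *
       (if s = tgt g h then bracket_poly k l g h * coord r (F (axis s 1)) else 0))"
  proof (rule sum.cong[OF refl])
    fix s
    have m: "scalar (- c) = - scalar c" for c :: 'f
      using scalar_add[of c "- c"] by (simp add: eq_neg_iff_add_eq_0 add.commute)
    have t: "rhom ?y lam (rhom dd ((!) [lam k]) (tab g h s)) = (if s = tgt g h then bracket_poly k l g h else 0)" for g h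
    proof -
      have sd: "scalar (c - d) = scalar c - scalar d" for c d :: 'f
        using scalar_add[of c "- d"] by (simp add: m)
      show ?thesis by (simp add: tab_eq bracket_poly_def sd algebra_simps)
    qed
    have l: "?y + lam k = - lam l" by simp
    have "rhom ?y lam (coord s ?u) = (\<Sum>g\<in>UNIV. \<Sum>h\<in>UNIV. psubst (a $ g) (- lam k) * psubst (b $ h) (- lam l) *
        (if s = tgt g h then bracket_poly k l g h else 0))"
      unfolding coord_vsubst coord_bracket rhom_sum rhom_mult t rhom_psubst
      by (simp del: minus_add_distrib add: l)
    then show "rhom ?y lam (coord s ?u) * coord r (F (axis s 1)) = (\<Sum>g\<in>UNIV. \<Sum>h\<in>UNIV. psubst (a $ g) (- lam k) * psubst (b $ h) (- lam l) *
       (if s = tgt g h then bracket_poly k l g h * coord r (F (axis s 1)) else 0))"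
      by (simp add: sum_distrib_right mult.assoc if_distrib[of "\<lambda>x. x * _"] cong: if_cong)
  qed
  also have "\<dots> = (\<Sum>g\<in>UNIV. \<Sum>h\<in>UNIV. \<Sum>s\<in>UNIV. psubst (a $ g) (- lam k) * psubst (b $ h) (- lam l) *
       (if s = tgt g h then bracket_poly k l g h * coord r (F (axis s 1)) else 0))"
    by (subst sum.swap, rule sum.cong[OF refl], rule sum.swap)
  also have "\<dots> = (\<Sum>g\<in>UNIV. \<Sum>h\<in>UNIV. psubst (a $ g) (- lam k) * psubst (b $ h) (- lam l) *
       (bracket_poly k l g h * coord r (F (axis (tgt g h) 1))))"
    by (simp only: sum_distrib_left[symmetric] sum.delta finite UNIV_I if_True)
  finally show ?thesis .
qed

lemma semilinear_bracket_left:
  fixes F :: "'f::field_char_0 sv \<Rightarrow> 'f sv mvpoly"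
  assumes "semilinear (- (lam k + lam l)) F"
  shows "semilinear (- lam k) (\<lambda>a. lin_ext sv_scale F (vsubst sv_scale [lam k] (sv_bracket a b)))"
proof (rule semilinearI)
  fix r and a :: "'f sv"
  show "coord r (lin_ext sv_scale F (vsubst sv_scale [lam k] (sv_bracket a b))) =
    (\<Sum>g\<in>UNIV. psubst (a $ g) (- lam k) * (\<Sum>h\<in>UNIV. psubst (b $ h) (- lam l) *
       (bracket_poly k l g h * coord r (F (axis (tgt g h) 1)))))"
    unfolding coord_lin_ext_bracket[OF assms] by (simp only: sum_distrib_left mult.assoc)
qed

lemma semilinear_bracket_right:
  fixes F :: "'f::field_char_0 sv \<Rightarrow> 'f sv mvpoly"
  assumes "semilinear (- (lam k + lam l)) F"
  shows "semilinear (- lam l) (\<lambda>b. lin_ext sv_scale F (vsubst sv_scale [lam k] (sv_bracket a b)))"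
proof (rule semilinearI)
  fix r and b :: "'f sv"
  show "coord r (lin_ext sv_scale F (vsubst sv_scale [lam k] (sv_bracket a b))) =
    (\<Sum>h\<in>UNIV. psubst (b $ h) (- lam l) * (\<Sum>g\<in>UNIV. psubst (a $ g) (- lam k) *
       (bracket_poly k l g h * coord r (F (axis (tgt g h) 1)))))"
    unfolding coord_lin_ext_bracket[OF assms]
    by (subst sum.swap) (simp only: sum_distrib_left mult.assoc mult.left_commute)
qed

section \<open>Sublists\<close>

lemma length_nths_compl: "length (nths xs A) = card (A \<inter> {..<length xs})"
  unfolding length_nths by (rule arg_cong[of _ _ card]) auto

lemma nths_indices: "nths xs A = map ((!) xs) (nths [0..<length xs] A)"
  using nths_map[of "(!) xs" "[0..<length xs]" A] by (simp add: map_nth)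

lemma set_nths_indices: "set (nths [0..<n] A) = A \<inter> {..<n}"
  by (force simp: set_nths)

lemma distinct_nths_indices: "distinct (nths [0..<n] A)"
  by (simp add: distinct_nthsI)

lemma nths_update_outside: "i \<notin> A \<Longrightarrow> nths (xs[i := a]) A = nths xs A"
proof -
  assume "i \<notin> A"
  then show ?thesis
    unfolding nths_indices[of "xs[i := a]"] nths_indices[of xs]
    by (auto simp: set_nths_indices) (metis nth_list_update_neq)
qed

text \<open>
  The position \<open>c\<close> depends on \<open>i\<close>, \<open>A\<close> and \<open>n\<close> only, so it is the same for the list of arguments and for
  the list of variables that go with them.
\<close>
lemma nths_update_inside:
  assumes "i \<in> A" "i < n"
  obtains c where "c < card (A \<inter> {..<n})"
    "\<And>(xs :: 'a list) a. length xs = n \<Longrightarrow> nths (xs[i := a]) A = (nths xs A)[c := a]"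
    "\<And>xs :: 'b list. length xs = n \<Longrightarrow> nths xs A ! c = xs ! i"
proof -
  define js where "js = nths [0..<n] A"
  have js: "distinct js" "set js = A \<inter> {..<n}" "length js = card (A \<inter> {..<n})"
    by (simp_all add: js_def distinct_nths_indices set_nths_indices length_nths_compl)
  then obtain c where c: "c < length js" "js ! c = i" using assms by (metis IntI in_set_conv_nth lessThan_iff)
  show ?thesis
  proof (rule that[of c])
    show "c < card (A \<inter> {..<n})" using c js by simp
    show "nths (xs[i := a]) A = (nths xs A)[c := a]" if "length xs = n" for xs :: "'a list" and a
    proof (rule nth_equalityI)
      show "length (nths (xs[i := a]) A) = length ((nths xs A)[c := a])" by (simp add: length_nths_compl)
      fix j assume "j < length (nths (xs[i := a]) A)"
      then have j: "j < length js" by (simp add: length_nths_compl js that)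
      then have "js ! j < n" using js(2) nth_mem by fastforce
      then show "nths (xs[i := a]) A ! j = (nths xs A)[c := a] ! j"
        unfolding nths_indices[of "xs[i := a]"] nths_indices[of xs] length_list_update that js_def[symmetric]
        using j c that js(1) by (auto simp: nth_list_update nth_eq_iff_index_eq)
    qed
    show "nths xs A ! c = xs ! i" if "length xs = n" for xs :: "'b list"
      unfolding nths_indices[of xs] that js_def[symmetric] using c by simp
  qed
qed

section \<open>Coefficients of cochains\<close>

definition generators_of :: "label list \<Rightarrow> 'f::field_char_0 sv list" where
  "generators_of xs = map (\<lambda>x. axis (fst x) 1) xs"

definition factorials :: "label list \<Rightarrow> 'f::field_char_0" where
  "factorials xs = (\<Prod>x\<leftarrow>xs. fact (snd x))"

text \<open>
  The coefficient with divided powers: for \<open>w = f\<^bsub>\<lambda>\<^sub>0,\<lambda>\<^sub>1,\<dots>\<^esub>(g\<^sub>0, g\<^sub>1, \<dots>)\<close> it is the value of the cochain at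
  \<open>xs = [(g\<^sub>0, n\<^sub>0), (g\<^sub>1, n\<^sub>1), \<dots>]\<close>.
\<close>
definition taylor :: "label list \<Rightarrow> 'f::field_char_0 sv mvpoly \<Rightarrow> 'f sv" where
  "taylor xs w = scl (factorials xs) (Poly_Mapping.lookup w (monomial (map snd xs)))"

definition coeffs_of :: "('f::field_char_0 sv list \<Rightarrow> 'f sv mvpoly) \<Rightarrow> label list \<Rightarrow> 'f sv" where
  "coeffs_of f xs = taylor xs (f (generators_of xs))"

definition sesquilinear :: "nat \<Rightarrow> ('f::field_char_0 sv list \<Rightarrow> 'f sv mvpoly) \<Rightarrow> bool" where
  "sesquilinear q f \<longleftrightarrow> (\<forall>as i. length as = q \<longrightarrow> i < q \<longrightarrow> semilinear (- lam i) (\<lambda>a. f (as[i := a])))"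

lemma factorials_nonzero: "factorials xs \<noteq> (0 :: 'f::field_char_0)"
  by (induction xs) (simp_all add: factorials_def)

lemma taylor_add: "taylor xs (u + w) = taylor xs u + taylor xs w"
  by (simp add: taylor_def lookup_add sv.scale_right_distrib)

lemma taylor_zero: "taylor xs 0 = 0"
  by (simp add: taylor_def)

lemma taylor_sum: "taylor xs (\<Sum>i\<in>A. w i) = (\<Sum>i\<in>A. taylor xs (w i))"
  by (induction A rule: infinite_finite_induct) (simp_all add: taylor_add taylor_zero)

lemma lookup_vmult_scalar:
  "Poly_Mapping.lookup (vmult sv_scale (scalar c) w) m = scl c (Poly_Mapping.lookup w m)"
  by (simp add: vec_eq_iff lookup_coord[symmetric] lookup_scalar_mult)

lemma taylor_scalar: "taylor xs (vmult sv_scale (scalar c) w) = scl c (taylor xs w)"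
  unfolding taylor_def lookup_vmult_scalar by (simp only: sv.scale_left_commute)

lemma minus_one_power: "(- 1) ^ n = (scalar ((- 1) ^ n) :: 'f::field poly mvpoly)"
proof (induction n)
  case (Suc n)
  have "scalar (- 1 :: 'f) = - 1"
    using scalar_add[of 1 "- 1 :: 'f"] by (simp add: eq_neg_iff_add_eq_0 add.commute)
  with Suc show ?case by (simp only: power_Suc scalar_mult)
qed simp

lemma taylor_sign: "taylor xs (vmult sv_scale ((- 1) ^ n) w) = scl ((- 1) ^ n) (taylor xs w)"
  unfolding minus_one_power by (rule taylor_scalar)

lemma factorials_nths:
  assumes "K \<subseteq> {..<length xs}"
  shows "factorials xs = (\<Prod>k\<in>K. fact (snd (xs ! k))) * factorials (nths xs (- K))"
proof -
  let ?h = "\<lambda>i. fact (snd (xs ! i)) :: 'a"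
  have A: "factorials (nths xs A) = (\<Prod>i\<in>A \<inter> {..<length xs}. ?h i)" for A
    unfolding nths_indices[of xs] factorials_def
    by (simp add: prod.distinct_set_conv_list[OF distinct_nths_indices, symmetric] set_nths_indices o_def)
  have "factorials xs = (\<Prod>i\<in>{..<length xs}. ?h i)"
    using A[of UNIV] by (simp add: nths_all)
  also have "\<dots> = (\<Prod>i\<in>K. ?h i) * (\<Prod>i\<in>{..<length xs} - K. ?h i)"
    using assms by (metis finite_lessThan mult.commute prod.subset_diff)
  also have "{..<length xs} - K = - K \<inter> {..<length xs}" by auto
  finally show ?thesis unfolding A .
qed

lemma generators_of_nths: "nths (generators_of xs) A = generators_of (nths xs A)"
  by (simp add: generators_of_def nths_map)

lemma length_nths_delete: "K \<subseteq> {..<length xs} \<Longrightarrow> length (nths xs (- K)) = length xs - card K"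
proof -
  assume K: "K \<subseteq> {..<length xs}"
  have "- K \<inter> {..<length xs} = {..<length xs} - K" by auto
  with K show ?thesis by (simp add: length_nths_compl card_Diff_subset finite_subset)
qed

lemma sum_psubst_axis:
  "(\<Sum>g'\<in>UNIV. psubst (axis g 1 $ g') x * X g') = X g"
proof -
  have "psubst (axis g 1 $ g') x * X g' = (if g' = g then X g' else 0)" for g'
    by (simp add: axis_def)
  then show ?thesis by simp
qed

definition action_term where
  "action_term f as k = lin_ext sv_scale (\<lambda>v. vsubst sv_scale [lam k] (sv_bracket (as ! k) v))
     (vsubst sv_scale (nths (map lam [0..<length as]) (- {k})) (f (nths as (- {k}))))"

definition bracket_term where
  "bracket_term f as k l = lin_ext sv_scale
     (\<lambda>e. vsubst sv_scale ((lam k + lam l) # nths (map lam [0..<length as]) (- {k, l})) (f (e # nths as (- {k, l}))))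
     (vsubst sv_scale [lam k] (sv_bracket (as ! k) (as ! l)))"

abbreviation adjoint_d :: "('f::field_char_0 sv list \<Rightarrow> 'f sv mvpoly) \<Rightarrow> 'f sv list \<Rightarrow> 'f sv mvpoly" where
  "adjoint_d \<equiv> differential sv_scale sv_bracket sv_scale sv_bracket"

lemma adjoint_d_terms: "adjoint_d f as = (\<Sum>k<length as. vmult sv_scale ((- 1) ^ k) (action_term f as k)) +
     (\<Sum>l<length as. \<Sum>k<l. vmult sv_scale ((- 1) ^ (k + l)) (bracket_term f as k l))"
  by (simp add: differential_def Let_def action_term_def bracket_term_def)

lemma nths_lam: "nths (map lam [0..<n]) A = map lam (nths [0..<n] A)"
  by (simp add: nths_map)

subsection \<open>Sesquilinearity of the differential\<close>

lemma sesquilinear_action_term: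
  assumes f: "sesquilinear q f" and as: "length as = Suc q" and i: "i < Suc q" and k: "k < Suc q"
  shows "semilinear (- lam i) (\<lambda>a. action_term f (as[i := a]) k)"
proof (cases "i = k")
  case True
  have "nths (as[k := a]) (- {k}) = nths as (- {k})" for a
    by (rule nths_update_outside) simp
  then show ?thesis using semilinear_bracket[of "lam k"] True as k by (simp add: action_term_def)
next
  case False
  then have iA: "i \<in> - {k}" by simp
  let ?L = "nths (map lam [0..<Suc q]) (- {k}) :: 'a poly mvpoly list"
  obtain c where c: "c < card (- {k} \<inter> {..<Suc q})"
    "\<And>(xs :: 'a sv list) a. length xs = Suc q \<Longrightarrow> nths (xs[i := a]) (- {k}) = (nths xs (- {k}))[c := a]"
    "\<And>xs :: 'a poly mvpoly list. length xs = Suc q \<Longrightarrow> nths xs (- {k}) ! c = xs ! i"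
    using nths_update_inside[OF iA i] by blast
  have "card (- {k} \<inter> {..<Suc q}) = q"
    using length_nths_delete[of "{k}" as] as k by (simp add: length_nths_compl)
  then have cq: "c < q" and len: "length (nths as (- {k})) = q" using c(1) by (simp_all add: length_nths_compl as)
  have "semilinear (- lam c) (\<lambda>a. f ((nths as (- {k}))[c := a]))"
    using f cq len by (simp add: sesquilinear_def)
  from semilinear_vsubst[OF this, of ?L]
  have "semilinear (- lam i) (\<lambda>a. vsubst sv_scale ?L (f ((nths as (- {k}))[c := a])))"
    using c(3)[of "map lam [0..<Suc q]"] i by (simp del: upt_Suc)
  from semilinear_action[OF this, of "lam k" "as ! k"] show ?thesis
    using False by (simp add: action_term_def as c(2) del: upt_Suc)
qed

lemma sesquilinear_slot:
  assumes f: "sesquilinear q f" and rest: "Suc (length rest) = q"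
  shows "semilinear (- x) (\<lambda>e. vsubst sv_scale (x # L) (f (e # rest)))"
proof -
  have "semilinear (- lam 0) (\<lambda>e. f ((0 # rest)[0 := e]))"
    using f rest unfolding sesquilinear_def by (metis length_Cons zero_less_Suc)
  from semilinear_vsubst[OF this, of "x # L"] show ?thesis by simp
qed

lemma sesquilinear_bracket_term:
  assumes f: "sesquilinear q f" and as: "length as = Suc q" and i: "i < Suc q" and l: "l < Suc q" and k: "k < l"
  shows "semilinear (- lam i) (\<lambda>a. bracket_term f (as[i := a]) k l)"
proof -
  have card: "card (- {k, l} \<inter> {..<Suc q}) = q - 1"
    using length_nths_delete[of "{k, l}" as] as k l by (simp add: length_nths_compl)
  have len: "Suc (length (nths as (- {k, l}))) = q" using card k l by (simp add: length_nths_compl as)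
  note slot = sesquilinear_slot[OF f len]
  consider "i = k" | "i = l" | "i \<noteq> k" "i \<noteq> l" by blast
  then show ?thesis
  proof cases
    case 1
    have "nths (as[k := a]) (- {k, l}) = nths as (- {k, l})" for a
      by (rule nths_update_outside) simp
    then show ?thesis using semilinear_bracket_left[OF slot] 1 as k l by (simp add: bracket_term_def)
  next
    case 2
    have "nths (as[l := a]) (- {k, l}) = nths as (- {k, l})" for a
      by (rule nths_update_outside) simp
    then show ?thesis using semilinear_bracket_right[OF slot] 2 as k l by (simp add: bracket_term_def)
  next
    case 3
    then have iA: "i \<in> - {k, l}" by simp
    let ?L = "nths (map lam [0..<Suc q]) (- {k, l}) :: 'a poly mvpoly list"
    obtain c where c: "c < card (- {k, l} \<inter> {..<Suc q})"
      "\<And>(xs :: 'a sv list) a. length xs = Suc q \<Longrightarrow> nths (xs[i := a]) (- {k, l}) = (nths xs (- {k, l}))[c := a]"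
      "\<And>xs :: 'a poly mvpoly list. length xs = Suc q \<Longrightarrow> nths xs (- {k, l}) ! c = xs ! i"
      using nths_update_inside[OF iA i] by blast
    have "semilinear (- lam i) (\<lambda>a. vsubst sv_scale ((lam k + lam l) # ?L) (f (e # (nths as (- {k, l}))[c := a])))" for e
    proof -
      have "semilinear (- lam (Suc c)) (\<lambda>a. f ((e # nths as (- {k, l}))[Suc c := a]))"
        using f c(1) len unfolding card sesquilinear_def by (metis One_nat_def Suc_less_eq Suc_pred length_Cons diff_Suc_1)
      from semilinear_vsubst[OF this, of "(lam k + lam l) # ?L"] show ?thesis
        using c(3)[of "map lam [0..<Suc q]"] i by (simp del: upt_Suc)
    qed
    from semilinear_lin_ext[OF this] show ?thesis
      using 3 by (simp add: bracket_term_def as c(2) del: upt_Suc)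
  qed
qed

lemma sesquilinear_adjoint_d:
  assumes "sesquilinear q f"
  shows "sesquilinear (Suc q) (adjoint_d f)"
  unfolding sesquilinear_def
proof (intro allI impI)
  fix as :: "'a sv list" and i
  assume as: "length as = Suc q" and i: "i < Suc q"
  show "semilinear (- lam i) (\<lambda>a. adjoint_d f (as[i := a]))"
    unfolding adjoint_d_terms length_list_update as
    by (intro semilinear_add semilinear_sum semilinear_vmult sesquilinear_action_term[OF assms as i]
        sesquilinear_bracket_term[OF assms as i]) auto
qed

subsection \<open>The differential on coefficients\<close>

lemma mvpolys_scalar: "scalar c \<in> mvpolys q"
  unfolding scalar_def by (rule mvpolys_single_0)

lemma mvpolys_dd: "dd \<in> mvpolys q"
  unfolding dd_def by (rule mvpolys_single_0)

lemma mvpolys_diff: "u \<in> mvpolys q \<Longrightarrow> w \<in> mvpolys q \<Longrightarrow> u - w \<in> mvpolys q" for u :: "'v::ab_group_add mvpoly"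
  unfolding diff_conv_add_uminus by (intro mvpolys_add mvpolys_uminus)

lemma nth_lam_sublist:
  assumes "i < card (A \<inter> {..<n})"
  shows "nths (map lam [0..<n]) A ! i \<in> mvpolys n"
proof -
  have "i < length (nths [0..<n] A)" using assms by (simp add: length_nths_compl)
  then have "nths [0..<n] A ! i < n" using set_nths_indices[of n A] nth_mem by fastforce
  then show ?thesis using assms by (simp add: nths_lam length_nths_compl mvpolys_lam)
qed

lemma mvpolys_action_term:
  assumes f: "f (nths as (- {k})) \<in> mvpolys q" and as: "length as = Suc q" and k: "k < Suc q"
  shows "action_term f as k \<in> mvpolys (Suc q)"
proof (rule mvpolys_coord)
  fix r
  have card: "card (- {k} \<inter> {..<Suc q}) = q"
    using length_nths_delete[of "{k}" as] as k by (simp add: length_nths_compl)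
  have t: "rhom dd ((!) [lam k]) (tab g h r :: 'a poly mvpoly) \<in> mvpolys (Suc q)" for g h
    by (auto simp: tab_eq intro!: mvpolys_add mvpolys_mult mvpolys_scalar mvpolys_dd mvpolys_lam k mvpolys_0)
  have u: "rhom (dd + lam k) lam (rhom dd ((!) (nths (map lam [0..<Suc q]) (- {k}))) (coord h (f (nths as (- {k}))))) \<in> mvpolys (Suc q)" for h
  proof (rule mvpolys_rhom)
    show "rhom dd ((!) (nths (map lam [0..<Suc q]) (- {k}))) (coord h (f (nths as (- {k})))) \<in> mvpolys (Suc q)"
      by (rule mvpolys_rhom[OF coord_mvpolys[OF f]]) (use card in \<open>auto intro: nth_lam_sublist mvpolys_dd simp del: upt_Suc\<close>)
  qed (auto intro!: mvpolys_add mvpolys_dd mvpolys_lam k)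
  show "coord r (action_term f as k) \<in> mvpolys (Suc q)"
    unfolding action_term_def ext_right coord_vsubst as
    by (intro mvpolys_sum mvpolys_mult t u mvpolys_psubst mvpolys_uminus mvpolys_lam k)
qed

lemma mvpolys_bracket_term:
  assumes f: "sesquilinear q f" "\<And>bs. length bs = q \<Longrightarrow> f bs \<in> mvpolys q"
    and as: "length as = Suc q" and l: "l < Suc q" and k: "k < l"
  shows "bracket_term f as k l \<in> mvpolys (Suc q)"
proof (rule mvpolys_coord)
  fix r
  have card: "card (- {k, l} \<inter> {..<Suc q}) = q - 1"
    using length_nths_delete[of "{k, l}" as] as k l by (simp add: length_nths_compl)
  have len: "Suc (length (nths as (- {k, l}))) = q" using card k l by (simp add: length_nths_compl as)
  have kl: "k < Suc q" using k l by simp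
  let ?L = "(lam k + lam l) # nths (map lam [0..<Suc q]) (- {k, l}) :: 'a poly mvpoly list"
  have L: "?L ! i \<in> mvpolys (Suc q)" if "i < q" for i
  proof (cases i)
    case (Suc j)
    then have "j < card (- {k, l} \<inter> {..<Suc q})" using that unfolding card by linarith
    from nth_lam_sublist[OF this] show ?thesis using Suc by (simp del: upt_Suc)
  qed (auto intro!: mvpolys_add mvpolys_lam kl l)
  have c: "coord r (vsubst sv_scale ?L (f (e # nths as (- {k, l})))) \<in> mvpolys (Suc q)" for e
    unfolding coord_vsubst
    by (rule mvpolys_rhom[OF coord_mvpolys[OF f(2)]]) (use len L in \<open>auto intro: mvpolys_dd simp del: upt_Suc\<close>)
  show "coord r (bracket_term f as k l) \<in> mvpolys (Suc q)"
    unfolding bracket_term_def coord_lin_ext_bracket[OF sesquilinear_slot[OF f(1) len]] as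
    by (intro mvpolys_sum mvpolys_mult c mvpolys_psubst mvpolys_uminus mvpolys_lam kl l)
      (auto simp: bracket_poly_def intro!: mvpolys_add mvpolys_diff mvpolys_mult mvpolys_scalar mvpolys_lam kl l)
qed

lemma lookup_rename:
  fixes P :: "'f::field poly mvpoly"
  assumes P: "P \<in> mvpolys (length js)" and js: "distinct js" "set js \<inter> S = {}"
    and A: "\<And>p. polys_in S (A p)" "A 0 = 0" and M: "Poly_Mapping.keys M \<subseteq> S" and es: "length es = length js"
  shows "Poly_Mapping.lookup (\<Sum>m\<in>Poly_Mapping.keys P. A (Poly_Mapping.lookup P m) * (\<Prod>i<length js. lam (js ! i) ^ Poly_Mapping.lookup m i))
     (M + spread js es) = Poly_Mapping.lookup (A (Poly_Mapping.lookup P (monomial es))) M"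
proof -
  have iff: "(\<forall>i<length js. Poly_Mapping.lookup m i = es ! i) \<longleftrightarrow> m = monomial es" if "m \<in> Poly_Mapping.keys P" for m
  proof
    assume *: "\<forall>i<length js. Poly_Mapping.lookup m i = es ! i"
    have "Poly_Mapping.keys m \<subseteq> {..<length js}" using P that by (auto simp: mvpolys_def)
    then have "Poly_Mapping.lookup m i = 0" if "\<not> i < length js" for i using that by (auto simp: in_keys_iff)
    with * show "m = monomial es" by (intro poly_mapping_eqI) (auto simp: lookup_monomial es)
  qed (simp add: lookup_monomial es)
  have "Poly_Mapping.lookup (\<Sum>m\<in>Poly_Mapping.keys P. A (Poly_Mapping.lookup P m) * (\<Prod>i<length js. lam (js ! i) ^ Poly_Mapping.lookup m i))
     (M + spread js es) = (\<Sum>m\<in>Poly_Mapping.keys P. if m = monomial es then Poly_Mapping.lookup (A (Poly_Mapping.lookup P m)) M else 0)"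
    unfolding lookup_sum
  proof (rule sum.cong[OF refl])
    fix m assume "m \<in> Poly_Mapping.keys P"
    then show "Poly_Mapping.lookup (A (Poly_Mapping.lookup P m) * (\<Prod>i<length js. lam (js ! i) ^ Poly_Mapping.lookup m i)) (M + spread js es) =
       (if m = monomial es then Poly_Mapping.lookup (A (Poly_Mapping.lookup P m)) M else 0)"
      using A(1)[of "Poly_Mapping.lookup P m"] js M es
      by (subst lookup_shuffle[where S = S]) (auto simp: polys_in_def iff)
  qed
  also have "\<dots> = Poly_Mapping.lookup (A (Poly_Mapping.lookup P (monomial es))) M"
    by (simp add: in_keys_iff A(2))
  finally show ?thesis .
qed

text \<open>
  The variable \<open>\<lambda>\<^sub>k\<close> occurs in the factor from the action only, and the remaining variables occur in the
  values of \<open>f\<close> only, so that \<open>lookup_rename\<close> separates them and \<open>lookup_action\<close> evaluates the first.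
\<close>
lemma taylor_action_term:
  assumes f: "\<And>bs. length bs = q \<Longrightarrow> f bs \<in> mvpolys q" and xs: "length xs = Suc q" and k: "k < Suc q"
  shows "taylor xs (action_term f (generators_of xs) k) = act (xs ! k) (coeffs_of f (nths xs (- {k})))"
proof -
  define ys where "ys = nths xs (- {k})"
  define js where "js = nths [0..<Suc q] (- {k})"
  define n where "n = snd (xs ! k)"
  define g where "g = fst (xs ! k)"
  have js: "distinct js" "set js = {..<Suc q} - {k}"
    by (auto simp: js_def distinct_nths_indices set_nths_indices simp del: upt_Suc)
  have ys: "ys = map ((!) xs) js" unfolding ys_def js_def nths_indices[of xs] xs ..
  have len: "length ys = q" "length js = q" using length_nths_delete[of "{k}" xs] xs k ys by (simp_all add: ys_def)
  have gl: "length (generators_of ys) = q" by (simp add: generators_of_def len)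
  have gk: "generators_of xs ! k = axis g 1" using xs k by (simp add: generators_of_def g_def)
  have xk: "xs ! k = (g, n)" by (simp add: g_def n_def)
  define P where "P = (\<lambda>h. coord h (f (generators_of ys)))"
  have P: "P h \<in> mvpolys q" for h unfolding P_def by (intro coord_mvpolys f gl)
  have monomial: "monomial (map snd xs) = Poly_Mapping.single k n + spread js (map snd ys)"
  proof -
    have jsn: "map ((!) (map snd xs)) js = map snd ys"
      unfolding ys using js(2) xs by auto
    show ?thesis
      using monomial_split[of js "map snd xs" "{k}"] js xs k by (simp add: jsn n_def)
  qed
  have fac: "factorials xs = fact n * (factorials ys :: 'a)"
    using factorials_nths[of "{k}" xs] xs k by (simp add: ys_def n_def)
  have R: "rhom (dd + lam k) lam (rhom dd ((!) (map lam js)) (P h)) =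
     (\<Sum>m\<in>Poly_Mapping.keys (P h). psubst (Poly_Mapping.lookup (P h) m) (dd + lam k) * (\<Prod>i<q. lam (js ! i) ^ Poly_Mapping.lookup m i))" for h
  proof -
    have "rhom (dd + lam k) lam (rhom dd ((!) (map lam js)) (P h)) = rhom (dd + lam k) (\<lambda>i. lam (js ! i)) (P h)"
      unfolding rhom_rhom rhom_dd by (rule rhom_cong[OF P]) (simp add: len)
    also have "\<dots> = (\<Sum>m\<in>Poly_Mapping.keys (P h). psubst (Poly_Mapping.lookup (P h) m) (dd + lam k) * (\<Prod>i<q. lam (js ! i) ^ Poly_Mapping.lookup m i))"
      unfolding rhom_def by (rule sum.cong[OF refl], subst prod_keys_lessThan[of _ q]) (use P[of h] in \<open>auto simp: mvpolys_def\<close>)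
    finally show ?thesis .
  qed
  have "taylor xs (action_term f (generators_of xs) k) $ r = act (xs ! k) (coeffs_of f ys) $ r" for r
  proof -
    define T where "T = (\<lambda>h. if r = tgt g h then scalar (alpha g h) * dd + scalar (beta g h) * lam k + scalar (gamma g h) else (0 :: 'a poly mvpoly))"
    have T: "polys_in {k} (T h)" for h
      by (auto simp: T_def intro!: polys_in_add polys_in_mult polys_in_scalar polys_in_dd polys_in_lam polys_in_scalar[of _ 0, simplified])
    have Tt: "rhom dd ((!) [lam k]) (tab g h r) = T h" for h by (simp add: T_def tab_eq)
    have "coord r (action_term f (generators_of xs) k) = (\<Sum>h\<in>UNIV. rhom (dd + lam k) lam (rhom dd ((!) (map lam js)) (P h)) * T h)"
    proof -
      have "coord r (action_term f (generators_of xs) k) = (\<Sum>g'\<in>UNIV. psubst (axis g 1 $ g') (- lam k) *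
         (\<Sum>h\<in>UNIV. rhom (dd + lam k) lam (rhom dd ((!) (map lam js)) (P h)) * rhom dd ((!) [lam k]) (tab g' h r)))"
        unfolding action_term_def ext_right coord_vsubst gk generators_of_nths nths_lam ys_def[symmetric] P_def
        by (simp add: generators_of_def xs js_def[symmetric] sum_distrib_left mult.assoc del: upt_Suc)
      then show ?thesis unfolding sum_psubst_axis Tt .
    qed
    also have "\<dots> = (\<Sum>h\<in>UNIV. \<Sum>m\<in>Poly_Mapping.keys (P h). (psubst (Poly_Mapping.lookup (P h) m) (dd + lam k) * T h) * (\<Prod>i<length js. lam (js ! i) ^ Poly_Mapping.lookup m i))"
      unfolding R len sum_distrib_right by (simp only: mult_ac)
    finally have E: "coord r (action_term f (generators_of xs) k) = (\<Sum>h\<in>UNIV. \<Sum>m\<in>Poly_Mapping.keys (P h). (psubst (Poly_Mapping.lookup (P h) m) (dd + lam k) * T h) * (\<Prod>i<length js. lam (js ! i) ^ Poly_Mapping.lookup m i))" .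
    have "Poly_Mapping.lookup (coord r (action_term f (generators_of xs) k)) (monomial (map snd xs)) =
        (\<Sum>h\<in>UNIV. Poly_Mapping.lookup (psubst (Poly_Mapping.lookup (P h) (monomial (map snd ys))) (dd + lam k) * T h) (Poly_Mapping.single k n))"
      unfolding E monomial
    proof (subst lookup_sum, rule sum.cong[OF refl], rule lookup_rename[where S = "{k}" and A = "\<lambda>p. psubst p (dd + lam k) * T _"])
      show "polys_in {k} (psubst p (dd + lam k) * T h)" for p h
        by (intro polys_in_mult polys_in_psubst polys_in_add polys_in_dd polys_in_lam T) simp
    qed (use P js len in auto)
    moreover have "smult (fact n) (Poly_Mapping.lookup (psubst p (dd + lam k) * T h) (Poly_Mapping.single k n)) =
       (if r = tgt g h then amap g h n p else 0)" for p h
      using lookup_action[of n p k g h] by (simp add: T_def)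
    ultimately have "smult (fact n) (Poly_Mapping.lookup (coord r (action_term f (generators_of xs) k)) (monomial (map snd xs))) =
       (\<Sum>h\<in>UNIV. if r = tgt g h then amap g h n (Poly_Mapping.lookup (P h) (monomial (map snd ys))) else 0)"
      by (simp add: smult_sum_right)
    then have "smult (factorials ys) (smult (fact n) (Poly_Mapping.lookup (coord r (action_term f (generators_of xs) k)) (monomial (map snd xs)))) =
       (\<Sum>h\<in>UNIV. if r = tgt g h then amap g h n (smult (factorials ys) (Poly_Mapping.lookup (P h) (monomial (map snd ys)))) else 0)"
      by (simp add: smult_sum_right amap_smult if_distrib[of "smult _"] cong: if_cong)
    then show ?thesis
      unfolding xk by (simp add: taylor_def coeffs_of_def fac lookup_coord P_def mult.commute cong: if_cong)
  qed
  then show ?thesis by (simp add: vec_eq_iff ys_def)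
qed

text \<open>
  The variables \<open>\<lambda>\<^sub>k\<close> and \<open>\<lambda>\<^sub>l\<close> occur through the bracket and through powers of \<open>\<lambda>\<^sub>k + \<lambda>\<^sub>l\<close>, which
  \<open>lookup_bracket\<close> evaluates; in the other variables this is a renaming.
\<close>
lemma taylor_bracket_term:
  assumes f: "sesquilinear q f" "\<And>bs. length bs = q \<Longrightarrow> f bs \<in> mvpolys q"
    and xs: "length xs = Suc q" and l: "l < Suc q" and k: "k < l"
  shows "taylor xs (bracket_term f (generators_of xs) k l) =
    scl (coef (xs ! k) (xs ! l)) (coeffs_of f (lab (xs ! k) (xs ! l) # nths xs (- {k, l})))"
proof -
  define ys where "ys = nths xs (- {k, l})"
  define js where "js = nths [0..<Suc q] (- {k, l})"
  define g h m n s N where "g = fst (xs ! k)" and "h = fst (xs ! l)" and "m = snd (xs ! k)" and "n = snd (xs ! l)"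
    and "s = tgt g h" and "N = m + n - shift g h"
  have js: "distinct js" "set js = {..<Suc q} - {k, l}"
    by (auto simp: js_def distinct_nths_indices set_nths_indices simp del: upt_Suc)
  have ys: "ys = map ((!) xs) js" unfolding ys_def js_def nths_indices[of xs] xs ..
  have len: "Suc (length ys) = q" "Suc (length js) = q"
    using length_nths_delete[of "{k, l}" xs] xs k l ys by (simp_all add: ys_def)
  have kq: "k < Suc q" using k l by simp
  have gkl: "generators_of xs ! k = axis g 1" "generators_of xs ! l = axis h 1" using xs k l by (simp_all add: generators_of_def g_def h_def)
  have gl: "Suc (length (generators_of ys)) = q" by (simp add: generators_of_def len)
  have monomial: "monomial (map snd xs) = (Poly_Mapping.single k m + Poly_Mapping.single l n) + spread js (map snd ys)"
  proof -
    have jsn: "map ((!) (map snd xs)) js = map snd ys"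
      unfolding ys using js(2) xs by auto
    show ?thesis
      using monomial_split[of js "map snd xs" "{k, l}"] js xs k l by (simp add: jsn m_def n_def)
  qed
  have fac: "factorials xs = (fact m * fact n) * (factorials ys :: 'a)"
    using factorials_nths[of "{k, l}" xs] xs k l by (simp add: ys_def m_def n_def)
  define B where "B = (bracket_poly k l g h :: 'a poly mvpoly)"
  have "taylor xs (bracket_term f (generators_of xs) k l) $ r =
    scl (coef (xs ! k) (xs ! l)) (coeffs_of f ((s, N) # ys)) $ r" for r
  proof -
    define P where "P = coord r (f (axis s 1 # generators_of ys))"
    have P: "P \<in> mvpolys q" unfolding P_def by (intro coord_mvpolys f) (simp add: gl)
    let ?L = "(lam k + lam l) # map lam js :: 'a poly mvpoly list"
    let ?Q = "\<lambda>i. (lam k + lam l) ^ i :: 'a poly mvpoly"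
    have "coord r (bracket_term f (generators_of xs) k l) = B * rhom dd ((!) ?L) P"
    proof -
      have "coord r (bracket_term f (generators_of xs) k l) = (\<Sum>g'\<in>UNIV. \<Sum>h'\<in>UNIV. psubst (axis g 1 $ g') (- lam k) * psubst (axis h 1 $ h') (- lam l) *
         (bracket_poly k l g' h' * rhom dd ((!) ?L) (coord r (f (axis (tgt g' h') 1 # generators_of ys)))))"
        unfolding bracket_term_def gkl generators_of_nths nths_lam ys_def[symmetric]
        by (subst coord_lin_ext_bracket[OF sesquilinear_slot[OF f(1) gl]])
          (simp add: generators_of_def xs js_def[symmetric] del: upt_Suc)
      also have "\<dots> = (\<Sum>g'\<in>UNIV. psubst (axis g 1 $ g') (- lam k) * (\<Sum>h'\<in>UNIV. psubst (axis h 1 $ h') (- lam l) *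
         (bracket_poly k l g' h' * rhom dd ((!) ?L) (coord r (f (axis (tgt g' h') 1 # generators_of ys))))))"
        by (simp only: sum_distrib_left mult.assoc)
      finally show ?thesis unfolding sum_psubst_axis by (simp add: B_def P_def s_def)
    qed
    also have "\<dots> = (\<Sum>a\<in>Poly_Mapping.keys P. (B * ?Q (Poly_Mapping.lookup a 0) * Poly_Mapping.single 0 (Poly_Mapping.lookup P a)) *
        (\<Prod>i<length js. lam (js ! i) ^ Poly_Mapping.lookup a (Suc i)))"
    proof -
      have "(\<Prod>i\<in>Poly_Mapping.keys a. ?L ! i ^ Poly_Mapping.lookup a i) = ?Q (Poly_Mapping.lookup a 0) *
          (\<Prod>i<length js. lam (js ! i) ^ Poly_Mapping.lookup a (Suc i))" if "a \<in> Poly_Mapping.keys P" for a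
      proof -
        have "Poly_Mapping.keys a \<subseteq> {..<Suc (length js)}" using P that len by (auto simp: mvpolys_def)
        from prod_keys_lessThan[OF this, of "(!) ?L"] show ?thesis
          by (simp add: prod.lessThan_Suc_shift del: prod.lessThan_Suc)
      qed
      then show ?thesis unfolding rhom_def by (simp add: sum_distrib_left mult_ac)
    qed
    finally have e: "coord r (bracket_term f (generators_of xs) k l) = (\<Sum>a\<in>Poly_Mapping.keys P. (B * ?Q (Poly_Mapping.lookup a 0) * Poly_Mapping.single 0 (Poly_Mapping.lookup P a)) *
        (\<Prod>i<length js. lam (js ! i) ^ Poly_Mapping.lookup a (Suc i)))" .
    have s0: "Poly_Mapping.lookup (A * Poly_Mapping.single 0 p) M = Poly_Mapping.lookup A M * p" for A :: "'a poly mvpoly" and p M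
      unfolding lookup_mult_single by (simp add: in_keys_iff)
    have BQ: "polys_in {k, l} (B * ?Q i * Poly_Mapping.single 0 p)" for i p
      by (auto simp: B_def bracket_poly_def intro!: polys_in_mult polys_in_power polys_in_add polys_in_diff polys_in_scalar polys_in_lam polys_in_single_0)
    have kM: "Poly_Mapping.keys (Poly_Mapping.single k m + Poly_Mapping.single l n) \<subseteq> {k, l}"
      using Poly_Mapping.keys_add[of "Poly_Mapping.single k m" "Poly_Mapping.single l n"] by (auto split: if_splits)
    have "smult (fact m * fact n) (Poly_Mapping.lookup (coord r (bracket_term f (generators_of xs) k l)) (monomial (map snd xs))) =
      (\<Sum>a\<in>Poly_Mapping.keys P. if a = monomial (N # map snd ys) then smult (coef (g, m) (h, n) * fact N) (Poly_Mapping.lookup P a) else 0)"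
      unfolding e monomial lookup_sum smult_sum_right
    proof (rule sum.cong[OF refl])
      fix a assume a: "a \<in> Poly_Mapping.keys P"
      have keys: "Poly_Mapping.lookup a i = 0" if "\<not> i < q" for i proof -
        have "Poly_Mapping.keys a \<subseteq> {..<q}" using P a by (simp add: mvpolys_def)
        with that show ?thesis by (auto simp: in_keys_iff)
      qed
      have iff: "a = monomial (N # map snd ys) \<longleftrightarrow> Poly_Mapping.lookup a 0 = N \<and> (\<forall>i<length js. Poly_Mapping.lookup a (Suc i) = map snd ys ! i)"
      proof
        assume *: "Poly_Mapping.lookup a 0 = N \<and> (\<forall>i<length js. Poly_Mapping.lookup a (Suc i) = map snd ys ! i)"
        show "a = monomial (N # map snd ys)"
        proof (rule poly_mapping_eqI)
          fix i show "Poly_Mapping.lookup a i = Poly_Mapping.lookup (monomial (N # map snd ys)) i"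
            using * keys[of i] len by (cases i) (auto simp: lookup_monomial)
        qed
      qed (use len in \<open>auto simp: lookup_monomial\<close>)
      have "smult (fact m * fact n) (Poly_Mapping.lookup (B * ?Q (Poly_Mapping.lookup a 0)) (Poly_Mapping.single k m + Poly_Mapping.single l n)) =
         (if Poly_Mapping.lookup a 0 = N then [:coef (g, m) (h, n) * fact N:] else 0)"
      proof -
        have "smult (fact m * fact n) (Poly_Mapping.lookup (B * ?Q (Poly_Mapping.lookup a 0)) (Poly_Mapping.single k m + Poly_Mapping.single l n)) =
          (if Poly_Mapping.lookup a 0 = N then [:coef (g, m) (h, n) * fact (Poly_Mapping.lookup a 0):] else 0)"
          unfolding B_def bracket_poly_def N_def by (rule lookup_bracket) (use k in simp)
        also have "\<dots> = (if Poly_Mapping.lookup a 0 = N then [:coef (g, m) (h, n) * fact N:] else 0)"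
          by (rule if_cong) (simp_all only:)
        finally show ?thesis .
      qed
      then have v: "smult (fact m * fact n) (Poly_Mapping.lookup (B * ?Q (Poly_Mapping.lookup a 0) * Poly_Mapping.single 0 (Poly_Mapping.lookup P a))
           (Poly_Mapping.single k m + Poly_Mapping.single l n)) =
         (if Poly_Mapping.lookup a 0 = N then smult (coef (g, m) (h, n) * fact N) (Poly_Mapping.lookup P a) else 0)"
        unfolding s0 mult_smult_left[symmetric] by simp
      have sh: "Poly_Mapping.lookup ((B * ?Q (Poly_Mapping.lookup a 0) * Poly_Mapping.single 0 (Poly_Mapping.lookup P a)) *
          (\<Prod>i<length js. lam (js ! i) ^ Poly_Mapping.lookup a (Suc i))) (Poly_Mapping.single k m + Poly_Mapping.single l n + spread js (map snd ys)) =
          (if \<forall>i<length js. Poly_Mapping.lookup a (Suc i) = map snd ys ! i then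
             Poly_Mapping.lookup (B * ?Q (Poly_Mapping.lookup a 0) * Poly_Mapping.single 0 (Poly_Mapping.lookup P a)) (Poly_Mapping.single k m + Poly_Mapping.single l n) else 0)"
        by (rule lookup_shuffle[where S = "{k, l}"]) (use BQ[unfolded polys_in_def] js kM len in auto)
      show "smult (fact m * fact n) (Poly_Mapping.lookup ((B * ?Q (Poly_Mapping.lookup a 0) * Poly_Mapping.single 0 (Poly_Mapping.lookup P a)) *
          (\<Prod>i<length js. lam (js ! i) ^ Poly_Mapping.lookup a (Suc i))) (Poly_Mapping.single k m + Poly_Mapping.single l n + spread js (map snd ys))) =
          (if a = monomial (N # map snd ys) then smult (coef (g, m) (h, n) * fact N) (Poly_Mapping.lookup P a) else 0)"
        (is "smult _ ?X = (if _ then ?Y else 0)")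
        unfolding iff
      proof (cases "\<forall>i<length js. Poly_Mapping.lookup a (Suc i) = map snd ys ! i")
        case True
        then show "smult (fact m * fact n) ?X = (if Poly_Mapping.lookup a 0 = N \<and> (\<forall>i<length js. Poly_Mapping.lookup a (Suc i) = map snd ys ! i) then ?Y else 0)"
          unfolding trans[OF sh if_P[OF True]] v by (intro if_cong) auto
      next
        case False
        then show "smult (fact m * fact n) ?X = (if Poly_Mapping.lookup a 0 = N \<and> (\<forall>i<length js. Poly_Mapping.lookup a (Suc i) = map snd ys ! i) then ?Y else 0)"
          unfolding trans[OF sh if_not_P[OF False]] by (subst if_not_P) auto
      qed
    qed
    also have "\<dots> = smult (coef (g, m) (h, n) * fact N) (Poly_Mapping.lookup P (monomial (N # map snd ys)))"
      by (simp add: in_keys_iff del: coef.simps)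
    finally have main: "smult (fact m * fact n) (Poly_Mapping.lookup (coord r (bracket_term f (generators_of xs) k l)) (monomial (map snd xs))) =
       smult (coef (g, m) (h, n) * fact N) (Poly_Mapping.lookup P (monomial (N # map snd ys)))" .
    have "taylor xs (bracket_term f (generators_of xs) k l) $ r = smult (factorials ys)
        (smult (fact m * fact n) (Poly_Mapping.lookup (coord r (bracket_term f (generators_of xs) k l)) (monomial (map snd xs))))"
      by (simp add: taylor_def fac lookup_coord mult_ac)
    also have "\<dots> = scl (coef (g, m) (h, n)) (coeffs_of f ((s, N) # ys)) $ r"
      unfolding main by (simp add: coeffs_of_def taylor_def generators_of_def factorials_def P_def lookup_coord mult_ac del: coef.simps)
    finally show ?thesis by (simp add: g_def h_def m_def n_def del: coef.simps)
  qed
  moreover have "lab (xs ! k) (xs ! l) = (s, N)"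
    by (cases "xs ! k"; cases "xs ! l") (simp add: s_def N_def g_def h_def m_def n_def)
  ultimately show ?thesis by (simp only: vec_eq_iff ys_def) simp
qed

lemma coeffs_of_adjoint_d:
  assumes f: "sesquilinear q f" "\<And>bs. length bs = q \<Longrightarrow> f bs \<in> mvpolys q" and xs: "length xs = Suc q"
  shows "coeffs_of (adjoint_d f) xs = sv.ce (coeffs_of f) xs"
proof -
  have len: "length (generators_of xs) = Suc q" by (simp add: generators_of_def xs)
  have "taylor xs (action_term f (generators_of xs) k) = act (xs ! k) (coeffs_of f (nths xs (- {k})))" if "k < Suc q" for k
    by (rule taylor_action_term) (use f xs that in auto)
  moreover have "taylor xs (bracket_term f (generators_of xs) k l) =
    scl (coef (xs ! k) (xs ! l)) (coeffs_of f (lab (xs ! k) (xs ! l) # nths xs (- {k, l})))" if "l < Suc q" "k < l" for k l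
    by (rule taylor_bracket_term) (use f xs that in auto)
  ultimately show ?thesis
    unfolding coeffs_of_def[of "adjoint_d f"] adjoint_d_terms sv.ce_def len xs taylor_add taylor_sum taylor_sign
    by (simp cong: sum.cong_simp)
qed

section \<open>Cochains and their coefficients\<close>

lemma sesquilinear_cochain:
  fixes f :: "'f::field_char_0 sv list \<Rightarrow> 'f sv mvpoly"
  assumes "f \<in> cochains sv_scale sv_scale q"
  shows "sesquilinear q f"
  unfolding sesquilinear_def semilinear_def
proof (intro allI impI conjI)
  fix as :: "'f sv list" and i
  assume as: "length as = q" and i: "i < q"
  have C: "f (bs[i := a + b]) = f (bs[i := a]) + f (bs[i := b])"
    "f (bs[i := sv_scale [:c:] (bs ! i)]) = vmult sv_scale (scalar c) (f bs)"
    "f (bs[i := sv_scale [:0, 1:] (bs ! i)]) = vmult sv_scale (- lam i) (f bs)" if "length bs = q" for bs a b c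
    using assms i that unfolding cochains_def by blast+
  note add = C(1)[OF as]
  have sc: "f (as[i := sv_scale [:c:] a]) = vmult sv_scale (scalar c) (f (as[i := a]))" for a c
    using C(2)[of "as[i := a]"] as i by simp
  have pa: "f (as[i := sv_scale [:0, 1:] a]) = vmult sv_scale (- lam i) (f (as[i := a]))" for a
    using C(3)[of "as[i := a]"] as i by simp
  show "f (as[i := a + b]) = f (as[i := a]) + f (as[i := b])" for a b by (rule add)
  show "f (as[i := sv_scale p a]) = vmult sv_scale (psubst p (- lam i)) (f (as[i := a]))" for p a
  proof (induction p)
    case 0
    have "f (as[i := 0]) = 0" using add[of 0 0] by simp
    then show ?case by (intro coord_eqI) simp
  next
    case (pCons c p)
    have "sv_scale (pCons c p) a = sv_scale [:c:] a + sv_scale [:0, 1:] (sv_scale p a)"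
      by (simp add: vec_eq_iff)
    then have "f (as[i := sv_scale (pCons c p) a]) =
        vmult sv_scale (scalar c) (f (as[i := a])) + vmult sv_scale (- lam i) (f (as[i := sv_scale p a]))"
      by (simp only: add sc pa)
    then show ?case unfolding pCons.IH by (intro coord_eqI) (simp add: algebra_simps)
  qed
qed

text \<open>
  The arguments are replaced by generators one position after the other.
\<close>
lemma sesquilinear_ext:
  fixes f f' :: "'f::field_char_0 sv list \<Rightarrow> 'f sv mvpoly"
  assumes f: "sesquilinear q f" "sesquilinear q f'"
    and gs: "\<And>gs :: sv_gen list. length gs = q \<Longrightarrow> f (map (\<lambda>g. axis g 1) gs) = f' (map (\<lambda>g. axis g 1) gs)"
    and as: "length as = q"
  shows "f as = f' as"
proof -
  have "\<forall>as. length as = q \<longrightarrow> (\<forall>i. j \<le> i \<and> i < q \<longrightarrow> (\<exists>g. as ! i = axis g 1)) \<longrightarrow> f as = f' as" if "j \<le> q" for j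
    using that
  proof (induction j)
    case 0
    show ?case
    proof (intro allI impI)
      fix as :: "'f sv list"
      assume l: "length as = q" and "\<forall>i. 0 \<le> i \<and> i < q \<longrightarrow> (\<exists>g. as ! i = axis g 1)"
      then obtain h where h: "\<And>i. i < q \<Longrightarrow> as ! i = axis (h i) 1" by (metis le0)
      have "as = map (\<lambda>g. axis g 1) (map h [0..<q])"
        by (rule nth_equalityI) (simp_all add: l h)
      then show "f as = f' as" using gs[of "map h [0..<q]"] by simp
    qed
  next
    case (Suc j)
    show ?case
    proof (intro allI impI)
      fix as :: "'f sv list"
      assume l: "length as = q" and ax: "\<forall>i. Suc j \<le> i \<and> i < q \<longrightarrow> (\<exists>g. as ! i = axis g 1)"
      have j: "j < q" using Suc.prems by simp
      have eq: "f (as[j := axis g 1]) = f' (as[j := axis g 1])" for g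
      proof -
        have "\<exists>g'. as[j := axis g 1] ! i = axis g' 1" if "j \<le> i" "i < q" for i
          using ax that l by (cases "i = j") auto
        then show ?thesis using Suc.IH l j by simp
      qed
      have "coord k (f (as[j := as ! j])) = coord k (f' (as[j := as ! j]))" for k
        using f l j semilinear_coord[of "- lam j" "\<lambda>a. f (as[j := a])" k "as ! j"]
          semilinear_coord[of "- lam j" "\<lambda>a. f' (as[j := a])" k "as ! j"]
        by (simp add: sesquilinear_def eq del: list_update_id)
      then show "f as = f' as" by (intro coord_eqI) simp
    qed
  qed
  moreover have "\<forall>i. q \<le> i \<and> i < q \<longrightarrow> (\<exists>g. as ! i = axis g 1)" by auto
  ultimately show ?thesis using as by blast
qed

lemma taylor_eqI:
  fixes u w :: "'f::field_char_0 sv mvpoly"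
  assumes "u \<in> mvpolys q" "w \<in> mvpolys q" "length gs = q"
    and "\<And>xs. map fst xs = gs \<Longrightarrow> taylor xs u = taylor xs w"
  shows "u = w"
proof (rule mvpoly_eqI[OF assms(1,2)])
  fix ns :: "nat list" assume "length ns = q"
  then have "taylor (zip gs ns) u = taylor (zip gs ns) w" "map snd (zip gs ns) = ns"
    using assms(3,4) by simp_all
  then show "Poly_Mapping.lookup u (monomial ns) = Poly_Mapping.lookup w (monomial ns)"
    by (simp add: taylor_def factorials_nonzero)
qed

lemma coeffs_of_ext:
  fixes f f' :: "'f::field_char_0 sv list \<Rightarrow> 'f sv mvpoly"
  assumes f: "sesquilinear q f" "sesquilinear q f'"
    and p: "\<And>bs. length bs = q \<Longrightarrow> f bs \<in> mvpolys q" "\<And>bs. length bs = q \<Longrightarrow> f' bs \<in> mvpolys q"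
    and eq: "\<And>xs. length xs = q \<Longrightarrow> coeffs_of f xs = coeffs_of f' xs" and as: "length as = q"
  shows "f as = f' as"
proof (rule sesquilinear_ext[OF f _ as])
  fix gs :: "sv_gen list" assume gs: "length gs = q"
  show "f (map (\<lambda>g. axis g 1) gs) = f' (map (\<lambda>g. axis g 1) gs)"
  proof (rule taylor_eqI[OF _ _ gs])
    fix xs :: "label list" assume xs: "map fst xs = gs"
    then have "generators_of xs = map (\<lambda>g. axis g (1 :: 'f poly)) gs" by (auto simp: generators_of_def)
    moreover have "length xs = q" using xs gs by auto
    ultimately show "taylor xs (f (map (\<lambda>g. axis g 1) gs)) = taylor xs (f' (map (\<lambda>g. axis g 1) gs))"
      using eq[of xs] by (simp add: coeffs_of_def)
  qed (simp_all add: p gs)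
qed

subsection \<open>Permutations\<close>

lemma lookup_permuted:
  fixes P :: "'f::field poly mvpoly"
  assumes P: "P \<in> mvpolys q" and \<sigma>: "\<sigma> permutes {..<q}" and ns: "length ns = q"
  shows "Poly_Mapping.lookup (rhom dd ((!) (map lam (permute_list \<sigma> [0..<q]))) P) (monomial ns) =
    Poly_Mapping.lookup P (monomial (permute_list \<sigma> ns))"
proof -
  define js where "js = permute_list \<sigma> [0..<q]"
  have nth: "js ! i = \<sigma> i" if "i < q" for i
    using permute_list_nth[of \<sigma> "[0..<q]" i] \<sigma> that permutes_in_image[OF \<sigma>, of i] by (simp add: js_def)
  have js: "distinct js" "set js = {..<q}" "length js = q"
    using \<sigma> by (auto simp: js_def)
  have e: "map ((!) ns) js = permute_list \<sigma> ns"
    by (rule nth_equalityI) (use \<sigma> ns js nth in \<open>auto simp: permute_list_nth\<close>)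
  have "rhom dd ((!) (map lam js)) P = (\<Sum>m\<in>Poly_Mapping.keys P. Poly_Mapping.single 0 (Poly_Mapping.lookup P m) * (\<Prod>i<length js. lam (js ! i) ^ Poly_Mapping.lookup m i))"
    unfolding rhom_def psubst_dd
  proof (rule sum.cong[OF refl])
    fix m assume "m \<in> Poly_Mapping.keys P"
    then have "Poly_Mapping.keys m \<subseteq> {..<length js}" using P js by (simp add: mvpolys_def)
    from prod_keys_lessThan[OF this, of "(!) (map lam js) :: nat \<Rightarrow> 'f poly mvpoly"]
    show "Poly_Mapping.single 0 (Poly_Mapping.lookup P m) * (\<Prod>i\<in>Poly_Mapping.keys m. map lam js ! i ^ Poly_Mapping.lookup m i) =
      Poly_Mapping.single 0 (Poly_Mapping.lookup P m) * (\<Prod>i<length js. lam (js ! i) ^ Poly_Mapping.lookup m i)" by simp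
  qed
  moreover have "monomial ns = 0 + spread js (map ((!) ns) js)"
    using monomial_split[of js ns "{}"] js ns by simp
  ultimately have "Poly_Mapping.lookup (rhom dd ((!) (map lam js)) P) (monomial ns) =
     Poly_Mapping.lookup (\<Sum>m\<in>Poly_Mapping.keys P. Poly_Mapping.single 0 (Poly_Mapping.lookup P m) * (\<Prod>i<length js. lam (js ! i) ^ Poly_Mapping.lookup m i))
       (0 + spread js (map ((!) ns) js))" by (simp only:)
  also have "\<dots> = Poly_Mapping.lookup (Poly_Mapping.single 0 (Poly_Mapping.lookup P (monomial (map ((!) ns) js)))) (0 :: nat \<Rightarrow>\<^sub>0 nat)"
    by (rule lookup_rename[where S = "{}" and A = "Poly_Mapping.single 0"]) (use P js in \<open>auto simp: polys_in_single_0\<close>)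
  finally show ?thesis unfolding e unfolding js_def by simp
qed

lemma taylor_permuted:
  fixes f :: "'f::field_char_0 sv list \<Rightarrow> 'f sv mvpoly"
  assumes f: "\<And>bs. length bs = q \<Longrightarrow> f bs \<in> mvpolys q" and \<sigma>: "\<sigma> permutes {..<q}" and xs: "length xs = q"
  shows "taylor xs (vsubst sv_scale (map lam (permute_list \<sigma> [0..<q])) (f (permute_list \<sigma> (generators_of xs)))) =
    coeffs_of f (permute_list \<sigma> xs)"
proof -
  have s: "\<sigma> permutes {..<length xs}" using \<sigma> xs by simp
  have g: "generators_of (permute_list \<sigma> xs) = permute_list \<sigma> (generators_of xs :: 'f sv list)"
    unfolding generators_of_def by (rule permute_list_map[OF s, symmetric])
  have m: "map snd (permute_list \<sigma> xs) = permute_list \<sigma> (map snd xs)"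
    by (rule permute_list_map[OF s, symmetric])
  have fac: "factorials (permute_list \<sigma> xs) = (factorials xs :: 'f)"
    unfolding factorials_def prod_mset_prod_list[symmetric] mset_map mset_permute_list[OF s] ..
  have "Poly_Mapping.lookup (vsubst sv_scale (map lam (permute_list \<sigma> [0..<q])) (f (permute_list \<sigma> (generators_of xs)))) (monomial (map snd xs)) $ r =
     Poly_Mapping.lookup (f (permute_list \<sigma> (generators_of xs))) (monomial (permute_list \<sigma> (map snd xs))) $ r" for r
    unfolding lookup_coord[symmetric] coord_vsubst
    by (rule lookup_permuted[OF coord_mvpolys[OF f] \<sigma>]) (simp_all add: xs generators_of_def)
  then have "Poly_Mapping.lookup (vsubst sv_scale (map lam (permute_list \<sigma> [0..<q])) (f (permute_list \<sigma> (generators_of xs)))) (monomial (map snd xs)) =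
     Poly_Mapping.lookup (f (permute_list \<sigma> (generators_of xs))) (monomial (permute_list \<sigma> (map snd xs)))"
    unfolding vec_eq_iff by blast
  then show ?thesis unfolding taylor_def coeffs_of_def g m fac by simp
qed

text \<open>
  Apply skew-symmetry to a transposition of neighbours.
\<close>
lemma alt_coeffs_of:
  fixes f :: "'f::field_char_0 sv list \<Rightarrow> 'f sv mvpoly"
  assumes f: "f \<in> cochains sv_scale sv_scale q"
  shows "sv.alt (coeffs_of f)"
  unfolding sv.alt_def
proof (intro allI)
  fix us :: "label list" and x y vs
  let ?xs = "us @ x # y # vs" and ?ys = "us @ y # x # vs"
  show "coeffs_of f ?xs = - coeffs_of f ?ys"
  proof (cases "length ?xs = q")
    case False
    then have "f (generators_of ?xs) = 0" "f (generators_of ?ys) = 0" using f by (auto simp: cochains_def generators_of_def)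
    then show ?thesis by (simp add: coeffs_of_def taylor_zero)
  next
    case True
    define n where "n = length us"
    define \<sigma> where "\<sigma> = Transposition.transpose n (Suc n)"
    have n: "n < q" "Suc n < q" using True by (simp_all add: n_def)
    have \<sigma>: "\<sigma> permutes {..<q}" unfolding \<sigma>_def using n by (intro permutes_swap_id) auto
    have sign: "sign \<sigma> = - 1" by (simp add: \<sigma>_def sign_swap_id)
    have p: "permute_list \<sigma> ?ys = ?xs"
    proof (rule nth_equalityI)
      fix i assume "i < length (permute_list \<sigma> ?ys)"
      then have i: "i < length ?ys" by simp
      have "permute_list \<sigma> ?ys ! i = ?ys ! \<sigma> i"
        using \<sigma> True i by (intro permute_list_nth) auto
      then show "permute_list \<sigma> ?ys ! i = ?xs ! i"
        by (auto simp: \<sigma>_def Transposition.transpose_def nth_append n_def nth_Cons' split: if_splits)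
    qed simp
    have fp: "f bs \<in> mvpolys q" if "length bs = q" for bs using f that by (auto simp: cochains_def)
    have lg: "length (generators_of ?ys :: 'f sv list) = q" using True by (simp add: generators_of_def)
    have ly: "length ?ys = q" using True by simp
    have "coeffs_of f ?xs = taylor ?ys (vsubst sv_scale (map lam (permute_list \<sigma> [0..<q])) (f (permute_list \<sigma> (generators_of ?ys))))"
      using taylor_permuted[where f = f, OF fp \<sigma> ly] unfolding p by simp
    also have "vsubst sv_scale (map lam (permute_list \<sigma> [0..<q])) (f (permute_list \<sigma> (generators_of ?ys))) = vmult sv_scale (of_int (sign \<sigma>)) (f (generators_of ?ys))"
      using f lg \<sigma> unfolding cochains_def by blast
    also have "\<dots> = vmult sv_scale ((- 1) ^ 1) (f (generators_of ?ys))" by (simp add: sign)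
    also have "taylor ?ys \<dots> = - coeffs_of f ?ys" unfolding taylor_sign by (simp add: coeffs_of_def)
    finally show ?thesis .
  qed
qed

text \<open>
  Both sides of the skew-symmetry condition are sesquilinear in the arguments, so it suffices to compare
  their coefficients at generators.
\<close>
lemma cochainI:
  fixes f :: "'f::field_char_0 sv list \<Rightarrow> 'f sv mvpoly"
  assumes sesq: "sesquilinear q f" and poly: "\<And>bs. length bs = q \<Longrightarrow> f bs \<in> mvpolys q"
    and hom: "\<And>bs. length bs \<noteq> q \<Longrightarrow> f bs = 0" and alt: "sv.alt (coeffs_of f)"
  shows "f \<in> cochains sv_scale sv_scale q"
proof -
  have skew: "vsubst sv_scale (map lam (permute_list \<sigma> [0..<q])) (f (permute_list \<sigma> as)) = vmult sv_scale (of_int (sign \<sigma>)) (f as)"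
    if as: "length as = q" and \<sigma>: "\<sigma> permutes {..<q}" for \<sigma> as
  proof -
    let ?L = "map lam (permute_list \<sigma> [0..<q]) :: 'f poly mvpoly list"
    have L: "?L ! c = lam (\<sigma> c)" if "c < q" for c
      using permute_list_nth[of \<sigma> "[0..<q]" c] \<sigma> that permutes_in_image[OF \<sigma>, of c] by simp
    let ?u = "\<lambda>as. vsubst sv_scale ?L (f (permute_list \<sigma> as))" and ?w = "\<lambda>as. vmult sv_scale (of_int (sign \<sigma>)) (f as)"
    have si: "of_int (sign \<sigma>) = scalar (of_int (sign \<sigma>) :: 'f)"
    proof -
      have "scalar (- 1 :: 'f) = - 1" using minus_one_power[of 1, where 'f = 'f, symmetric] by simp
      then show ?thesis by (simp add: sign_def)
    qed
    have "?u as = ?w as"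
    proof (rule coeffs_of_ext[where f = ?u and f' = ?w])
      show "sesquilinear q ?u"
        unfolding sesquilinear_def
      proof (intro allI impI)
        fix as :: "'f sv list" and i assume l: "length as = q" and i: "i < q"
        define c where "c = inv_into UNIV \<sigma> i"
        have c: "c < q" "\<sigma> c = i" using i permutes_in_image[OF permutes_inv[OF \<sigma>], of i] permutes_inverses(1)[OF \<sigma>] by (auto simp: c_def)
        have s: "\<sigma> permutes {..<length as}" "\<sigma> permutes {..<length (as[i := a])}" for a using \<sigma> l by simp_all
        have up: "permute_list \<sigma> (as[i := a]) = (permute_list \<sigma> as)[c := a]" for a
        proof (rule nth_equalityI)
          fix j assume "j < length (permute_list \<sigma> (as[i := a]))"
          then have j: "j < q" using l by simp
          have inj: "\<sigma> j = i \<longleftrightarrow> j = c" using c permutes_inj[OF \<sigma>] by (auto dest: injD)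
          show "permute_list \<sigma> (as[i := a]) ! j = (permute_list \<sigma> as)[c := a] ! j"
            using j l c(1) permutes_in_image[OF \<sigma>, of j] inj
            by (auto simp: permute_list_nth[OF s(2)] permute_list_nth[OF s(1)] nth_list_update)
        qed simp
        have "semilinear (- lam c) (\<lambda>a. f ((permute_list \<sigma> as)[c := a]))"
          using sesq l c by (simp add: sesquilinear_def)
        from semilinear_vsubst[OF this, of ?L] show "semilinear (- lam i) (\<lambda>a. ?u (as[i := a]))"
          using L[OF c(1)] c by (simp add: up)
      qed
      show "sesquilinear q ?w"
        unfolding sesquilinear_def
      proof (intro allI impI, rule semilinear_vmult)
        show "semilinear (- lam i) (\<lambda>a. f (as[i := a]))" if "length as = q" "i < q" for as i
          using sesq that by (simp add: sesquilinear_def)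
      qed
      show "?u bs \<in> mvpolys q" if "length bs = q" for bs
      proof (rule mvpolys_coord)
        fix r
        have "coord r (f (permute_list \<sigma> bs)) \<in> mvpolys q" by (intro coord_mvpolys poly) (simp add: that)
        then show "coord r (?u bs) \<in> mvpolys q"
          unfolding coord_vsubst by (rule mvpolys_rhom) (use L permutes_in_image[OF \<sigma>] in \<open>auto intro: mvpolys_lam mvpolys_dd\<close>)
      qed
      show "?w bs \<in> mvpolys q" if "length bs = q" for bs
        by (rule mvpolys_coord) (use poly[OF that] in \<open>auto simp: si intro!: mvpolys_mult mvpolys_scalar coord_mvpolys\<close>)
      show "coeffs_of ?u xs = coeffs_of ?w xs" if xs: "length xs = q" for xs
      proof -
        have "coeffs_of ?u xs = coeffs_of f (permute_list \<sigma> xs)"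
          using taylor_permuted[where f = f, OF poly \<sigma> xs] by (simp add: coeffs_of_def)
        also have "\<dots> = scl (of_int (sign \<sigma>)) (coeffs_of f xs)"
          by (rule sv.alt_permute[OF alt]) (simp add: \<sigma> xs)
        also have "\<dots> = coeffs_of ?w xs" by (simp add: coeffs_of_def si taylor_scalar)
        finally show ?thesis .
      qed
    qed (rule as)
    then show ?thesis .
  qed
  have up: "f (as[i := a + b]) = f (as[i := a]) + f (as[i := b])"
    "f (as[i := sv_scale p a]) = vmult sv_scale (psubst p (- lam i)) (f (as[i := a]))" if "length as = q" "i < q" for as i a b p
  proof -
    have "semilinear (- lam i) (\<lambda>a. f (as[i := a]))" using sesq that by (simp add: sesquilinear_def)
    then show "f (as[i := a + b]) = f (as[i := a]) + f (as[i := b])"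
      "f (as[i := sv_scale p a]) = vmult sv_scale (psubst p (- lam i)) (f (as[i := a]))"
      unfolding semilinear_def by simp_all
  qed
  have "f (as[i := sv_scale [:c:] (as ! i)]) = vmult sv_scale (scalar c) (f as)"
    "f (as[i := sv_scale [:0, 1:] (as ! i)]) = vmult sv_scale (- lam i) (f as)" if "length as = q" "i < q" for as i c
    using up(2)[OF that, of "[:c:]" "as ! i"] up(2)[OF that, of "[:0, 1:]" "as ! i"] by simp_all
  then show ?thesis
    unfolding cochains_def by (intro CollectI conjI allI impI) (simp_all add: hom poly up(1) skew)
qed

abbreviation sv_cochains :: "nat \<Rightarrow> ('f::field_char_0 sv list \<Rightarrow> 'f sv mvpoly) set" where
  "sv_cochains \<equiv> cochains sv_scale sv_scale"

lemma cochain_length: "f \<in> cochains scA scV q \<Longrightarrow> length as \<noteq> q \<Longrightarrow> f as = 0"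
  by (simp add: cochains_def)

lemma cochain_poly: "f \<in> cochains scA scV q \<Longrightarrow> length as = q \<Longrightarrow> f as \<in> mvpolys q"
  by (simp add: cochains_def)

lemma coeffs_of_length: "f \<in> sv_cochains q \<Longrightarrow> length xs \<noteq> q \<Longrightarrow> coeffs_of f xs = 0"
  by (simp add: coeffs_of_def cochain_length generators_of_def taylor_zero)

lemma cochain_eqI:
  assumes "f \<in> sv_cochains q" "f' \<in> sv_cochains q" "\<And>xs. coeffs_of f xs = coeffs_of f' xs"
  shows "f = f'"
proof
  fix as
  show "f as = f' as"
  proof (cases "length as = q")
    case True
    show ?thesis
      by (rule coeffs_of_ext[OF sesquilinear_cochain[OF assms(1)] sesquilinear_cochain[OF assms(2)]])
        (use assms True in \<open>auto intro: cochain_poly\<close>)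
  qed (use assms in \<open>simp add: cochain_length\<close>)
qed

text \<open>
  There are finitely many lists of \<open>q\<close> generators, and at each of them the value is a polynomial.
\<close>
lemma bounded_coeffs_of:
  fixes f :: "'f::field_char_0 sv list \<Rightarrow> 'f sv mvpoly"
  assumes f: "f \<in> sv_cochains q"
  shows "bounded_support (coeffs_of f)"
proof -
  define B where "B = (\<Union>gs\<in>{gs. set gs \<subseteq> (UNIV :: sv_gen set) \<and> length gs = q}.
     \<Union>m\<in>Poly_Mapping.keys (f (map (\<lambda>g. axis g 1) gs)). Poly_Mapping.lookup m ` Poly_Mapping.keys m)"
  have "finite B" unfolding B_def by (intro finite_UN_I finite_lists_length_eq) auto
  then obtain N where N: "\<And>b. b \<in> B \<Longrightarrow> b < N" using finite_nat_set_iff_bounded by auto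
  \<comment> \<open>The bound is \<open>Suc N\<close>, since the exponent \<open>0\<close> does not show up in \<open>B\<close>.\<close>
  have "coeffs_of f xs = 0" if x: "x \<in> set xs" "Suc N \<le> snd x" for xs x
  proof (rule ccontr)
    assume nz: "coeffs_of f xs \<noteq> 0"
    then have l: "length xs = q" using coeffs_of_length[OF f] by blast
    have gs: "generators_of xs = map (\<lambda>g. axis g (1 :: 'f poly)) (map fst xs)" by (simp add: generators_of_def)
    have m: "monomial (map snd xs) \<in> Poly_Mapping.keys (f (generators_of xs))"
      using nz by (auto simp: coeffs_of_def taylor_def in_keys_iff)
    obtain i where i: "i < length xs" "x = xs ! i" using x by (auto simp: in_set_conv_nth)
    have lk: "Poly_Mapping.lookup (monomial (map snd xs)) i = snd x" using i by (simp add: lookup_monomial)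
    then have "i \<in> Poly_Mapping.keys (monomial (map snd xs))" using x(2) by (simp add: in_keys_iff)
    then have "snd x \<in> Poly_Mapping.lookup (monomial (map snd xs)) ` Poly_Mapping.keys (monomial (map snd xs))"
      using lk by (metis imageI)
    then have "snd x \<in> B" unfolding B_def using m l unfolding gs by (intro UN_I[of "map fst xs"] UN_I[of "monomial (map snd xs)"]) auto
    then show False using N[of "snd x"] x by simp
  qed
  then show ?thesis unfolding bounded_support_def by blast
qed

lemma monomial_inj: "length ns = length ns' \<Longrightarrow> monomial ns = monomial ns' \<longleftrightarrow> ns = ns'"
proof
  assume "length ns = length ns'" "monomial ns = monomial ns'"
  then show "ns = ns'" by (intro nth_equalityI) (metis lookup_monomial)+
qed simp

text \<open>
  The cochain is the generating function
  \<open>\<Sum> \<Prod>\<^sub>i p\<^sub>i(- \<lambda>\<^sub>i) \<lambda>\<^sub>i\<^bsup>n\<^sub>i\<^esup>/n\<^sub>i! \<cdot> G((g\<^sub>0, n\<^sub>0), (g\<^sub>1, n\<^sub>1), \<dots>)\<close>, where \<open>p\<^sub>i\<close> is the component of the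
  \<open>i\<close>-th argument along \<open>g\<^sub>i\<close>; the sum is finite because \<open>G\<close> has bounded support.
\<close>
lemma realize_coefficients:
  fixes G :: "label list \<Rightarrow> 'f::field_char_0 sv"
  assumes alt: "sv.alt G" and bd: "bounded_support G" and len: "\<And>xs. length xs \<noteq> q \<Longrightarrow> G xs = 0"
  obtains g where "g \<in> sv_cochains q" "\<And>xs. coeffs_of g xs = G xs"
proof -
  obtain N where N: "\<And>xs x. x \<in> set xs \<Longrightarrow> N \<le> snd x \<Longrightarrow> G xs = 0"
    using bd unfolding bounded_support_def by blast
  define X where "X = {xs :: label list. set xs \<subseteq> UNIV \<times> {..<N} \<and> length xs = q}"
  have fin: "finite X" unfolding X_def by (intro finite_lists_length_eq) (simp add: finite_cartesian_product)
  define W where "W = (\<lambda>as xs. \<Prod>i<q. psubst ((as ! i :: 'f sv) $ fst (xs ! i)) (- lam i) * lam i ^ snd (xs ! i :: label))"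
  define V where "V = (\<lambda>xs. scl (inverse (factorials xs)) (G xs))"
  define g where "g = (\<lambda>as. if length as = q then \<Sum>xs\<in>X. vmult sv_scale (W as xs) (Poly_Mapping.single 0 (V xs)) else 0)"
  have sesq: "sesquilinear q g"
    unfolding sesquilinear_def
  proof (intro allI impI)
    fix as :: "'f sv list" and i assume l: "length as = q" and i: "i < q"
    have "semilinear (- lam i) (\<lambda>a. vmult sv_scale (W (as[i := a]) xs) (Poly_Mapping.single 0 (V xs)))" for xs
    proof -
      define R where "R = lam i ^ snd (xs ! i) * (\<Prod>j\<in>{..<q} - {i}. psubst (as ! j $ fst (xs ! j)) (- lam j) * lam j ^ snd (xs ! j))"
      have W: "W (as[i := a]) xs = psubst (a $ fst (xs ! i)) (- lam i) * R" for a
      proof -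
        have "W (as[i := a]) xs = (psubst (as[i := a] ! i $ fst (xs ! i)) (- lam i) * lam i ^ snd (xs ! i)) *
           (\<Prod>j\<in>{..<q} - {i}. psubst (as[i := a] ! j $ fst (xs ! j)) (- lam j) * lam j ^ snd (xs ! j))"
          unfolding W_def by (rule prod.remove) (use i in auto)
        also have "(\<Prod>j\<in>{..<q} - {i}. psubst (as[i := a] ! j $ fst (xs ! j)) (- lam j) * lam j ^ snd (xs ! j)) =
          (\<Prod>j\<in>{..<q} - {i}. psubst (as ! j $ fst (xs ! j)) (- lam j) * lam j ^ snd (xs ! j))"
          by (rule prod.cong) auto
        finally show ?thesis using l i by (simp add: R_def mult.assoc)
      qed
      show ?thesis
        unfolding semilinear_def W by (intro conjI allI coord_eqI) (simp_all add: algebra_simps)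
    qed
    then show "semilinear (- lam i) (\<lambda>a. g (as[i := a]))"
      unfolding g_def length_list_update using l by (simp add: semilinear_sum)
  qed
  have poly: "g bs \<in> mvpolys q" if "length bs = q" for bs
    unfolding g_def if_P[OF that]
    by (intro mvpolys_sum mvpolys_coord)
      (auto simp: coord_single W_def intro!: mvpolys_mult mvpolys_prod mvpolys_single_0 mvpolys_psubst mvpolys_uminus mvpolys_lam mvpolys_power)
  have coeffs: "coeffs_of g ys = G ys" for ys
  proof (cases "length ys = q")
    case False
    then show ?thesis by (simp add: coeffs_of_def g_def generators_of_def taylor_zero len)
  next
    case True
    have "Poly_Mapping.lookup (vmult sv_scale (W (generators_of ys) xs) (Poly_Mapping.single 0 (V xs))) (monomial (map snd ys)) =
       (if xs = ys then V xs else 0)" if "xs \<in> X" for xs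
    proof -
      have lx: "length xs = q" using that by (simp add: X_def)
      have W: "W (generators_of ys) xs = (if map fst xs = map fst ys then Poly_Mapping.single (monomial (map snd xs)) 1 else 0)"
      proof (cases "map fst xs = map fst ys")
        case True
        have "fst (xs ! i) = fst (ys ! i)" if "i < q" for i using that True lx \<open>length ys = q\<close> by (metis nth_map)
        then have "W (generators_of ys) xs = (\<Prod>i<q. lam i ^ snd (xs ! i))"
          unfolding W_def by (intro prod.cong refl) (simp add: generators_of_def axis_def \<open>length ys = q\<close>)
        also have "\<dots> = Poly_Mapping.single (monomial (map snd xs)) 1"
          using prod_lam[of "\<lambda>i. i" "\<lambda>i. snd (xs ! i)" q] lx by (simp add: monomial_def)
        finally show ?thesis using True by simp
      next
        case False
        then obtain i where i: "i < q" "fst (xs ! i) \<noteq> fst (ys ! i)"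
          using lx \<open>length ys = q\<close> by (auto simp: list_eq_iff_nth_eq)
        have "psubst ((generators_of ys ! i :: 'f sv) $ fst (xs ! i)) (- lam i) = 0"
          using i \<open>length ys = q\<close> by (simp add: generators_of_def axis_def)
        then have "W (generators_of ys) xs = 0" unfolding W_def using i(1) by (intro prod_zero) auto
        then show ?thesis using False by simp
      qed
      have eq: "xs = ys \<longleftrightarrow> map fst xs = map fst ys \<and> map snd xs = map snd ys"
        using lx True by (auto simp: list_eq_iff_nth_eq prod_eq_iff)
      have "Poly_Mapping.lookup (vmult sv_scale (W (generators_of ys) xs) (Poly_Mapping.single 0 (V xs))) (monomial (map snd ys)) $ r =
        (if xs = ys then V xs else 0) $ r" for r
        unfolding lookup_coord[symmetric] coord_vmult W coord_single
        using monomial_inj[of "map snd xs" "map snd ys"] lx True eq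
        by (auto simp: mult_single lookup_single when_def)
      then show ?thesis by (simp only: vec_eq_iff) simp
    qed
    then have "Poly_Mapping.lookup (g (generators_of ys)) (monomial (map snd ys)) = (\<Sum>xs\<in>X. if xs = ys then V xs else 0)"
      using True by (simp add: g_def generators_of_def lookup_sum)
    then have "coeffs_of g ys = (if ys \<in> X then G ys else 0)"
      using fin by (simp add: coeffs_of_def taylor_def V_def factorials_nonzero)
    moreover have "G ys = 0" if "ys \<notin> X"
    proof -
      have "\<exists>x\<in>set ys. \<not> snd x < N" using that True by (force simp: X_def)
      then show ?thesis using N by (auto simp: not_less)
    qed
    ultimately show ?thesis by auto
  qed
  have "g \<in> sv_cochains q"
  proof (rule cochainI[OF sesq poly])
    show "g bs = 0" if "length bs \<noteq> q" for bs using that by (simp add: g_def)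
    have "coeffs_of g = G" using coeffs by blast
    then show "sv.alt (coeffs_of g)" using alt by simp
  qed
  then show ?thesis using that coeffs by blast
qed

subsection \<open>The complex\<close>

lemma cochain_add:
  assumes f: "f \<in> sv_cochains q" and g: "g \<in> sv_cochains q"
  shows "(\<lambda>as. f as + g as) \<in> sv_cochains q" "coeffs_of (\<lambda>as. f as + g as) xs = coeffs_of f xs + coeffs_of g xs"
proof -
  have c: "coeffs_of (\<lambda>as. f as + g as) xs = coeffs_of f xs + coeffs_of g xs" for xs
    by (simp add: coeffs_of_def taylor_add)
  then show "coeffs_of (\<lambda>as. f as + g as) xs = coeffs_of f xs + coeffs_of g xs" .
  show "(\<lambda>as. f as + g as) \<in> sv_cochains q"
  proof (rule cochainI)
    show "sesquilinear q (\<lambda>as. f as + g as)"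
      using sesquilinear_cochain[OF f] sesquilinear_cochain[OF g] by (simp add: sesquilinear_def semilinear_add)
    show "sv.alt (coeffs_of (\<lambda>as. f as + g as))"
      unfolding sv.alt_def
    proof (intro allI)
      fix us x y vs
      show "coeffs_of (\<lambda>as. f as + g as) (us @ x # y # vs) = - coeffs_of (\<lambda>as. f as + g as) (us @ y # x # vs)"
        using sv.altD[OF alt_coeffs_of[OF f], of us x y vs] sv.altD[OF alt_coeffs_of[OF g], of us x y vs] by (simp add: c)
    qed
  qed (use f g in \<open>simp_all add: cochain_poly cochain_length mvpolys_add\<close>)
qed

lemma cochain_vmult:
  assumes f: "f \<in> sv_cochains q" and P: "P \<in> mvpolys q" and alt: "sv.alt (coeffs_of (\<lambda>as. vmult sv_scale P (f as)))"
  shows "(\<lambda>as. vmult sv_scale P (f as)) \<in> sv_cochains q"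
proof (rule cochainI[OF _ _ _ alt])
  show "sesquilinear q (\<lambda>as. vmult sv_scale P (f as))"
    using sesquilinear_cochain[OF f] by (simp add: sesquilinear_def semilinear_vmult)
  show "vmult sv_scale P (f bs) \<in> mvpolys q" if "length bs = q" for bs
    by (rule mvpolys_coord) (use cochain_poly[OF f that] P in \<open>auto intro: mvpolys_mult coord_mvpolys\<close>)
  show "vmult sv_scale P (f bs) = 0" if "length bs \<noteq> q" for bs
    by (rule coord_eqI) (simp add: cochain_length[OF f that])
qed

lemma cochain_minus:
  assumes f: "f \<in> sv_cochains q"
  shows "(\<lambda>as. - f as) \<in> sv_cochains q" "coeffs_of (\<lambda>as. - f as) xs = - coeffs_of f xs"
proof -
  have m: "- u = vmult sv_scale ((- 1) ^ 1) u" for u :: "'a sv mvpoly" by (rule coord_eqI) simp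
  have c: "coeffs_of (\<lambda>as. - f as) xs = - coeffs_of f xs" for xs
    unfolding coeffs_of_def m taylor_sign by simp
  then show "coeffs_of (\<lambda>as. - f as) xs = - coeffs_of f xs" .
  have "sv.alt (coeffs_of (\<lambda>as. - f as))"
    unfolding sv.alt_def
  proof (intro allI)
    fix us x y vs
    show "coeffs_of (\<lambda>as. - f as) (us @ x # y # vs) = - coeffs_of (\<lambda>as. - f as) (us @ y # x # vs)"
      using sv.altD[OF alt_coeffs_of[OF f], of us x y vs] by (simp add: c)
  qed
  then show "(\<lambda>as. - f as) \<in> sv_cochains q"
    unfolding m by (intro cochain_vmult f) (auto intro!: mvpolys_uminus mvpolys_1)
qed

lemma cochain_zero:
  "(\<lambda>as. 0 :: 'a::field_char_0 sv mvpoly) \<in> sv_cochains q"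
  "coeffs_of (\<lambda>as. 0 :: 'a sv mvpoly) xs = 0"
proof -
  have c: "coeffs_of (\<lambda>as. 0 :: 'a sv mvpoly) xs = 0" for xs by (simp add: coeffs_of_def taylor_zero)
  then show "coeffs_of (\<lambda>as. 0 :: 'a sv mvpoly) xs = 0" .
  show "(\<lambda>as. 0 :: 'a sv mvpoly) \<in> sv_cochains q"
    by (rule cochainI) (auto simp: sesquilinear_def semilinear_def sv.alt_def c mvpolys_0 intro!: coord_eqI)
qed

lemma adjoint_d_length:
  assumes f: "f \<in> sv_cochains q" and as: "length as \<noteq> Suc q"
  shows "adjoint_d f as = 0"
proof -
  have a: "action_term f as k = 0" if "k < length as" for k
  proof -
    have "length (nths as (- {k})) \<noteq> q" using length_nths_delete[of "{k}" as] that as by simp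
    then show ?thesis using cochain_length[OF f] by (intro coord_eqI) (simp add: action_term_def ext_right)
  qed
  have b: "bracket_term f as k l = 0" if "l < length as" "k < l" for k l
  proof -
    have "length (nths as (- {k, l})) = length as - 2" using length_nths_delete[of "{k, l}" as] that by simp
    then have "length (e # nths as (- {k, l})) \<noteq> q" for e using that as by simp
    then have "f (e # nths as (- {k, l})) = 0" for e using cochain_length[OF f] by blast
    then show ?thesis by (intro coord_eqI) (simp add: bracket_term_def coord_lin_ext)
  qed
  show ?thesis unfolding adjoint_d_terms by (intro coord_eqI) (simp add: coord_sum a b)
qed

lemma coeffs_of_adjoint_d_cochain:
  assumes f: "f \<in> sv_cochains q"
  shows "coeffs_of (adjoint_d f) xs = sv.cd (coeffs_of f) xs"
proof (cases "length xs = Suc q")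
  case True
  then show ?thesis
    using coeffs_of_adjoint_d[OF sesquilinear_cochain[OF f], of xs] f sv.ce_eq_cd[OF alt_coeffs_of[OF f]]
    by (simp add: cochain_poly)
next
  case False
  have a: "coeffs_of f (nths xs (- {k})) = 0" if "k < length xs" for k
    using length_nths_delete[of "{k}" xs] that False by (intro coeffs_of_length[OF f]) simp
  have b: "coeffs_of f (y # nths xs (- {k, l})) = 0" if "l < length xs" "k < l" for k l y
    using length_nths_delete[of "{k, l}" xs] that False by (intro coeffs_of_length[OF f]) simp
  have "sv.ce (coeffs_of f) xs = 0" by (simp add: sv.ce_def a b)
  moreover have "coeffs_of (adjoint_d f) xs = 0"
    using adjoint_d_length[OF f, of "generators_of xs"] False by (simp add: coeffs_of_def generators_of_def taylor_zero)
  ultimately show ?thesis using sv.ce_eq_cd[OF alt_coeffs_of[OF f]] by simp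
qed

lemma adjoint_d_cochain:
  assumes f: "f \<in> sv_cochains q"
  shows "adjoint_d f \<in> sv_cochains (Suc q)"
proof (rule cochainI)
  show "sesquilinear (Suc q) (adjoint_d f)" by (rule sesquilinear_adjoint_d[OF sesquilinear_cochain[OF f]])
  show "adjoint_d f bs = 0" if "length bs \<noteq> Suc q" for bs by (rule adjoint_d_length[OF f that])
  have "coeffs_of (adjoint_d f) = sv.cd (coeffs_of f)" using coeffs_of_adjoint_d_cochain[OF f] by blast
  then show "sv.alt (coeffs_of (adjoint_d f))" using sv.alt_cd[OF alt_coeffs_of[OF f]] by simp
  show "adjoint_d f bs \<in> mvpolys (Suc q)" if bs: "length bs = Suc q" for bs
  proof -
    have sg: "vmult sv_scale ((- 1) ^ n) w \<in> mvpolys (Suc q)" if "w \<in> mvpolys (Suc q)" for n and w :: "'a sv mvpoly"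
      unfolding minus_one_power using that by (intro mvpolys_coord) (auto intro: mvpolys_mult mvpolys_scalar coord_mvpolys)
    have a: "action_term f bs k \<in> mvpolys (Suc q)" if "k < Suc q" for k
    proof -
      have "length (nths bs (- {k})) = q" using length_nths_delete[of "{k}" bs] bs that by simp
      then show ?thesis by (intro mvpolys_action_term cochain_poly[OF f] bs that)
    qed
    have b: "bracket_term f bs k l \<in> mvpolys (Suc q)" if "l < Suc q" "k < l" for k l
      by (rule mvpolys_bracket_term[OF sesquilinear_cochain[OF f] cochain_poly[OF f] bs that])
    show ?thesis unfolding adjoint_d_terms bs
      by (intro mvpolys_add mvpolys_sum sg) (auto intro: a b)
  qed
qed

lemma adjoint_d_adjoint_d: assumes f: "f \<in> sv_cochains q" shows "adjoint_d (adjoint_d f) = (\<lambda>as. 0)"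
proof (rule cochain_eqI[where q = "Suc (Suc q)"])
  have "coeffs_of (adjoint_d f) = sv.cd (coeffs_of f)" using coeffs_of_adjoint_d_cochain[OF f] by blast
  then show "coeffs_of (adjoint_d (adjoint_d f)) xs = coeffs_of (\<lambda>as. 0) xs" for xs
    by (simp add: coeffs_of_adjoint_d_cochain[OF adjoint_d_cochain[OF f]] sv.cd_cd cochain_zero)
qed (use f in \<open>simp_all add: adjoint_d_cochain cochain_zero\<close>)

lemma adjoint_d_add:
  assumes f: "f \<in> sv_cochains q" and g: "g \<in> sv_cochains q"
  shows "adjoint_d (\<lambda>as. f as + g as) = (\<lambda>as. adjoint_d f as + adjoint_d g as)"
proof (rule cochain_eqI[where q = "Suc q"])
  have "coeffs_of (\<lambda>as. f as + g as) = (\<lambda>xs. coeffs_of f xs + coeffs_of g xs)" by (rule ext, rule cochain_add(2)[OF f g])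
  then show "coeffs_of (adjoint_d (\<lambda>as. f as + g as)) xs = coeffs_of (\<lambda>as. adjoint_d f as + adjoint_d g as) xs" for xs
    unfolding cochain_add(2)[OF adjoint_d_cochain[OF f] adjoint_d_cochain[OF g]]
    by (simp add: coeffs_of_adjoint_d_cochain[OF cochain_add(1)[OF f g]] coeffs_of_adjoint_d_cochain[OF f] coeffs_of_adjoint_d_cochain[OF g] sv.cd_add)
qed (intro adjoint_d_cochain cochain_add f g)+

lemma adjoint_d_minus:
  assumes f: "f \<in> sv_cochains q"
  shows "adjoint_d (\<lambda>as. - f as) = (\<lambda>as. - adjoint_d f as)"
proof (rule cochain_eqI[where q = "Suc q"])
  have "coeffs_of (\<lambda>as. - f as) = (\<lambda>xs. - coeffs_of f xs)" by (rule ext, rule cochain_minus(2)[OF f])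
  then show "coeffs_of (adjoint_d (\<lambda>as. - f as)) xs = coeffs_of (\<lambda>as. - adjoint_d f as) xs" for xs
    unfolding cochain_minus(2)[OF adjoint_d_cochain[OF f]]
    by (simp add: coeffs_of_adjoint_d_cochain[OF cochain_minus(1)[OF f]] coeffs_of_adjoint_d_cochain[OF f] sv.cd_minus)
qed (intro adjoint_d_cochain cochain_minus f)+

text \<open>
  A closed cochain has closed coefficients, these are exact, and a primitive of them is realized by a
  cochain.  In degree \<open>0\<close> the primitive has negative degree, so it is zero.
\<close>
theorem basic_exactness:
  assumes f: "f \<in> sv_cochains q" and closed: "adjoint_d f = (\<lambda>as. 0)"
  shows "case q of 0 \<Rightarrow> f = (\<lambda>as. 0) | Suc p \<Rightarrow> \<exists>g\<in>sv_cochains p. adjoint_d g = f"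
proof -
  have cl: "sv.cd (coeffs_of f) xs = 0" for xs
    unfolding coeffs_of_adjoint_d_cochain[OF f, symmetric] closed by (rule cochain_zero)
  obtain G where G: "sv.alt G" "bounded_support G" "\<And>xs. Suc (length xs) \<noteq> q \<Longrightarrow> G xs = 0"
    "\<And>xs. coeffs_of f xs = sv.cd G xs"
    using labelled_cohomology_vanishes[OF alt_coeffs_of[OF f] bounded_coeffs_of[OF f] coeffs_of_length[OF f] cl] by blast
  show ?thesis
  proof (cases q)
    case 0
    then have "G = (\<lambda>xs. 0)" using G(3) by auto
    then have "coeffs_of f xs = 0" for xs using G(4) by (simp add: sv.cd_zero)
    then have "f = (\<lambda>as. 0)" by (intro cochain_eqI[OF f]) (simp_all add: cochain_zero)
    then show ?thesis using 0 by simp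
  next
    case (Suc p)
    obtain g where g: "g \<in> sv_cochains p" "\<And>xs. coeffs_of g xs = G xs"
      using realize_coefficients[OF G(1,2), of p] G(3) Suc by auto
    then have "coeffs_of g = G" by blast
    then have "adjoint_d g = f"
      using adjoint_d_cochain[OF g(1)] f Suc by (intro cochain_eqI[of _ q]) (simp_all add: coeffs_of_adjoint_d_cochain[OF g(1)] G(4))
    then show ?thesis using g(1) Suc by auto
  qed
qed

subsection \<open>The action of the derivation\<close>

abbreviation partial_cochain :: "('f::field_char_0 sv list \<Rightarrow> 'f sv mvpoly) \<Rightarrow> 'f sv list \<Rightarrow> 'f sv mvpoly" where
  "partial_cochain \<equiv> cochain_partial sv_scale"

lemma taylor_lam:
  assumes i: "i < length xs"
  shows "taylor xs (vmult sv_scale (lam i) w) = scl (of_nat (snd (xs ! i))) (taylor (xs[i := (fst (xs ! i), snd (xs ! i) - 1)]) w)"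
proof -
  define n where "n = snd (xs ! i)"
  define ys where "ys = xs[i := (fst (xs ! i), n - 1)]"
  have ys: "nths ys (- {i}) = nths xs (- {i})" unfolding ys_def by (rule nths_update_outside) simp
  have fac: "factorials xs = fact n * (factorials (nths xs (- {i})) :: 'a)" "factorials ys = fact (n - 1) * (factorials (nths xs (- {i})) :: 'a)"
  proof -
    have y: "length ys = length xs" "ys ! i = (fst (xs ! i), n - 1)" using i by (simp_all add: ys_def)
    show "factorials xs = fact n * (factorials (nths xs (- {i})) :: 'a)" "factorials ys = fact (n - 1) * (factorials (nths xs (- {i})) :: 'a)"
      using factorials_nths[of "{i}" xs] factorials_nths[of "{i}" ys] i by (simp_all add: y ys) (simp_all add: n_def)
  qed
  define M where "M = spread (nths [0..<length xs] (- {i})) (map ((!) (map snd xs)) (nths [0..<length xs] (- {i})))"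
  have js: "distinct (nths [0..<length xs] (- {i}))" "set (nths [0..<length xs] (- {i})) = {..<length xs} - {i}"
    by (auto simp: distinct_nths_indices set_nths_indices)
  have m: "monomial (map snd xs) = Poly_Mapping.single i n + M"
    using monomial_split[of "nths [0..<length xs] (- {i})" "map snd xs" "{i}"] js i by (simp add: n_def M_def)
  have m': "monomial (map snd ys) = Poly_Mapping.single i (n - 1) + M"
  proof -
    let ?js = "nths [0..<length xs] (- {i})"
    have e: "map ((!) (map snd ys)) ?js = map ((!) (map snd xs)) ?js"
      using js(2) by (auto simp: ys_def)
    have "monomial (map snd ys) = (\<Sum>k\<in>{i}. Poly_Mapping.single k (map snd ys ! k)) + spread ?js (map ((!) (map snd ys)) ?js)"
      by (rule monomial_split) (use js i in \<open>simp_all add: ys_def\<close>)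
    moreover have "map snd ys ! i = n - 1" using i by (simp add: ys_def)
    ultimately show ?thesis unfolding e M_def by simp
  qed
  have "i \<notin> Poly_Mapping.keys M" using keys_spread js(2) unfolding M_def by blast
  then have "Poly_Mapping.lookup (vmult sv_scale (lam i) w) (monomial (map snd xs)) $ r =
     (if n = 0 then 0 else Poly_Mapping.lookup w (monomial (map snd ys)) $ r)" for r
    unfolding lookup_coord[symmetric] coord_vmult m m' by (rule lookup_lam_mult)
  then have l: "Poly_Mapping.lookup (vmult sv_scale (lam i) w) (monomial (map snd xs)) =
     (if n = 0 then 0 else Poly_Mapping.lookup w (monomial (map snd ys)))" by (simp add: vec_eq_iff)
  show ?thesis
    unfolding n_def[symmetric] ys_def[symmetric] unfolding taylor_def l fac
    by (cases n) (simp_all add: mult_ac)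
qed

lemma taylor_dd: "taylor xs (vmult sv_scale dd w) = act (Gen_L, 0) (taylor xs w)"
proof -
  have "taylor xs (vmult sv_scale dd w) $ r = act (Gen_L, 0) (taylor xs w) $ r" for r
    by (cases r; simp add: taylor_def lookup_coord[symmetric] lookup_dd_mult sum_gen amap_def)
  then show ?thesis by (simp only: vec_eq_iff) simp
qed

text \<open>
  On the coefficients \<open>\<partial>\<close> is the Lie derivative along \<open>L\<^bsub>(0)\<^esub>\<close>: this element acts on the algebra as
  \<open>\<partial>\<close>, and \<open>[L\<^bsub>(0)\<^esub>, g\<^bsub>(n)\<^esub>] = - n g\<^bsub>(n-1)\<^esub>\<close> accounts for multiplication by \<open>\<lambda>\<^sub>i\<close>.  Hence \<open>\<partial>\<close> preserves cochains
  and commutes with the differential.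
\<close>
lemma coeffs_of_partial_cochain:
  assumes f: "f \<in> sv_cochains q"
  shows "coeffs_of (partial_cochain f) xs = sv.lie (Gen_L, 0) (coeffs_of f) xs"
proof (cases "length xs = q")
  case False
  then have "sv.lie (Gen_L, 0) (coeffs_of f) xs = 0"
    by (simp add: sv.lie_explicit coeffs_of_length[OF f])
  moreover have "f (generators_of xs) = 0" using False cochain_length[OF f] by (simp add: generators_of_def)
  then have "partial_cochain f (generators_of xs) = 0" by (intro coord_eqI) (simp add: cochain_partial_def)
  ultimately show ?thesis by (simp add: coeffs_of_def taylor_zero)
next
  case True
  have e: "partial_cochain f (generators_of xs) = vmult sv_scale dd (f (generators_of xs)) + (\<Sum>i<q. vmult sv_scale (lam i) (f (generators_of xs)))"
    using True by (intro coord_eqI) (simp add: cochain_partial_def generators_of_def distrib_right sum_distrib_right coord_sum)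
  have g: "generators_of (xs[i := (fst (xs ! i), n)]) = (generators_of xs :: 'a sv list)" if "i < length xs" for i n
    using that by (intro nth_equalityI) (auto simp: generators_of_def nth_list_update)
  have "taylor xs (vmult sv_scale (lam i) (f (generators_of xs))) =
     - scl (coef (Gen_L, 0) (xs ! i)) (coeffs_of f (xs[i := lab (Gen_L, 0) (xs ! i)]))" if i: "i < q" for i
  proof -
    obtain h n where h: "xs ! i = (h, n)" by (cases "xs ! i")
    have c: "coef (Gen_L, 0) (h, n) = - (of_nat n :: 'a)" "lab (Gen_L, 0) (h, n) = (h, n - 1)"
      by (cases h; simp)+
    have "generators_of (xs[i := (h, n - 1)]) = (generators_of xs :: 'a sv list)" using g[of i "n - 1"] i True h by simp
    then show ?thesis
      using taylor_lam[of i xs "f (generators_of xs)"] i True unfolding h c by (simp add: h coeffs_of_def)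
  qed
  then have "coeffs_of (partial_cochain f) xs = act (Gen_L, 0) (coeffs_of f xs) + (\<Sum>i<q. - scl (coef (Gen_L, 0) (xs ! i)) (coeffs_of f (xs[i := lab (Gen_L, 0) (xs ! i)])))"
    unfolding coeffs_of_def[of "partial_cochain f"] e taylor_add taylor_sum taylor_dd by (simp add: coeffs_of_def)
  then show ?thesis unfolding sv.lie_explicit using True by (simp add: sum_negf del: coef.simps lab.simps act.simps)
qed

lemma partial_cochain_cochain: assumes f: "f \<in> sv_cochains q" shows "partial_cochain f \<in> sv_cochains q"
proof -
  let ?P = "dd + (\<Sum>k<q. lam k) :: 'a poly mvpoly"
  have e: "partial_cochain f = (\<lambda>as. vmult sv_scale ?P (f as))"
  proof
    fix as show "partial_cochain f as = vmult sv_scale ?P (f as)"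
      by (cases "length as = q") (auto simp: cochain_partial_def cochain_length[OF f] intro!: coord_eqI)
  qed
  have "coeffs_of (partial_cochain f) = sv.lie (Gen_L, 0) (coeffs_of f)" using coeffs_of_partial_cochain[OF f] by blast
  then have "sv.alt (coeffs_of (partial_cochain f))" using sv.alt_lie[OF alt_coeffs_of[OF f]] by simp
  then show ?thesis unfolding e
    by (intro cochain_vmult f) (auto intro!: mvpolys_add mvpolys_dd mvpolys_sum mvpolys_lam)
qed

lemma adjoint_d_partial_cochain: assumes f: "f \<in> sv_cochains q" shows "adjoint_d (partial_cochain f) = partial_cochain (adjoint_d f)"
proof (rule cochain_eqI[where q = "Suc q"])
  have 1: "coeffs_of (partial_cochain f) = sv.lie (Gen_L, 0) (coeffs_of f)" using coeffs_of_partial_cochain[OF f] by blast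
  have 2: "coeffs_of (adjoint_d f) = sv.cd (coeffs_of f)" using coeffs_of_adjoint_d_cochain[OF f] by blast
  show "coeffs_of (adjoint_d (partial_cochain f)) xs = coeffs_of (partial_cochain (adjoint_d f)) xs" for xs
    unfolding coeffs_of_adjoint_d_cochain[OF partial_cochain_cochain[OF f]] coeffs_of_partial_cochain[OF adjoint_d_cochain[OF f]] 1 2
    by (rule sv.lie_cd[symmetric])
qed (intro adjoint_d_cochain partial_cochain_cochain f)+

lemma partial_cochain_add: "partial_cochain (\<lambda>as. f as + g as) = (\<lambda>as. partial_cochain f as + partial_cochain g as)"
  by (rule ext, rule coord_eqI) (simp add: cochain_partial_def algebra_simps)

lemma partial_cochain_minus: "partial_cochain (\<lambda>as. - f as) = (\<lambda>as. - partial_cochain f as)"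
  by (rule ext, rule coord_eqI) (simp add: cochain_partial_def algebra_simps)

lemma partial_cochain_inj:
  fixes f :: "'f::field_char_0 sv list \<Rightarrow> 'f sv mvpoly"
  assumes "partial_cochain f = (\<lambda>as. 0)" shows "f = (\<lambda>as. 0)"
proof
  fix as :: "'f sv list"
  have nz: "dd + (\<Sum>k<length as. lam k) \<noteq> (0 :: 'f poly mvpoly)"
  proof
    assume "dd + (\<Sum>k<length as. lam k) = (0 :: 'f poly mvpoly)"
    then have "Poly_Mapping.lookup (dd + (\<Sum>k<length as. lam k) :: 'f poly mvpoly) 0 = 0" by simp
    moreover have "Poly_Mapping.single k (Suc 0) \<noteq> 0" for k :: nat
      by (metis lookup_single_eq lookup_zero nat.simps(3))
    ultimately show False by (simp add: lookup_add lookup_sum dd_def lam_def lookup_single when_def)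
  qed
  have "coord k (partial_cochain f as) = 0" for k using assms by simp
  then have "(dd + (\<Sum>k<length as. lam k)) * coord k (f as) = 0" for k by (simp add: cochain_partial_def)
  then have "coord k (f as) = 0" for k using nz by (metis mult_eq_0_iff)
  then show "f as = 0" by (intro coord_eqI) simp
qed

section \<open>Triviality of the cohomology groups\<close>

lemma trivial_groupI:
  assumes "carrier G = {\<one>\<^bsub>G\<^esub>}" "\<one>\<^bsub>G\<^esub> \<otimes>\<^bsub>G\<^esub> \<one>\<^bsub>G\<^esub> = \<one>\<^bsub>G\<^esub>"
  shows "trivial_group G"
proof -
  have "group G" by (rule groupI) (use assms in auto)
  then show ?thesis using assms by (simp add: trivial_group_def)
qed

text \<open>
  If every cocycle is a coboundary, then the only coset is the subgroup itself.
\<close>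
lemma trivial_cohomology_group:
  assumes G: "group (C q)" and N: "subgroup (coboundaries C d q) (C q)"
    and exact: "\<And>x. x \<in> carrier (C q) \<Longrightarrow> d q x = \<one>\<^bsub>C (Suc q)\<^esub> \<Longrightarrow> x \<in> coboundaries C d q"
    and one: "d q \<one>\<^bsub>C q\<^esub> = \<one>\<^bsub>C (Suc q)\<^esub>"
  shows "trivial_group (cohomology_group C d q)"
proof -
  interpret G: group "C q" by (rule G)
  let ?N = "coboundaries C d q" and ?K = "kernel (C q) (C (Suc q)) (d q)"
  let ?H = "(C q)\<lparr>carrier := ?K\<rparr>"
  have K: "\<one>\<^bsub>C q\<^esub> \<in> ?K" "?K \<subseteq> ?N" using one exact by (auto simp: kernel_def)
  have "?N #>\<^bsub>?H\<^esub> a = ?N" if "a \<in> ?K" for a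
  proof -
    have "?N #>\<^bsub>?H\<^esub> a = ?N #>\<^bsub>C q\<^esub> a" by (simp add: r_coset_def)
    also have "\<dots> = ?N" using G.coset_join2[OF _ N] K(2) that subgroup.mem_carrier[OF N] by blast
    finally show ?thesis .
  qed
  then have "carrier (?H Mod ?N) = {?N}" using K(1) by (auto simp: FactGroup_def RCOSETS_def)
  moreover have "?N <#>\<^bsub>?H\<^esub> ?N = ?N"
    using G.subgroup_mult_id[OF N] by (simp add: set_mult_def)
  ultimately show ?thesis
    unfolding cohomology_group_def by (intro trivial_groupI) (simp_all add: FactGroup_def)
qed

abbreviation sv_basic :: "nat \<Rightarrow> ('f::field_char_0 sv list \<Rightarrow> 'f sv mvpoly) monoid" where
  "sv_basic \<equiv> basic_group sv_scale sv_scale"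

lemma sv_basic_simps:
  "carrier (sv_basic q) = sv_cochains q" "f \<otimes>\<^bsub>sv_basic q\<^esub> g = (\<lambda>as. f as + g as)" "\<one>\<^bsub>sv_basic q\<^esub> = (\<lambda>as. 0)"
  by (simp_all add: basic_group_def)

lemma comm_group_sv_basic: "comm_group (sv_basic q :: ('f::field_char_0 sv list \<Rightarrow> 'f sv mvpoly) monoid)"
proof (rule comm_groupI)
  fix x :: "'f sv list \<Rightarrow> 'f sv mvpoly"
  assume "x \<in> carrier (sv_basic q)"
  then show "\<exists>y\<in>carrier (sv_basic q). y \<otimes>\<^bsub>sv_basic q\<^esub> x = \<one>\<^bsub>sv_basic q\<^esub>"
    by (intro bexI[of _ "\<lambda>as. - x as"]) (auto simp: sv_basic_simps cochain_minus)
qed (auto simp: sv_basic_simps cochain_add cochain_zero add_ac)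

lemma inv_sv_basic:
  assumes "f \<in> sv_cochains q"
  shows "inv\<^bsub>sv_basic q\<^esub> f = (\<lambda>as. - f as)"
proof -
  interpret comm_group "sv_basic q :: ('a sv list \<Rightarrow> 'a sv mvpoly) monoid" by (rule comm_group_sv_basic)
  show ?thesis by (rule inv_equality) (use assms in \<open>auto simp: sv_basic_simps cochain_minus\<close>)
qed

lemma subgroup_sv_basicI:
  assumes "H \<subseteq> sv_cochains q" "(\<lambda>as. 0) \<in> H" "\<And>f g. f \<in> H \<Longrightarrow> g \<in> H \<Longrightarrow> (\<lambda>as. f as + g as) \<in> H"
    "\<And>f. f \<in> H \<Longrightarrow> (\<lambda>as. - f as) \<in> H"
  shows "subgroup H (sv_basic q)"
proof
  show "inv\<^bsub>sv_basic q\<^esub> f \<in> H" if "f \<in> H" for f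
    using assms that inv_sv_basic[of f q] by auto
qed (use assms in \<open>auto simp: sv_basic_simps\<close>)

lemma adjoint_d_zero: "adjoint_d (\<lambda>as. 0 :: 'f::field_char_0 sv mvpoly) = (\<lambda>as. 0)"
proof (rule cochain_eqI[where q = "Suc 0"])
  have "coeffs_of (\<lambda>as. 0 :: 'f sv mvpoly) = (\<lambda>xs. 0)" by (rule ext, rule cochain_zero)
  then show "coeffs_of (adjoint_d (\<lambda>as. 0 :: 'f sv mvpoly)) xs = coeffs_of (\<lambda>as. 0) xs" for xs
    by (simp add: coeffs_of_adjoint_d_cochain[OF cochain_zero(1)] sv.cd_zero)
qed (intro adjoint_d_cochain cochain_zero)+

lemma subgroup_exact_cochains:
  "subgroup (adjoint_d ` sv_cochains p) (sv_basic (Suc p) :: ('f::field_char_0 sv list \<Rightarrow> 'f sv mvpoly) monoid)"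
proof (rule subgroup_sv_basicI)
  show "adjoint_d ` sv_cochains p \<subseteq> sv_cochains (Suc p)" using adjoint_d_cochain by blast
  show "(\<lambda>as. 0 :: 'f sv mvpoly) \<in> adjoint_d ` sv_cochains p"
    by (rule image_eqI[of _ _ "\<lambda>as. 0"]) (simp_all add: adjoint_d_zero cochain_zero)
next
  fix f g :: "'f sv list \<Rightarrow> 'f sv mvpoly"
  assume "f \<in> adjoint_d ` sv_cochains p" "g \<in> adjoint_d ` sv_cochains p"
  then obtain f' g' where f': "f' \<in> sv_cochains p" "g' \<in> sv_cochains p" "f = adjoint_d f'" "g = adjoint_d g'" by blast
  then show "(\<lambda>as. f as + g as) \<in> adjoint_d ` sv_cochains p"
    by (intro image_eqI[of _ _ "\<lambda>as. f' as + g' as"])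
      (simp_all add: adjoint_d_add[OF f'(1,2)] cochain_add(1)[OF f'(1,2)])
next
  fix f :: "'f sv list \<Rightarrow> 'f sv mvpoly"
  assume "f \<in> adjoint_d ` sv_cochains p"
  then obtain f' where f': "f' \<in> sv_cochains p" "f = adjoint_d f'" by blast
  then show "(\<lambda>as. - f as) \<in> adjoint_d ` sv_cochains p"
    by (intro image_eqI[of _ _ "\<lambda>as. - f' as"])
      (simp_all add: adjoint_d_minus[OF f'(1)] cochain_minus(1)[OF f'(1)])
qed

theorem basic_cohomology_trivial:
  "trivial_group (basic_cohomology (sv_scale :: 'f::field_char_0 poly \<Rightarrow> 'f sv \<Rightarrow> 'f sv) sv_bracket sv_scale sv_bracket q)"
proof -
  interpret G: comm_group "sv_basic q :: ('f sv list \<Rightarrow> 'f sv mvpoly) monoid" by (rule comm_group_sv_basic)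
  show ?thesis
    unfolding basic_cohomology_def
  proof (rule trivial_cohomology_group)
    show "group (sv_basic q :: ('f sv list \<Rightarrow> 'f sv mvpoly) monoid)" by (rule G.is_group)
    show "subgroup (coboundaries sv_basic (\<lambda>_. adjoint_d) q) (sv_basic q :: ('f sv list \<Rightarrow> 'f sv mvpoly) monoid)"
      using G.triv_subgroup subgroup_exact_cochains by (cases q) (simp_all add: coboundaries_def sv_basic_simps)
    show "adjoint_d \<one>\<^bsub>sv_basic q\<^esub> = (\<one>\<^bsub>sv_basic (Suc q)\<^esub> :: 'f sv list \<Rightarrow> 'f sv mvpoly)"
      by (simp add: sv_basic_simps adjoint_d_zero)
    show "f \<in> coboundaries sv_basic (\<lambda>_. adjoint_d) q"
      if "f \<in> carrier (sv_basic q)" "adjoint_d f = \<one>\<^bsub>sv_basic (Suc q)\<^esub>" for f :: "'f sv list \<Rightarrow> 'f sv mvpoly"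
      using basic_exactness[of f q] that by (cases q) (auto simp: coboundaries_def sv_basic_simps)
  qed
qed

subsection \<open>The reduced complex\<close>

abbreviation sv_partial :: "nat \<Rightarrow> ('f::field_char_0 sv list \<Rightarrow> 'f sv mvpoly) set" where
  "sv_partial \<equiv> partial_image sv_scale sv_scale"

lemma subgroup_sv_partial:
  "subgroup (sv_partial q) (sv_basic q :: ('f::field_char_0 sv list \<Rightarrow> 'f sv mvpoly) monoid)"
proof (rule subgroup_sv_basicI)
  show "sv_partial q \<subseteq> sv_cochains q" using partial_cochain_cochain by (auto simp: partial_image_def)
  have "partial_cochain (\<lambda>as. 0) = (\<lambda>as. 0 :: 'f sv mvpoly)" by (rule ext, rule coord_eqI) (simp add: cochain_partial_def)
  then show "(\<lambda>as. 0 :: 'f sv mvpoly) \<in> sv_partial q"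
    unfolding partial_image_def by (intro image_eqI[of _ _ "\<lambda>as. 0"]) (simp_all add: cochain_zero)
next
  fix f g :: "'f sv list \<Rightarrow> 'f sv mvpoly"
  assume "f \<in> sv_partial q" "g \<in> sv_partial q"
  then obtain f' g' where f': "f' \<in> sv_cochains q" "g' \<in> sv_cochains q" "f = partial_cochain f'" "g = partial_cochain g'"
    by (auto simp: partial_image_def)
  then show "(\<lambda>as. f as + g as) \<in> sv_partial q"
    unfolding partial_image_def
    by (intro image_eqI[of _ _ "\<lambda>as. f' as + g' as"]) (simp_all add: partial_cochain_add cochain_add(1)[OF f'(1,2)])
next
  fix f :: "'f sv list \<Rightarrow> 'f sv mvpoly"
  assume "f \<in> sv_partial q"
  then obtain f' where f': "f' \<in> sv_cochains q" "f = partial_cochain f'" by (auto simp: partial_image_def)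
  then show "(\<lambda>as. - f as) \<in> sv_partial q"
    unfolding partial_image_def
    by (intro image_eqI[of _ _ "\<lambda>as. - f' as"]) (simp_all add: partial_cochain_minus cochain_minus(1)[OF f'(1)])
qed

abbreviation reduced_class :: "nat \<Rightarrow> ('f::field_char_0 sv list \<Rightarrow> 'f sv mvpoly) \<Rightarrow> ('f sv list \<Rightarrow> 'f sv mvpoly) set" where
  "reduced_class q f \<equiv> sv_partial q #>\<^bsub>sv_basic q\<^esub> f"

lemma normal_sv_partial:
  "sv_partial q \<lhd> (sv_basic q :: ('f::field_char_0 sv list \<Rightarrow> 'f sv mvpoly) monoid)"
  using comm_group.subgroup_imp_normal[OF comm_group_sv_basic subgroup_sv_partial] .

lemma reduced_class_eqI:
  fixes f g :: "'f::field_char_0 sv list \<Rightarrow> 'f sv mvpoly"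
  assumes "g \<in> sv_cochains q" "h \<in> sv_cochains q" "f = (\<lambda>as. partial_cochain h as + g as)"
  shows "reduced_class q f = reduced_class q g"
proof -
  interpret G: comm_group "sv_basic q :: ('f sv list \<Rightarrow> 'f sv mvpoly) monoid" by (rule comm_group_sv_basic)
  have "f \<in> reduced_class q g"
    using assms by (auto simp: r_coset_def sv_basic_simps partial_image_def)
  then have "reduced_class q g = reduced_class q f"
    by (rule G.repr_independence[OF _ _ subgroup_sv_partial]) (simp add: sv_basic_simps assms)
  then show ?thesis ..
qed

lemma reduced_differential_reduced_class:
  fixes f :: "'f::field_char_0 sv list \<Rightarrow> 'f sv mvpoly"
  assumes f: "f \<in> sv_cochains q"
  shows "reduced_differential sv_scale sv_bracket sv_scale sv_bracket q (reduced_class q f) = reduced_class (Suc q) (adjoint_d f)"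
proof -
  have "reduced_class (Suc q) (adjoint_d f') = reduced_class (Suc q) (adjoint_d f)" if mem: "f' \<in> reduced_class q f" for f'
  proof -
    obtain p where p: "p \<in> sv_partial q" "f' = (\<lambda>as. p as + f as)"
      using mem unfolding r_coset_def sv_basic_simps by blast
    then obtain h where h: "h \<in> sv_cochains q" "f' = (\<lambda>as. partial_cochain h as + f as)"
      unfolding partial_image_def by blast
    then have "adjoint_d f' = (\<lambda>as. partial_cochain (adjoint_d h) as + adjoint_d f as)"
      by (simp add: adjoint_d_add[OF partial_cochain_cochain[OF h(1)] f] adjoint_d_partial_cochain)
    then show ?thesis by (rule reduced_class_eqI[OF adjoint_d_cochain[OF f] adjoint_d_cochain[OF h(1)]])
  qed
  moreover have "f \<in> reduced_class q f"
    using subgroup.one_closed[OF subgroup_sv_partial[of q]] by (force simp: r_coset_def sv_basic_simps)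
  ultimately show ?thesis unfolding reduced_differential_def by blast
qed

text \<open>
  Let the class of \<open>f\<close> be closed, so \<open>d f = \<partial> g\<close>.  Then \<open>\<partial> d g = d d f = 0\<close> and \<open>\<partial>\<close> is injective, so \<open>d g = 0\<close>
  and \<open>g = d h\<close> by exactness of the basic complex.  Now \<open>f - \<partial> h\<close> is closed, hence exact (zero in
  degree \<open>0\<close>), and it has the same class as \<open>f\<close>.
\<close>
theorem reduced_cohomology_trivial:
  "trivial_group (reduced_cohomology (sv_scale :: 'f::field_char_0 poly \<Rightarrow> 'f sv \<Rightarrow> 'f sv) sv_bracket sv_scale sv_bracket q)"
proof -
  let ?B = "sv_basic :: nat \<Rightarrow> ('f sv list \<Rightarrow> 'f sv mvpoly) monoid"
  let ?R = "reduced_group sv_scale sv_scale :: nat \<Rightarrow> ('f sv list \<Rightarrow> 'f sv mvpoly) set monoid"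
  let ?d = "reduced_differential sv_scale sv_bracket sv_scale sv_bracket :: nat \<Rightarrow> ('f sv list \<Rightarrow> 'f sv mvpoly) set \<Rightarrow> _"
  interpret G: comm_group "?B q" by (rule comm_group_sv_basic)
  have R: "group (?R q)" for q
    unfolding reduced_group_def by (rule normal.factorgroup_is_group[OF normal_sv_partial])
  interpret R: group "?R q" by (rule R)
  have car: "carrier (?R q) = reduced_class q ` sv_cochains q" for q
    by (auto simp: reduced_group_def FactGroup_def RCOSETS_def sv_basic_simps)
  have one: "\<one>\<^bsub>?R q\<^esub> = sv_partial q" for q by (simp add: reduced_group_def FactGroup_def)
  have one': "reduced_class q (\<lambda>as. 0 :: 'f sv mvpoly) = sv_partial q" for q
    by (simp add: r_coset_def sv_basic_simps)
  show ?thesis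
    unfolding reduced_cohomology_def
  proof (rule trivial_cohomology_group)
    show "group (?R q)" by (rule R)
    show "?d q \<one>\<^bsub>?R q\<^esub> = \<one>\<^bsub>?R (Suc q)\<^esub>"
      using reduced_differential_reduced_class[OF cochain_zero(1)[where 'a = 'f], of q] unfolding one adjoint_d_zero one' .
    show "subgroup (coboundaries ?R ?d q) (?R q)"
    proof (cases q)
      case 0
      then show ?thesis using R.triv_subgroup by (simp add: coboundaries_def)
    next
      case (Suc p)
      have "coboundaries ?R ?d q = ?d p ` reduced_class p ` sv_cochains p" by (simp add: coboundaries_def Suc car)
      also have "\<dots> = reduced_class q ` adjoint_d ` sv_cochains p"
        unfolding image_image by (rule image_cong[OF refl]) (simp add: reduced_differential_reduced_class Suc)
      finally have e: "coboundaries ?R ?d q = reduced_class q ` adjoint_d ` sv_cochains p" .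
      have h: "group_hom (?B q) (?R q) (reduced_class q)"
      proof (rule group_hom.intro[OF G.is_group R], rule group_hom_axioms.intro)
        show "reduced_class q \<in> hom (?B q) (?R q)"
          unfolding reduced_group_def by (rule normal.r_coset_hom_Mod[OF normal_sv_partial])
      qed
      show ?thesis unfolding e
        by (rule group_hom.subgroup_img_is_subgroup[OF h], unfold Suc, rule subgroup_exact_cochains)
    qed
    fix X assume X: "X \<in> carrier (?R q)" "?d q X = \<one>\<^bsub>?R (Suc q)\<^esub>"
    then obtain f where f: "f \<in> sv_cochains q" "X = reduced_class q f" by (auto simp: car)
    have "reduced_class (Suc q) (adjoint_d f) = sv_partial (Suc q)" using X f by (simp add: reduced_differential_reduced_class one)
    moreover have "adjoint_d f \<in> reduced_class (Suc q) (adjoint_d f)"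
      using subgroup.one_closed[OF subgroup_sv_partial[of "Suc q"]] by (force simp: r_coset_def sv_basic_simps)
    ultimately obtain g where g: "g \<in> sv_cochains (Suc q)" "adjoint_d f = partial_cochain g"
      by (auto simp: partial_image_def)
    have "partial_cochain (adjoint_d g) = (\<lambda>as. 0)"
      using adjoint_d_partial_cochain[OF g(1)] adjoint_d_adjoint_d[OF f(1)] g(2) by simp
    then have "adjoint_d g = (\<lambda>as. 0)" by (rule partial_cochain_inj)
    then obtain h where h: "h \<in> sv_cochains q" "adjoint_d h = g" using basic_exactness[OF g(1)] by auto
    define k where "k = (\<lambda>as. f as + - partial_cochain h as)"
    have k: "k \<in> sv_cochains q" unfolding k_def by (intro cochain_add cochain_minus partial_cochain_cochain f h)
    have "adjoint_d k = (\<lambda>as. 0)"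
      unfolding k_def adjoint_d_add[OF f(1) cochain_minus(1)[OF partial_cochain_cochain[OF h(1)]]] adjoint_d_minus[OF partial_cochain_cochain[OF h(1)]]
        adjoint_d_partial_cochain[OF h(1)] h(2) g(2) by simp
    from basic_exactness[OF k this] show "X \<in> coboundaries ?R ?d q"
    proof (cases q)
      case 0
      then have "k = (\<lambda>as. 0)" using basic_exactness[OF k \<open>adjoint_d k = _\<close>] by simp
      then have "f = (\<lambda>as. partial_cochain h as + 0)" by (simp add: k_def fun_eq_iff)
      then have "X = reduced_class q (\<lambda>as. 0)" unfolding f(2) by (rule reduced_class_eqI[OF cochain_zero(1) h(1)])
      then show ?thesis using 0 by (simp add: coboundaries_def one one')
    next
      case (Suc p)
      then obtain l where l: "l \<in> sv_cochains p" "adjoint_d l = k" using basic_exactness[OF k \<open>adjoint_d k = _\<close>] by auto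
      have "f = (\<lambda>as. partial_cochain h as + k as)" by (simp add: k_def fun_eq_iff)
      then have "X = reduced_class q k" unfolding f(2) by (rule reduced_class_eqI[OF k h(1)])
      also have "\<dots> = ?d p (reduced_class p l)" using reduced_differential_reduced_class[OF l(1)] l(2) Suc by simp
      finally show ?thesis using l(1) by (auto simp: coboundaries_def Suc car)
    qed
  qed
qed

section \<open>Casimir elements and derivations\<close>

lemma lookup_psubst_neg:
  fixes Q :: "'f::field poly mvpoly"
  shows "Poly_Mapping.lookup (psubst p (- lam 0) * Q) 0 = smult (coeff p 0) (Poly_Mapping.lookup Q 0)"
    and "Poly_Mapping.lookup (psubst p (- lam 0) * Q) (Poly_Mapping.single 0 1) =
      smult (coeff p 0) (Poly_Mapping.lookup Q (Poly_Mapping.single 0 1)) - smult (coeff p 1) (Poly_Mapping.lookup Q 0)"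
proof -
  have l: "Poly_Mapping.lookup (lam 0 * A) (Poly_Mapping.single 0 n) = (if n = 0 then 0 else Poly_Mapping.lookup A (Poly_Mapping.single 0 (n - 1)))"
    for A :: "'f poly mvpoly" and n using lookup_lam_mult[of 0 0 A n] by simp
  have 0: "Poly_Mapping.lookup (psubst p (- lam 0) * Q) 0 = smult (coeff p 0) (Poly_Mapping.lookup Q 0)" for p and Q :: "'f poly mvpoly"
  proof (cases p)
    case (pCons a p')
    have "psubst p (- lam 0) * Q = scalar a * Q - lam 0 * (psubst p' (- lam 0) * Q)"
      by (simp add: pCons algebra_simps)
    then show ?thesis using l[of "psubst p' (- lam 0) * Q" 0] pCons by (simp add: lookup_minus lookup_scalar_mult)
  qed
  then show "Poly_Mapping.lookup (psubst p (- lam 0) * Q) 0 = smult (coeff p 0) (Poly_Mapping.lookup Q 0)" .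
  show "Poly_Mapping.lookup (psubst p (- lam 0) * Q) (Poly_Mapping.single 0 1) =
      smult (coeff p 0) (Poly_Mapping.lookup Q (Poly_Mapping.single 0 1)) - smult (coeff p 1) (Poly_Mapping.lookup Q 0)"
  proof (cases p)
    case (pCons a p')
    have "psubst p (- lam 0) * Q = scalar a * Q - lam 0 * (psubst p' (- lam 0) * Q)"
      by (simp add: pCons algebra_simps)
    then show ?thesis using l[of "psubst p' (- lam 0) * Q" 1] pCons 0[of p' Q]
      by (simp add: lookup_minus lookup_scalar_mult)
  qed
qed

lemma coord_bracket_left: "coord k (sv_bracket a b) = (\<Sum>g\<in>UNIV. psubst (a $ g) (- lam 0) * coord k (sv_bracket (axis g 1) b))"
  unfolding coord_bracket mult.assoc sum_distrib_left[symmetric]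
  by (simp only: sum_psubst_axis)

lemma lookup_generator_bracket:
  "scl (fact n) (Poly_Mapping.lookup (sv_bracket (axis g 1) b) (Poly_Mapping.single 0 n)) = act (g, n) b"
proof -
  have "smult (fact n) (Poly_Mapping.lookup (sv_bracket (axis g 1) b) (Poly_Mapping.single 0 n) $ k) = act (g, n) b $ k" for k
  proof -
    have "coord k (sv_bracket (axis g 1) b) = (\<Sum>h\<in>UNIV. psubst (b $ h) (dd + lam 0) * tab g h k)"
      unfolding coord_bracket mult.assoc sum_distrib_left[symmetric] sum_psubst_axis ..
    then have "Poly_Mapping.lookup (sv_bracket (axis g 1) b) (Poly_Mapping.single 0 n) $ k =
      (\<Sum>h\<in>UNIV. Poly_Mapping.lookup (psubst (b $ h) (dd + lam 0) * tab g h k) (Poly_Mapping.single 0 n))"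
      by (simp add: lookup_coord[symmetric] lookup_sum)
    moreover have "smult (fact n) (Poly_Mapping.lookup (psubst (b $ h) (dd + lam 0) * tab g h k) (Poly_Mapping.single 0 n)) =
       (if k = tgt g h then amap g h n (b $ h) else 0)" for h
      using lookup_action[of n "b $ h" 0 g h] by (simp add: tab_eq)
    ultimately show ?thesis by (simp add: smult_sum_right)
  qed
  then show ?thesis by (simp add: vec_eq_iff)
qed

text \<open>
  The zeroth and first products, by sesquilinearity in the first argument.
\<close>
lemma bracket_coefficients:
  shows "Poly_Mapping.lookup (sv_bracket a b) 0 = (\<Sum>g\<in>UNIV. scl (coeff (a $ g) 0) (act (g, 0) b))"
    and "Poly_Mapping.lookup (sv_bracket a b) (Poly_Mapping.single 0 1) =
      (\<Sum>g\<in>UNIV. scl (coeff (a $ g) 0) (act (g, 1) b) - scl (coeff (a $ g) 1) (act (g, 0) b))"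
proof -
  have 0: "Poly_Mapping.lookup (coord k (sv_bracket (axis g 1) b)) 0 = act (g, 0) b $ k" for g k
    using lookup_generator_bracket[of 0 g b] by (simp add: lookup_coord del: act.simps)
  have 1: "Poly_Mapping.lookup (coord k (sv_bracket (axis g 1) b)) (Poly_Mapping.single 0 1) = act (g, 1) b $ k" for g k
    using lookup_generator_bracket[of 1 g b] by (simp add: lookup_coord del: act.simps)
  have "Poly_Mapping.lookup (sv_bracket a b) 0 $ k = (\<Sum>g\<in>UNIV. scl (coeff (a $ g) 0) (act (g, 0) b)) $ k" for k
    unfolding lookup_coord[symmetric] coord_bracket_left[of k a b] lookup_sum lookup_psubst_neg 0 by (simp del: act.simps)
  then show "Poly_Mapping.lookup (sv_bracket a b) 0 = (\<Sum>g\<in>UNIV. scl (coeff (a $ g) 0) (act (g, 0) b))"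
    by (simp only: vec_eq_iff) simp
  have "Poly_Mapping.lookup (sv_bracket a b) (Poly_Mapping.single 0 1) $ k =
      (\<Sum>g\<in>UNIV. scl (coeff (a $ g) 0) (act (g, 1) b) - scl (coeff (a $ g) 1) (act (g, 0) b)) $ k" for k
    unfolding lookup_coord[symmetric] coord_bracket_left[of k a b] lookup_sum lookup_psubst_neg 0 1 by (simp del: act.simps)
  then show "Poly_Mapping.lookup (sv_bracket a b) (Poly_Mapping.single 0 1) =
      (\<Sum>g\<in>UNIV. scl (coeff (a $ g) 0) (act (g, 1) b) - scl (coeff (a $ g) 1) (act (g, 0) b))"
    by (simp only: vec_eq_iff) simp
qed

lemma act_zero_nth:
  "act (g, 0) b $ k = (\<Sum>h\<in>UNIV. if k = tgt g h then smult (alpha g h) (pCons 0 (b $ h)) + smult (gamma g h) (b $ h) else 0)"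
  by (simp add: amap_def cong: if_cong)

lemma act_one_nth:
  "act (g, Suc 0) b $ k = (\<Sum>h\<in>UNIV. if k = tgt g h then smult (alpha g h) (pCons 0 (pderiv (b $ h))) +
     smult (beta g h) (b $ h) + smult (gamma g h) (pderiv (b $ h)) else 0)"
  by (simp add: amap_def Dn_Suc cong: if_cong)

text \<open>
  The products with \<open>L\<close>, \<open>M\<close> and \<open>N\<close> detect the four coefficients.
\<close>
lemma central_coefficients:
  fixes c :: "sv_gen \<Rightarrow> 'f::field_char_0"
  assumes "\<And>b. (\<Sum>g\<in>UNIV. scl (c g) (act (g, 0) b)) = 0"
  shows "c g = 0"
proof -
  have e: "coeff ((\<Sum>g\<in>UNIV. scl (c g) (act (g, 0) (axis h 1))) $ k) j = 0" for h k j
    unfolding assms by simp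
  have "c Gen_L = 0" "c Gen_Y = 0" "c Gen_N = 0" "c Gen_M = 0"
    using e[of Gen_L Gen_L 1] e[of Gen_L Gen_Y 1] e[of Gen_M Gen_M 0] e[of Gen_N Gen_M 0]
    by (simp_all add: sum_gen act_zero_nth axis_def del: act.simps)
  then show ?thesis by (cases g) auto
qed

theorem casimir_trivial:
  assumes "X \<in> casimir_elements (sv_scale :: 'f::field_char_0 poly \<Rightarrow> 'f sv \<Rightarrow> 'f sv) sv_bracket"
  shows "X = integral_class sv_scale 0"
proof -
  obtain a where X: "X = integral_class sv_scale a" and a: "\<And>b. bracket_at_0 sv_bracket a b = 0"
    using assms by (auto simp: casimir_elements_def)
  have "coeff (a $ g) 0 = 0" for g
    by (rule central_coefficients) (use a in \<open>simp add: bracket_at_0_def bracket_coefficients(1) del: act.simps\<close>)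
  then have "\<exists>p. a $ g = pCons 0 p" for g by (metis coeff_pCons_0 pCons_cases)
  then obtain p where p: "\<And>g. a $ g = pCons 0 (p g)" by metis
  have ap: "a = sv_scale [:0, 1:] (\<chi> g. p g)" by (simp add: vec_eq_iff p)
  have add: "sv_scale q (u + v) = sv_scale q u + sv_scale q v" and min: "sv_scale q (u - v) = sv_scale q u - sv_scale q v"
    for q and u v :: "'f sv" by (simp_all add: vec_eq_iff algebra_simps)
  show ?thesis
    unfolding X integral_class_def
  proof safe
    fix b show "\<exists>b'. a + sv_scale [:0, 1:] b = 0 + sv_scale [:0, 1:] b' \<and> True"
      by (intro exI[of _ "(\<chi> g. p g) + b"]) (simp only: ap add, simp)
  next
    fix b show "\<exists>b'. 0 + sv_scale [:0, 1:] b = a + sv_scale [:0, 1:] b' \<and> True"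
      by (intro exI[of _ "b - (\<chi> g. p g)"]) (simp only: ap min, simp)
  qed
qed

text \<open>
  The zeroth product with \<open>L\<close> is \<open>\<partial>\<close>, which commutes with \<open>D\<close>; so \<open>D L\<close> acts trivially by its zeroth
  product and has zero constant term.  The first product with \<open>L\<close> is diagonal, and the rule for it
  determines every coefficient of \<open>D g\<close> whose weight differs from that of \<open>g\<close>, in terms of the
  linear terms \<open>eL\<close> and \<open>eY\<close> of \<open>D L\<close> (those along \<open>M\<close> and \<open>N\<close> vanish).  The zeroth product with \<open>N\<close>
  and the first with \<open>Y\<close> leave two more parameters, \<open>m\<close> and \<open>t\<close>, and the derivation with all these
  parameters is the zeroth product with \<open>eL L + 2 eY Y - (m/2) M + t N\<close>.
\<close>
theorem derivation_inner:
  assumes D: "derivation (sv_scale :: 'f::field_char_0 poly \<Rightarrow> 'f sv \<Rightarrow> 'f sv) sv_bracket D"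
  shows "inner_derivation sv_bracket D"
proof -
  have hom: "module_hom sv_scale sv_scale D" and der: "\<And>a b. Poly_Mapping.map D (sv_bracket a b) = sv_bracket a (D b) + sv_bracket (D a) b"
    using D by (auto simp: derivation_def)
  interpret D: module_hom sv_scale sv_scale D by (rule hom)
  define G where "G = (\<lambda>g. D (axis g 1))"
  have Gg: "D (axis g 1) = G g" for g by (simp add: G_def)
  have lk: "D (Poly_Mapping.lookup (sv_bracket a b) m) = Poly_Mapping.lookup (sv_bracket a (D b)) m + Poly_Mapping.lookup (sv_bracket (D a) b) m" for a b m
    using arg_cong[OF der[of a b], of "\<lambda>w. Poly_Mapping.lookup w m"] by (cases "Poly_Mapping.lookup (sv_bracket a b) m = 0") (simp_all add: lookup_add map.rep_eq when_def D.zero)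
  have ax: "coeff (axis g (1 :: 'f poly) $ h) n = (if h = g \<and> n = 0 then 1 else 0)" for g h n
    by (auto simp: axis_def coeff_1)
  have one: "(\<Sum>h\<in>UNIV. scl (if h = g then 1 else 0) (V h)) = V g" for g and V :: "sv_gen \<Rightarrow> 'f sv"
    by (cases g) (simp_all add: sum_gen vec_eq_iff)
  have D0: "D (act (g, 0) b) = act (g, 0) (D b) + (\<Sum>h\<in>UNIV. scl (coeff (G g $ h) 0) (act (h, 0) b))" for g b
    using lk[of "axis g 1" b 0] unfolding bracket_coefficients G_def ax by (simp add: one del: act.simps)
  have D1: "D (act (g, 1) b) = act (g, 1) (D b) +
     (\<Sum>h\<in>UNIV. scl (coeff (G g $ h) 0) (act (h, 1) b) - scl (coeff (G g $ h) 1) (act (h, 0) b))" for g b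
    using lk[of "axis g 1" b "Poly_Mapping.single 0 1"] unfolding bracket_coefficients G_def ax by (simp add: one del: act.simps)
  have "(\<Sum>h\<in>UNIV. scl (coeff (G Gen_L $ h) 0) (act (h, 0) b)) = 0" for b
  proof -
    have "act (Gen_L, 0) v = sv_scale [:0, 1:] v" for v :: "'f sv"
    proof -
      have "act (Gen_L, 0) v $ k = sv_scale [:0, 1:] v $ k" for k
        by (cases k) (simp_all add: act_zero_nth sum_gen del: act.simps)
      then show ?thesis unfolding vec_eq_iff by blast
    qed
    then show ?thesis using D0[of Gen_L b] by (simp add: D.scale del: act.simps)
  qed
  then have L0: "coeff (G Gen_L $ h) 0 = 0" for h by (rule central_coefficients)
  define eL eM eY eN where "eL = coeff (G Gen_L $ Gen_L) 1" and "eM = coeff (G Gen_L $ Gen_M) 1"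
    and "eY = coeff (G Gen_L $ Gen_Y) 1" and "eN = coeff (G Gen_L $ Gen_N) 1"
  have wt: "act (Gen_L, 1) (axis g (1 :: 'f poly)) = scl (beta Gen_L g) (axis g 1)" for g :: sv_gen
  proof -
    have "act (Gen_L, 1) (axis g 1) $ k = scl (beta Gen_L g) (axis g (1 :: 'f poly)) $ k" for k
      by (cases g; cases k) (simp_all add: act_one_nth sum_gen axis_def del: act.simps)
    then show ?thesis unfolding vec_eq_iff by blast
  qed
  have cw: "coeff (act (Gen_L, Suc 0) v $ k) j = (of_nat j + beta Gen_L k) * coeff (v $ k) j" for v :: "'f sv" and k j
  proof -
    have "coeff (pCons 0 (pderiv p)) j = of_nat j * coeff p j" for p :: "'f poly"
      by (cases j) (simp_all add: coeff_pderiv)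
    then show ?thesis
      by (cases k) (simp_all add: act_one_nth sum_gen algebra_simps del: act.simps)
  qed
  \<comment> \<open>The rule for the first product with \<open>L\<close>: the left factor is the weight of \<open>g\<close> minus that of \<open>\<partial>\<^sup>j k\<close>.\<close>
  have K: "(beta Gen_L g - of_nat j - beta Gen_L k) * coeff (G g $ k) j =
      - coeff ((scl eL (act (Gen_L, 0) (axis g 1)) + scl eM (act (Gen_M, 0) (axis g 1)) + scl eY (act (Gen_Y, 0) (axis g 1)) + scl eN (act (Gen_N, 0) (axis g 1))) $ k) j"
    for g k j
  proof -
    have "D (scl (beta Gen_L g) (axis g 1)) = scl (beta Gen_L g) (G g)" by (simp add: D.scale G_def)
    then have "scl (beta Gen_L g) (G g) = act (Gen_L, 1) (G g) - (scl eL (act (Gen_L, 0) (axis g 1)) + scl eM (act (Gen_M, 0) (axis g 1)) + scl eY (act (Gen_Y, 0) (axis g 1)) + scl eN (act (Gen_N, 0) (axis g 1)))"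
      using D1[of Gen_L "axis g 1"] unfolding wt Gg
      by (simp add: L0 sum_gen eL_def eM_def eY_def eN_def algebra_simps del: act.simps)
    from arg_cong[OF this, of "\<lambda>v. coeff (v $ k) j"] show ?thesis
      by (simp add: cw algebra_simps del: act.simps)
  qed
  note S = sum_gen act_zero_nth axis_def
  \<comment> \<open>In the next two instances the weights agree.\<close>
  have eM: "eM = 0" using K[of Gen_N 0 Gen_M] by (simp add: S del: act.simps)
  have eN: "eN = 0" using K[of Gen_M 0 Gen_M] by (simp add: S del: act.simps)
  define m t where "m = coeff (G Gen_N $ Gen_M) 0" and "t = coeff (G Gen_Y $ Gen_Y) 0"
  have K': "(beta Gen_L g - of_nat j - beta Gen_L k) * coeff (G g $ k) j =
      - (eL * coeff (act (Gen_L, 0) (axis g 1) $ k) j + eY * coeff (act (Gen_Y, 0) (axis g 1) $ k) j)" for g k j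
    using K[of g j k] by (simp add: eM eN del: act.simps)
  define A where "A = (\<chi> g. case g of Gen_L \<Rightarrow> [:eL:] | Gen_Y \<Rightarrow> [:2 * eY:] | Gen_M \<Rightarrow> [:- m / 2:] | Gen_N \<Rightarrow> [:t:])"
  have A: "A $ Gen_L = [:eL:]" "A $ Gen_Y = [:2 * eY:]" "A $ Gen_M = [:- m / 2:]" "A $ Gen_N = [:t:]"
    by (simp_all add: A_def)
  have B: "bracket_at_0 sv_bracket A b = scl eL (act (Gen_L, 0) b) + scl (- m / 2) (act (Gen_M, 0) b) + scl (2 * eY) (act (Gen_Y, 0) b) + scl t (act (Gen_N, 0) b)" for b
    by (simp add: bracket_at_0_def bracket_coefficients(1) sum_gen A del: act.simps)
  have MN: "coeff (G Gen_M $ Gen_N) 0 = 0" and NN: "coeff (G Gen_N $ Gen_N) 0 = 0"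
  proof -
    have a: "act (Gen_N, 0) (axis Gen_M (1 :: 'f poly)) = scl 2 (axis Gen_M 1)"
    proof -
      have "act (Gen_N, 0) (axis Gen_M (1 :: 'f poly)) $ k = scl 2 (axis Gen_M 1) $ k" for k
        by (cases k) (simp_all add: S numeral_poly del: act.simps)
      then show ?thesis unfolding vec_eq_iff by blast
    qed
    have e: "scl 2 (G Gen_M) = act (Gen_N, 0) (G Gen_M) + (\<Sum>h\<in>UNIV. scl (coeff (G Gen_N $ h) 0) (act (h, 0) (axis Gen_M 1)))"
      using D0[of Gen_N "axis Gen_M 1"] unfolding a by (simp add: D.scale Gg del: act.simps)
    show "coeff (G Gen_M $ Gen_N) 0 = 0"
      using arg_cong[OF e, of "\<lambda>v. coeff (v $ Gen_N) 0"] by (simp add: S del: act.simps)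
    show "coeff (G Gen_N $ Gen_N) 0 = 0"
      using arg_cong[OF e, of "\<lambda>v. coeff (v $ Gen_M) 0"] by (simp add: S del: act.simps)
  qed
  have MM: "coeff (G Gen_M $ Gen_M) 0 = 2 * t"
  proof -
    have a: "act (Gen_Y, 1) (axis Gen_Y (1 :: 'f poly)) = scl 2 (axis Gen_M 1)"
    proof -
      have "act (Gen_Y, 1) (axis Gen_Y (1 :: 'f poly)) $ k = scl 2 (axis Gen_M 1) $ k" for k
        by (cases k) (simp_all add: sum_gen act_one_nth axis_def del: act.simps)
      then show ?thesis unfolding vec_eq_iff by blast
    qed
    have e: "scl 2 (G Gen_M) = act (Gen_Y, 1) (G Gen_Y) + (\<Sum>h\<in>UNIV. scl (coeff (G Gen_Y $ h) 0) (act (h, 1) (axis Gen_Y 1))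
        - scl (coeff (G Gen_Y $ h) 1) (act (h, 0) (axis Gen_Y 1)))"
      using D1[of Gen_Y "axis Gen_Y 1"] unfolding a by (simp add: D.scale Gg del: act.simps)
    have "2 * coeff (G Gen_M $ Gen_M) 0 = 2 * t + 2 * t"
      using arg_cong[OF e, of "\<lambda>v. coeff (v $ Gen_M) 0"] by (simp add: S act_one_nth t_def del: act.simps)
    then show ?thesis by simp
  qed
  have gen: "G g = bracket_at_0 sv_bracket A (axis g 1)" for g
  proof (rule sv_eqI)
    fix k j
    show "coeff (G g $ k) j = coeff (bracket_at_0 sv_bracket A (axis g 1) $ k) j"
    proof (cases "beta Gen_L g - of_nat j - beta Gen_L k = (0 :: 'f)")
      case False
      have "(beta Gen_L g - of_nat j - beta Gen_L k) * coeff (G g $ k) j =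
          (beta Gen_L g - of_nat j - beta Gen_L k) * coeff (bracket_at_0 sv_bracket A (axis g 1) $ k) j"
        unfolding K' B using MM MN
        by (cases g; cases k; cases j; cases "j - 1"; simp add: S del: act.simps)
      with False show ?thesis by (metis mult_left_cancel)
    next
      case True
      have b: "2 * beta Gen_L g = (of_int (weight2 g) :: 'f)" for g
        by (cases g) (simp_all add: weight2_def)
      have "(of_int (weight2 g - 2 * int j - weight2 k) :: 'f) = 2 * (beta Gen_L g - of_nat j - beta Gen_L k)"
        by (simp add: b[symmetric] algebra_simps)
      then have "weight2 g - 2 * int j - weight2 k = 0" unfolding True by (simp only: mult_zero_right of_int_eq_0_iff)
      then have "2 * int j = weight2 g - weight2 k" by simp
      then consider "g = k" "j = 0" | "g = Gen_L" "k = Gen_M" "j = 1" | "g = Gen_L" "k = Gen_N" "j = 1"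
        | "g = Gen_M" "k = Gen_N" "j = 0" | "g = Gen_N" "k = Gen_M" "j = 0"
        by (cases g; cases k; simp add: weight2_def; presburger)
      then show ?thesis
      proof cases
        case 1
        then show ?thesis by (cases k) (simp_all add: L0 MM NN t_def B S del: act.simps)
      qed (use eM eN MN in \<open>simp_all add: eM_def eN_def m_def B S del: act.simps\<close>)
    qed
  qed
  have "D b = bracket_at_0 sv_bracket A b" for b
  proof -
    have b: "b = (\<Sum>g\<in>UNIV. sv_scale (b $ g) (axis g 1))"
      unfolding vec_eq_iff
    proof
      fix k show "b $ k = (\<Sum>g\<in>UNIV. sv_scale (b $ g) (axis g 1)) $ k"
        by (cases k) (simp_all add: sum_gen axis_def)
    qed
    have "D b = (\<Sum>g\<in>UNIV. sv_scale (b $ g) (G g))"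
      by (subst b) (simp add: D.sum D.scale G_def)
    also have "\<dots> = bracket_at_0 sv_bracket A b"
    proof -
      have "(\<Sum>g\<in>UNIV. sv_scale (b $ g) (G g)) $ k = bracket_at_0 sv_bracket A b $ k" for k
        unfolding gen B by (cases k) (simp_all add: S algebra_simps del: act.simps)
      then show ?thesis unfolding vec_eq_iff by blast
    qed
    finally show ?thesis .
  qed
  then show ?thesis unfolding inner_derivation_def by blast
qed

section \<open>Vanishing of the adjoint cohomology\<close>

theorem theorem4p13:
  shows
    "(\<forall>q. trivial_group
        (basic_cohomology (sv_scale :: 'f::field_char_0 poly \<Rightarrow> 'f sv \<Rightarrow> 'f sv) sv_bracket
           sv_scale sv_bracket q)) \<and>
     (\<forall>q. trivial_group
        (reduced_cohomology (sv_scale :: 'f poly \<Rightarrow> 'f sv \<Rightarrow> 'f sv) sv_bracket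
           sv_scale sv_bracket q)) \<and>
     (\<forall>X \<in> casimir_elements (sv_scale :: 'f poly \<Rightarrow> 'f sv \<Rightarrow> 'f sv) sv_bracket.
        X = integral_class sv_scale 0) \<and>
     (\<forall>D. derivation (sv_scale :: 'f poly \<Rightarrow> 'f sv \<Rightarrow> 'f sv) sv_bracket D \<longrightarrow>
        inner_derivation sv_bracket D)"
  by (intro conjI allI ballI impI)
    (fact basic_cohomology_trivial reduced_cohomology_trivial | erule casimir_trivial derivation_inner)+

end
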